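(* For every $\epsilon>0$ there exists a constant $c_\epsilon>0$ such that for every integer $N\ge2$ and every convex sequence $A\subset\mathbb{R}$ of cardinality $N$ (with $c_\epsilon$ independent of $A$), $$|A-A|\geq c_\epsilon|A|^{5/3-\epsilon},\qquad |A+A|\geq c_\epsilon|A|^{8/5-\epsilon}.$$
   Context: A finite sequence of real numbers $A=\{a_1<a_2<\cdots<a_N\}$ with $N>1$ (identified with the set of its terms) is convex if $a_{k+1}-a_k>a_k-a_{k-1}$ for all integers $2\le k\le N-1$. Moreover $A\pm A=\{a\pm a':a,a'\in A\}$. *)

theory Defs
  imports Complex_Main
begin

text \<open>
  The finite sequence \<open>a\<^sub>1 < \<dots> < a\<^sub>N\<close> is given by the values on \<open>{1..N}\<close> of a function on the
  naturals; values outside this range are irrelevant.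
\<close>
definition convex_seq :: "nat \<Rightarrow> (nat \<Rightarrow> real) \<Rightarrow> bool" where
  "convex_seq N a \<longleftrightarrow> N > 1 \<and> strict_mono_on {1..N} a \<and>
     (\<forall>k\<in>{2..N - 1}. a (k + 1) - a k > a k - a (k - 1))"

text \<open>
  Minkowski sum and difference. The symbol \<open>-\<close> on sets is set difference in HOL, hence separate names.
\<close>
definition sumset :: "real set \<Rightarrow> real set \<Rightarrow> real set" where
  "sumset A B = {a + b | a b. a \<in> A \<and> b \<in> B}"

definition diffset :: "real set \<Rightarrow> real set \<Rightarrow> real set" where
  "diffset A B = {a - b | a b. a \<in> A \<and> b \<in> B}"

end

theory Submission
  imports Defs "HOL-Analysis.Analysis"
begin

text \<open>
  For a finite set \<open>A\<close> of \<open>n\<close> reals let \<open>J\<close> be the number of solutions of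
  \<open>x\<^sub>1 + x\<^sub>2 + x\<^sub>3 = y\<^sub>1 + y\<^sub>2 + y\<^sub>3\<close> in \<open>A\<close>, and let \<open>E = (\<Sum>d. r d ^ 3)\<close>, where \<open>r d\<close> counts the
  representations of \<open>d\<close> as a difference. Weighted counting of triples \<open>(a, b, c)\<close> through the pairs
  \<open>(a - b, b - c)\<close> or \<open>(a + b, b + c)\<close> gives, for every \<open>A\<close>, with \<open>D\<close> and \<open>S\<close> the sets of differences and of sums,
  \<open>n ^ 12 \<le> card D ^ 3 * E * J\<close> and \<open>n ^ 18 \<le> 2 ^ 14 * card S ^ 5 * E ^ 2 * J\<close>
  (\<open>difference_set_bound\<close>, \<open>sumset_bound\<close>). For a convex sequence of length \<open>N\<close> an elementary argument
  with consecutive representations bounds \<open>E\<close> by \<open>N ^ 3\<close> up to logarithms (\<open>cubic_energy_le\<close>). So the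
  exponents \<open>5/3\<close> and \<open>8/5\<close> follow from \<open>J\<close> being at most \<open>N powr (4 + \<epsilon>)\<close> on a subset of \<open>A\<close> with
  at least \<open>c * N\<close> elements; passing to such a subset only decreases the two sets that are to be
  bounded from below.

  To bound \<open>J\<close>, replace \<open>a i\<close> by the point \<open>(i, a i)\<close> of the plane. The sum of indices takes \<open>O(N)\<close>
  values, so it is enough that \<open>J\<close> for these points is at most \<open>N powr (3 + \<epsilon>)\<close>. This is a discrete
  form of \<open>l\<^sup>2\<close> decoupling for curves at the critical exponent six. Nothing is known about the sizes of the
  second differences of \<open>a\<close>, and this is handled by the choice of the subset. It is a tree: with
  \<open>K \<approx> N powr (1/d)\<close> and \<open>d\<close> constant, every interval of length \<open>K ^ (h + 1)\<close> keeps a constant fraction of its \<open>K\<close>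
  subintervals of length \<open>K ^ h\<close> such that the slope of the curve increases on each of them by at
  most \<open>2/K\<close> of the increase on the parent, and such that any two of them are \<open>tame\<close>: either both slope
  increases are at most \<open>K\<close> times the slope gap between the two, or one of them is negligible
  compared with this gap. Such a selection exists because the graph of pairs that are not tame is
  degenerate, so that it has a large independent set (\<open>tame_subset_exists\<close>).

  On such a tree the bound follows by induction on the height (\<open>sixth_moment_branch\<close>). Relations
  that are not confined to one child are controlled by mixed moments of two tame siblings. If one sibling is
  flat, these are estimated at once. If both are balanced, \<open>bilinear_chain\<close> applies: the slope
  gap forces \<open>x\<close> and \<open>x'\<close> in \<open>x + y\<^sub>1 + y\<^sub>2 = x' + y\<^sub>3 + y\<^sub>4\<close> to be close when the \<open>y\<^sub>i\<close> lie in a short block, which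
  localises \<open>x\<close> to blocks of about squared relative length; Cauchy-Schwarz then exchanges the roles of the two
  siblings. Each round saves the same power of the number of children, and a bounded number of
  rounds pays for all losses.
\<close>

section \<open>Counting additive relations between sets\<close>

text \<open>
  \<open>reps Xs z\<close> counts the tuples in the product of the listed sets that add up to \<open>z\<close>; it is the
  convolution of their indicator functions. All moments below are values at \<open>0\<close> for lists in which
  complex conjugation of a Fourier transform is replaced by negation of a set.
\<close>

primrec reps :: "'v::ab_group_add set list \<Rightarrow> 'v \<Rightarrow> real" where
  "reps [] z = (if z = 0 then 1 else 0)"
| "reps (X # Xs) z = (\<Sum>x\<in>X. reps Xs (z - x))"

primrec sums_of :: "'v::ab_group_add set list \<Rightarrow> 'v set" where
  "sums_of [] = {0}"
| "sums_of (X # Xs) = (\<lambda>(x, y). x + y) ` (X \<times> sums_of Xs)"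

abbreviation neg :: "'v::ab_group_add set \<Rightarrow> 'v set" where
  "neg X \<equiv> uminus ` X"

lemma neg_neg [simp]: "neg (neg X) = X"
  by (simp add: image_image)

lemma reps_nonneg [simp]: "0 \<le> reps Xs z"
  by (induction Xs arbitrary: z) (auto intro: sum_nonneg)

lemma finite_sums_of: "(\<And>X. X \<in> set Xs \<Longrightarrow> finite X) \<Longrightarrow> finite (sums_of Xs)"
  by (induction Xs) auto

lemma reps_swap: "reps (X # Y # Zs) z = reps (Y # X # Zs) z"
  by (simp, subst sum.swap) (simp add: diff_diff_eq add.commute)

lemma reps_move_front: "reps (Ys @ X # Zs) z = reps (X # Ys @ Zs) z"
proof (induction Ys arbitrary: z)
  case (Cons Y Ys)
  have "reps ((Y # Ys) @ X # Zs) z = reps (Y # X # Ys @ Zs) z"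
    using Cons.IH by simp
  then show ?case by (metis reps_swap append_Cons)
qed simp

lemma reps_perm: "mset Xs = mset Ys \<Longrightarrow> reps Xs z = reps Ys z"
proof (induction Xs arbitrary: Ys z)
  case (Cons X Xs)
  obtain Y1 Y2 where Y: "Ys = Y1 @ X # Y2"
    by (metis Cons.prems list.set_intros(1) set_mset_mset split_list)
  have "mset Xs = mset (Y1 @ Y2)" using Cons.prems Y by simp
  then have "reps Xs w = reps (Y1 @ Y2) w" for w by (rule Cons.IH)
  then have "reps (X # Xs) z = reps (X # Y1 @ Y2) z" by simp
  also have "\<dots> = reps Ys z" using Y reps_move_front by metis
  finally show ?case .
qed simp

lemma reps_neg: "reps (map neg Xs) z = reps Xs (- z)"
proof (induction Xs arbitrary: z)
  case (Cons X Xs)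
  have "reps (map neg (X # Xs)) z = (\<Sum>x\<in>X. reps (map neg Xs) (z + x))"
    by (simp add: sum.reindex)
  also have "\<dots> = (\<Sum>x\<in>X. reps Xs (- z - x))"
    using Cons.IH by simp
  finally show ?case by simp
qed simp

lemma reps_append:
  assumes "finite F" "sums_of Xs \<subseteq> F"
  shows "reps (Xs @ Ys) z = (\<Sum>w\<in>F. reps Xs w * reps Ys (z - w))"
  using assms
proof (induction Xs arbitrary: F z)
  case Nil
  have "(\<Sum>w\<in>F. reps [] w * reps Ys (z - w)) = (\<Sum>w\<in>{0}. reps [] w * reps Ys (z - w))"
    using Nil by (intro sum.mono_neutral_right) auto
  then show ?case by simp
next
  case (Cons X Xs)
  have *: "reps (Xs @ Ys) (z - x) = (\<Sum>w\<in>F. reps Xs (w - x) * reps Ys (z - w))" if "x \<in> X" for x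
  proof -
    have inj: "inj_on (\<lambda>w. w - x) F" by (simp add: inj_on_def)
    have "reps (Xs @ Ys) (z - x) = (\<Sum>w\<in>(\<lambda>w. w - x) ` F. reps Xs w * reps Ys (z - x - w))"
    proof (rule Cons.IH)
      show "finite ((\<lambda>w. w - x) ` F)" using Cons.prems by simp
      show "sums_of Xs \<subseteq> (\<lambda>w. w - x) ` F"
      proof
        fix y assume "y \<in> sums_of Xs"
        then have "x + y \<in> F" using Cons.prems that by force
        then show "y \<in> (\<lambda>w. w - x) ` F" by (intro image_eqI[of _ _ "x + y"]) auto
      qed
    qed
    also have "\<dots> = (\<Sum>w\<in>F. reps Xs (w - x) * reps Ys (z - w))"
      by (subst sum.reindex[OF inj]) (simp add: algebra_simps)
    finally show ?thesis .
  qed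
  have "reps ((X # Xs) @ Ys) z = (\<Sum>x\<in>X. \<Sum>w\<in>F. reps Xs (w - x) * reps Ys (z - w))"
    using * by simp
  also have "\<dots> = (\<Sum>w\<in>F. \<Sum>x\<in>X. reps Xs (w - x) * reps Ys (z - w))"
    by (rule sum.swap)
  finally show ?case by (simp add: sum_distrib_right)
qed

lemma reps_square:
  assumes "finite F" "sums_of Xs \<subseteq> F"
  shows "(\<Sum>w\<in>F. (reps Xs w)\<^sup>2) = reps (Xs @ map neg Xs) 0"
  by (subst reps_append[OF assms]) (simp add: reps_neg power2_eq_square)

text \<open>
  Any splitting of the factors into two groups bounds the count by two symmetric counts. Together
  with \<open>reps_perm\<close> this replaces every use of Hoelder's inequality for the moments.
\<close>

lemma reps_Cauchy_Schwarz:
  assumes "\<And>X. X \<in> set Xs \<Longrightarrow> finite X" "\<And>Y. Y \<in> set Ys \<Longrightarrow> finite Y"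
  shows "(reps (Xs @ Ys) z)\<^sup>2 \<le> reps (Xs @ map neg Xs) 0 * reps (Ys @ map neg Ys) 0"
proof -
  define F where "F = sums_of Xs \<union> (\<lambda>w. z - w) ` sums_of Ys"
  have F: "finite F" "sums_of Xs \<subseteq> F"
    using finite_sums_of assms unfolding F_def by auto
  have inj: "inj_on (\<lambda>w. z - w) F" by (simp add: inj_on_def)
  have G: "finite ((\<lambda>w. z - w) ` F)" "sums_of Ys \<subseteq> (\<lambda>w. z - w) ` F"
    using finite_sums_of assms unfolding F_def by (auto simp: image_Un image_image)
  have "(reps (Xs @ Ys) z)\<^sup>2 = (\<Sum>w\<in>F. reps Xs w * reps Ys (z - w))\<^sup>2"
    by (subst reps_append[OF F]) simp
  also have "\<dots> \<le> (\<Sum>w\<in>F. (reps Xs w)\<^sup>2) * (\<Sum>w\<in>F. (reps Ys (z - w))\<^sup>2)"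
    by (rule Cauchy_Schwarz_ineq_sum)
  also have "(\<Sum>w\<in>F. (reps Ys (z - w))\<^sup>2) = (\<Sum>w\<in>(\<lambda>w. z - w) ` F. (reps Ys w)\<^sup>2)"
    by (subst sum.reindex[OF inj]) simp
  finally show ?thesis by (simp add: reps_square[OF F] reps_square[OF G])
qed

lemma reps_witness:
  "reps Xs z \<noteq> 0 \<Longrightarrow> \<exists>xs. list_all2 (\<in>) xs Xs \<and> sum_list xs = z"
proof (induction Xs arbitrary: z)
  case (Cons X Xs)
  then obtain x where x: "x \<in> X" "reps Xs (z - x) \<noteq> 0"
    by (metis (no_types, lifting) reps.simps(2) sum.neutral)
  then obtain xs where "list_all2 (\<in>) xs Xs" "sum_list xs = z - x" using Cons.IH by blast
  then show ?case using x by (intro exI[of _ "x # xs"]) auto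
qed (auto split: if_splits)

lemma reps_expand:
  assumes "finite S" "\<And>f j. f \<in> set fs \<Longrightarrow> j \<in> S \<Longrightarrow> finite (f j)"
    "\<And>f i j. f \<in> set fs \<Longrightarrow> i \<in> S \<Longrightarrow> j \<in> S \<Longrightarrow> i \<noteq> j \<Longrightarrow> f i \<inter> f j = {}"
  shows "reps (map (\<lambda>f. \<Union>j\<in>S. f j) fs @ Zs) z =
    (\<Sum>js | set js \<subseteq> S \<and> length js = length fs. reps (map2 (\<lambda>f j. f j) fs js @ Zs) z)"
  using assms
proof (induction fs arbitrary: z)
  case Nil
  have "{js. set js \<subseteq> S \<and> length js = 0} = {[]}" by auto
  then show ?case by simp
next
  case (Cons f fs)
  let ?L = "\<lambda>n. {js. set js \<subseteq> S \<and> length js = n}"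
  have L: "?L (Suc n) = (\<lambda>(j, js). j # js) ` (S \<times> ?L n)" for n
    by (auto simp: image_iff length_Suc_conv)
  have inj: "inj_on (\<lambda>(j, js). j # js) (S \<times> ?L n)" for n by (auto simp: inj_on_def)
  have IH: "reps (map (\<lambda>f. \<Union>j\<in>S. f j) fs @ Zs) z' =
    (\<Sum>js\<in>?L (length fs). reps (map2 (\<lambda>f j. f j) fs js @ Zs) z')" for z'
    using Cons by (intro Cons.IH) auto
  have "reps (map (\<lambda>f. \<Union>j\<in>S. f j) (f # fs) @ Zs) z =
      (\<Sum>j\<in>S. reps (f j # map (\<lambda>f. \<Union>j\<in>S. f j) fs @ Zs) z)"
    using Cons.prems by (simp add: sum.UNION_disjoint)
  also have "\<dots> = (\<Sum>j\<in>S. \<Sum>js\<in>?L (length fs). reps (f j # map2 (\<lambda>f j. f j) fs js @ Zs) z)"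
    by (intro sum.cong refl) (simp add: IH, rule sum.swap)
  also have "\<dots> = (\<Sum>(j, js)\<in>S \<times> ?L (length fs). reps (f j # map2 (\<lambda>f j. f j) fs js @ Zs) z)"
    by (rule sum.cartesian_product)
  also have "\<dots> = (\<Sum>js\<in>?L (Suc (length fs)). reps (map2 (\<lambda>f j. f j) (f # fs) js @ Zs) z)"
    by (subst L, subst sum.reindex[OF inj]) (auto intro!: sum.cong)
  finally show ?case by simp
qed

text \<open>
  In terms of exponential sums \<open>F\<close> and \<open>G\<close> over \<open>X\<close> and \<open>Y\<close>, the first quantity is the integral of \<open>\<bar>F\<bar> ^ 6\<close> and
  the second one that of \<open>\<bar>F\<bar> ^ 2 * \<bar>G\<bar> ^ 4\<close>.
\<close>

definition sixth_moment :: "'v::ab_group_add set \<Rightarrow> real" where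
  "sixth_moment X = reps [X, X, X, neg X, neg X, neg X] 0"

definition mixed_moment :: "'v::ab_group_add set \<Rightarrow> 'v set \<Rightarrow> real" where
  "mixed_moment X Y = reps [X, neg X, Y, Y, neg Y, neg Y] 0"

lemma sixth_moment_nonneg [simp]: "0 \<le> sixth_moment X" and mixed_moment_nonneg [simp]: "0 \<le> mixed_moment X Y"
  by (simp_all add: sixth_moment_def mixed_moment_def del: reps.simps)

lemma sixth_moment_neg [simp]: "sixth_moment (neg X) = sixth_moment X"
  unfolding sixth_moment_def neg_neg by (rule reps_perm) simp

lemma mixed_moment_neg [simp]: "mixed_moment (neg X) Y = mixed_moment X Y" "mixed_moment X (neg Y) = mixed_moment X Y"
  unfolding mixed_moment_def neg_neg by (rule reps_perm, simp)+

text \<open>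
  The factors are grouped as \<open>\<bar>F\<bar>\<^sup>2 G\<close> and \<open>\<bar>G\<bar>\<^sup>2 G\<close> (up to conjugation). This is the step that exchanges the roles
  of the two sets at the price of the square root of one sixth moment.
\<close>

lemma mixed_moment_Cauchy_Schwarz:
  assumes "finite X" "finite Y"
  shows "(mixed_moment X Y)\<^sup>2 \<le> mixed_moment Y X * sixth_moment Y"
proof -
  have "(reps ([X, neg X, Y] @ [Y, neg Y, neg Y]) 0)\<^sup>2 \<le>
    reps ([X, neg X, Y] @ map neg [X, neg X, Y]) 0 * reps ([Y, neg Y, neg Y] @ map neg [Y, neg Y, neg Y]) 0"
    using assms by (intro reps_Cauchy_Schwarz) auto
  also have "reps ([X, neg X, Y] @ map neg [X, neg X, Y]) 0 = mixed_moment Y X"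
    unfolding mixed_moment_def by (rule reps_perm) (simp add: image_image)
  also have "reps ([Y, neg Y, neg Y] @ map neg [Y, neg Y, neg Y]) 0 = sixth_moment Y"
    unfolding sixth_moment_def by (rule reps_perm) (simp add: image_image)
  finally show ?thesis by (simp add: mixed_moment_def del: reps.simps)
qed

lemma mixed_moment_Hoelder:
  assumes "finite X" "finite Y"
  shows "(mixed_moment X Y) ^ 3 \<le> sixth_moment X * (sixth_moment Y)\<^sup>2"
proof (cases "mixed_moment X Y = 0")
  case False
  then have pos: "mixed_moment X Y > 0" using mixed_moment_nonneg[of X Y] by linarith
  have "(mixed_moment X Y)\<^sup>2 * (mixed_moment X Y)\<^sup>2 \<le> (mixed_moment Y X * sixth_moment Y) * (mixed_moment Y X * sixth_moment Y)"
    using mixed_moment_Cauchy_Schwarz[OF assms] by (intro mult_mono) auto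
  also have "\<dots> = (mixed_moment Y X)\<^sup>2 * (sixth_moment Y)\<^sup>2" by (simp add: power2_eq_square)
  also have "\<dots> \<le> (mixed_moment X Y * sixth_moment X) * (sixth_moment Y)\<^sup>2"
    using mixed_moment_Cauchy_Schwarz[OF assms(2,1)] by (intro mult_right_mono) auto
  finally have "mixed_moment X Y * (mixed_moment X Y ^ 3) \<le> mixed_moment X Y * (sixth_moment X * (sixth_moment Y)\<^sup>2)"
    by (simp add: power2_eq_square power3_eq_cube mult_ac)
  then show ?thesis using pos by simp
qed simp

lemma mixed_moment_le_max:
  assumes "finite X" "finite Y" "sixth_moment X \<le> W" "sixth_moment Y \<le> W"
  shows "mixed_moment X Y \<le> W"
proof -
  have W: "0 \<le> W" using assms sixth_moment_nonneg[of X] by linarith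
  have "mixed_moment X Y ^ 3 \<le> W * W\<^sup>2"
    using mixed_moment_Hoelder[OF assms(1,2)] assms(3,4) W mult_mono[of "sixth_moment X" W "(sixth_moment Y)\<^sup>2" "W\<^sup>2"]
    by (auto intro: order_trans power_mono)
  then have "mixed_moment X Y ^ 3 \<le> W ^ 3" by (simp add: power2_eq_square power3_eq_cube)
  then show ?thesis using W by (simp add: power_mono_iff)
qed

definition triple_moment :: "'v::ab_group_add set \<Rightarrow> 'v set \<Rightarrow> 'v set \<Rightarrow> real" where
  "triple_moment X Y Z = reps ([X, Y, Z] @ map neg [X, Y, Z]) 0"

lemma triple_moment_nonneg [simp]: "0 \<le> triple_moment X Y Z"
  by (simp add: triple_moment_def del: reps.simps)

lemma triple_moment_le:
  assumes "finite X" "finite Y" "finite Z"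
  shows "(triple_moment X Y Z)\<^sup>2 \<le> mixed_moment X Y * mixed_moment X Z"
proof -
  have "triple_moment X Y Z = reps ([X, Y, neg Y] @ [neg X, Z, neg Z]) 0"
    unfolding triple_moment_def by (rule reps_perm) simp
  then have "(triple_moment X Y Z)\<^sup>2 \<le> reps ([X, Y, neg Y] @ map neg [X, Y, neg Y]) 0 *
      reps ([neg X, Z, neg Z] @ map neg [neg X, Z, neg Z]) 0"
    using reps_Cauchy_Schwarz[of "[X, Y, neg Y]" "[neg X, Z, neg Z]" 0] assms by auto
  also have "reps ([X, Y, neg Y] @ map neg [X, Y, neg Y]) 0 = mixed_moment X Y"
    unfolding mixed_moment_def by (rule reps_perm) (simp add: image_image)
  also have "reps ([neg X, Z, neg Z] @ map neg [neg X, Z, neg Z]) 0 = mixed_moment X Z"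
    unfolding mixed_moment_def by (rule reps_perm) (simp add: image_image)
  finally show ?thesis .
qed

lemma triple_moment_le_bound:
  assumes "finite X" "finite Y" "finite Z" "mixed_moment X Y \<le> W" "mixed_moment X Z \<le> W"
  shows "triple_moment X Y Z \<le> W"
proof -
  have W: "0 \<le> W" using assms mixed_moment_nonneg[of X Y] by linarith
  have "(triple_moment X Y Z)\<^sup>2 \<le> W\<^sup>2"
    using triple_moment_le[OF assms(1-3)] mult_mono[OF assms(4,5)] W by (simp add: power2_eq_square)
  then show ?thesis using W by (simp add: power2_le_iff_abs_le)
qed

lemma reps_six_le:
  assumes "finite A" "finite B" "finite C" "finite D" "finite E" "finite F"
  shows "(reps [A, B, C, D, E, F] 0)\<^sup>2 \<le> triple_moment A B C * triple_moment D E F"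
  using reps_Cauchy_Schwarz[of "[A, B, C]" "[D, E, F]" 0] assms unfolding triple_moment_def by auto

text \<open>
  A relation between six sets is controlled by the mixed moment of any two of them that one wishes
  to single out. The exponent \<open>1/4\<close> on that moment is the outcome of two applications of Cauchy-Schwarz.
\<close>

lemma reps_mixed_le:
  assumes len: "length Ys = 6" and ij: "i < 6" "j < 6" "i \<noteq> j"
    and fin: "\<And>Y. Y \<in> set Ys \<Longrightarrow> finite Y" and W: "\<And>Y. Y \<in> set Ys \<Longrightarrow> sixth_moment Y \<le> W"
  shows "(reps Ys 0) ^ 4 \<le> mixed_moment (Ys ! i) (Ys ! j) * W ^ 3"
proof -
  define Y where "Y = Ys ! i"
  define Y' where "Y' = Ys ! j"
  have "mset Ys = image_mset ((!) Ys) (mset_set {..<6})"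
    using len by (metis atLeast0LessThan map_nth mset_map mset_upt)
  moreover have "{#i, j#} \<subseteq># mset_set {..<6::nat}"
    using ij by (simp add: insert_subset_eq_iff in_diff_count)
  ultimately have Yin: "{#Y, Y'#} \<subseteq># mset Ys"
    unfolding Y_def Y'_def by (metis image_mset_add_mset image_mset_empty image_mset_subseteq_mono)
  obtain Zs where "mset Ys - {#Y, Y'#} = mset Zs" using ex_mset by metis
  then have "mset Ys = mset Zs + {#Y, Y'#}" using subset_mset.diff_add[OF Yin] by simp
  then have Zs: "mset Ys = mset (Y # Y' # Zs)" by simp
  have "length Ys = length (Y # Y' # Zs)" using Zs by (metis size_mset)
  then have "length Zs = 4" using len by simp
  then obtain C D E F where Z4: "Zs = [C, D, E, F]"
    by (auto simp: numeral_eq_Suc length_Suc_conv)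
  have set: "set Ys = {Y, Y', C, D, E, F}"
    using Zs Z4 by (metis set_mset_mset list.simps(15) empty_set)
  have f: "finite Y" "finite Y'" "finite C" "finite D" "finite E" "finite F"
    using fin set by auto
  have w: "sixth_moment Y \<le> W" "sixth_moment Y' \<le> W" "sixth_moment C \<le> W" "sixth_moment D \<le> W" "sixth_moment E \<le> W" "sixth_moment F \<le> W"
    using W set by auto
  have W0: "0 \<le> W" using w sixth_moment_nonneg[of Y] by linarith
  have "(reps Ys 0)\<^sup>2 \<le> triple_moment Y Y' C * triple_moment D E F"
    using reps_six_le[OF f] reps_perm[OF Zs] Z4 by metis
  also have "\<dots> \<le> triple_moment Y Y' C * W"
    using f w by (intro mult_left_mono triple_moment_le_bound mixed_moment_le_max) auto
  finally have "((reps Ys 0)\<^sup>2)\<^sup>2 \<le> (triple_moment Y Y' C * W)\<^sup>2"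
    by (intro power_mono) auto
  also have "\<dots> = (triple_moment Y Y' C)\<^sup>2 * W\<^sup>2" by (simp add: power_mult_distrib)
  also have "\<dots> \<le> (mixed_moment Y Y' * mixed_moment Y C) * W\<^sup>2"
    using f by (intro mult_right_mono triple_moment_le) auto
  also have "\<dots> \<le> (mixed_moment Y Y' * W) * W\<^sup>2"
    using f w by (intro mult_right_mono mult_left_mono mixed_moment_le_max) auto
  finally show ?thesis unfolding Y_def Y'_def by (simp add: power2_eq_square power3_eq_cube power4_eq_xxxx mult_ac)
qed

section \<open>Moments of unions\<close>

lemma mixed_moment_UN_right_le:
  assumes X: "finite X" and S: "finite S" and fin: "\<And>k. k \<in> S \<Longrightarrow> finite (Y k)"
    and dis: "\<And>i j. i \<in> S \<Longrightarrow> j \<in> S \<Longrightarrow> i \<noteq> j \<Longrightarrow> Y i \<inter> Y j = {}"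
    and W: "\<And>k. k \<in> S \<Longrightarrow> mixed_moment X (Y k) \<le> W"
  shows "mixed_moment X (\<Union>k\<in>S. Y k) \<le> real (card S) ^ 4 * W"
proof -
  let ?L = "{js. set js \<subseteq> S \<and> length js = 4}"
  let ?fs = "[Y, Y, \<lambda>k. neg (Y k), \<lambda>k. neg (Y k)]"
  have len: "length ?fs = 4" by simp
  have "mixed_moment X (\<Union>k\<in>S. Y k) = reps (map (\<lambda>f. \<Union>j\<in>S. f j) ?fs @ [X, neg X]) 0"
    unfolding mixed_moment_def by (rule reps_perm) (simp add: image_UN)
  also have "\<dots> = (\<Sum>js | set js \<subseteq> S \<and> length js = length ?fs. reps (map2 (\<lambda>f j. f j) ?fs js @ [X, neg X]) 0)"
    using S fin dis by (intro reps_expand) (auto, (metis disjoint_iff)+)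
  also have "\<dots> = (\<Sum>js\<in>?L. reps (map2 (\<lambda>f j. f j) ?fs js @ [X, neg X]) 0)" unfolding len ..
  also have "\<dots> \<le> (\<Sum>js\<in>?L. W)"
  proof (rule sum_mono)
    fix js assume js: "js \<in> ?L"
    then obtain a b c d where sixth: "js = [a, b, c, d]"
      by (auto simp: numeral_eq_Suc length_Suc_conv)
    have in4: "a \<in> S" "b \<in> S" "c \<in> S" "d \<in> S" using js sixth by auto
    have "reps (map2 (\<lambda>f j. f j) ?fs js @ [X, neg X]) 0 = reps [X, Y a, Y b, neg X, neg (Y c), neg (Y d)] 0"
      unfolding sixth by (rule reps_perm) simp
    also have "\<dots> \<le> W"
    proof -
      have W0: "0 \<le> W" using W[OF in4(1)] mixed_moment_nonneg[of X "Y a"] by linarith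
      have "(reps [X, Y a, Y b, neg X, neg (Y c), neg (Y d)] 0)\<^sup>2 \<le>
          triple_moment X (Y a) (Y b) * triple_moment (neg X) (neg (Y c)) (neg (Y d))"
        using X fin in4 by (intro reps_six_le) auto
      also have "\<dots> \<le> W * W"
        using X fin in4 W W0 by (intro mult_mono triple_moment_le_bound) auto
      finally show ?thesis using W0 by (metis power2_eq_square power2_le_imp_le)
    qed
    finally show "reps (map2 (\<lambda>f j. f j) ?fs js @ [X, neg X]) 0 \<le> W" .
  qed
  also have "\<dots> = real (card S) ^ 4 * W"
    using card_lists_length_eq[OF S, of 4] by simp
  finally show ?thesis .
qed

text \<open>
  Almost orthogonality: if a relation can only link an index \<open>i\<close> with \<open>i - 1\<close>, \<open>i\<close> or \<open>i + 1\<close>, the off-diagonal terms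
  cost no more than a factor three.
\<close>

lemma mixed_moment_UN_left_le:
  fixes Z :: "nat \<Rightarrow> 'v::ab_group_add set"
  assumes Y: "finite Y" and S: "finite S" and fin: "\<And>k. k \<in> S \<Longrightarrow> finite (Z k)"
    and dis: "\<And>i j. i \<in> S \<Longrightarrow> j \<in> S \<Longrightarrow> i \<noteq> j \<Longrightarrow> Z i \<inter> Z j = {}"
    and W: "\<And>k. k \<in> S \<Longrightarrow> mixed_moment (Z k) Y \<le> W" and W0: "0 \<le> W"
    and link: "\<And>i j x x' y1 y2 y3 y4. i \<in> S \<Longrightarrow> j \<in> S \<Longrightarrow> x \<in> Z i \<Longrightarrow> x' \<in> Z j \<Longrightarrow>
      y1 \<in> Y \<Longrightarrow> y2 \<in> Y \<Longrightarrow> y3 \<in> Y \<Longrightarrow> y4 \<in> Y \<Longrightarrow> x + y1 + y2 = x' + y3 + y4 \<Longrightarrow>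
      i \<le> j + 1 \<and> j \<le> i + 1"
  shows "mixed_moment (\<Union>k\<in>S. Z k) Y \<le> 3 * real (card S) * W"
proof -
  let ?L = "{js. set js \<subseteq> S \<and> length js = 2}"
  let ?L' = "{js \<in> ?L. js ! 0 \<le> js ! 1 + 1 \<and> js ! 1 \<le> js ! 0 + 1}"
  let ?fs = "[Z, \<lambda>k. neg (Z k)]"
  have len: "length ?fs = 2" by simp
  let ?t = "\<lambda>js. reps (map2 (\<lambda>f j. f j) ?fs js @ [Y, Y, neg Y, neg Y]) 0"
  have finL: "finite ?L" using finite_lists_length_eq[OF S, of 2] by simp
  have "mixed_moment (\<Union>k\<in>S. Z k) Y = reps (map (\<lambda>f. \<Union>j\<in>S. f j) ?fs @ [Y, Y, neg Y, neg Y]) 0"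
    unfolding mixed_moment_def by (rule reps_perm) (simp add: image_UN)
  also have "\<dots> = (\<Sum>js | set js \<subseteq> S \<and> length js = length ?fs. ?t js)"
    using S fin dis by (intro reps_expand) (auto, (metis disjoint_iff)+)
  also have "\<dots> = (\<Sum>js\<in>?L. ?t js)" unfolding len ..
  also have "\<dots> = (\<Sum>js\<in>?L'. ?t js)"
  proof (rule sum.mono_neutral_right[OF finL])
    show "\<forall>js\<in>?L - ?L'. ?t js = 0"
    proof
      fix js assume js: "js \<in> ?L - ?L'"
      then obtain i j where ij: "js = [i, j]" by (auto simp: numeral_eq_Suc length_Suc_conv)
      show "?t js = 0"
      proof (rule ccontr)
        assume "?t js \<noteq> 0"
        then obtain xs where "list_all2 (\<in>) xs [Z i, neg (Z j), Y, Y, neg Y, neg Y]" "sum_list xs = 0"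
          using reps_witness[of _ 0] ij by fastforce
        then obtain x x' y1 y2 y3 y4 where m: "x \<in> Z i" "x' \<in> Z j" "y1 \<in> Y" "y2 \<in> Y" "y3 \<in> Y" "y4 \<in> Y"
          and e: "x + (- x' + (y1 + (y2 + (- y3 - y4)))) = 0"
          by (auto simp: list_all2_Cons2)
        have "x + y1 + y2 = x' + y3 + y4"
          using e by (simp add: algebra_simps add_eq_0_iff)
        then show False using link[of i j x x' y1 y2 y3 y4] m js ij by auto
      qed
    qed
  qed auto
  also have "\<dots> \<le> (\<Sum>js\<in>?L'. W)"
  proof (rule sum_mono)
    fix js assume js: "js \<in> ?L'"
    then obtain i j where ij: "js = [i, j]" by (auto simp: numeral_eq_Suc length_Suc_conv)
    have in2: "i \<in> S" "j \<in> S" using js ij by auto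
    have "?t js = reps [Z i, Y, neg Y, neg (Z j), Y, neg Y] 0"
      unfolding ij by (rule reps_perm) simp
    then have "(?t js)\<^sup>2 \<le> triple_moment (Z i) Y (neg Y) * triple_moment (neg (Z j)) Y (neg Y)"
      using Y fin in2 reps_six_le[of "Z i" Y "neg Y" "neg (Z j)" Y "neg Y"] by auto
    also have "\<dots> \<le> W * W"
      using Y fin in2 W W0 by (intro mult_mono triple_moment_le_bound) auto
    finally show "?t js \<le> W" using W0 by (metis power2_eq_square power2_le_imp_le)
  qed
  also have "\<dots> = real (card ?L') * W" by simp
  also have "\<dots> \<le> 3 * real (card S) * W"
  proof -
    have "?L' \<subseteq> (\<lambda>(i, e). [i, i + e - 1]) ` (S \<times> {0, 1, 2})"
    proof
      fix js assume js: "js \<in> ?L'"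
      then obtain i j where ij: "js = [i, j]" by (auto simp: numeral_eq_Suc length_Suc_conv)
      then have "i \<in> S" "j + 1 - i \<in> {0, 1, 2}" "i + (j + 1 - i) - 1 = j" using js by auto
      then show "js \<in> (\<lambda>(i, e). [i, i + e - 1]) ` (S \<times> {0, 1, 2})"
        unfolding ij by (intro image_eqI[of _ _ "(i, j + 1 - i)"]) auto
    qed
    then have "card ?L' \<le> card (S \<times> {0, 1, 2::nat})"
      using S by (meson card_image_le card_mono finite_SigmaI finite_imageI finite.intros order_trans)
    also have "\<dots> = 3 * card S" by (simp add: card_cartesian_product)
    finally have "real (card ?L') \<le> 3 * real (card S)" by linarith
    then show ?thesis using W0 by (intro mult_right_mono) auto
  qed
  finally show ?thesis .
qed

text \<open>
  The broad-narrow decomposition. Relations inside one piece contribute the first term, with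
  constant one. Any other relation involves two distinct pieces, and for each such pair it suffices to control
  one of the two mixed moments, whichever is smaller.
\<close>

lemma sixth_moment_UN_le:
  fixes X :: "nat \<Rightarrow> 'v::ab_group_add set"
  assumes S: "finite S" and fin: "\<And>k. k \<in> S \<Longrightarrow> finite (X k)"
    and dis: "\<And>i j. i \<in> S \<Longrightarrow> j \<in> S \<Longrightarrow> i \<noteq> j \<Longrightarrow> X i \<inter> X j = {}"
    and W: "\<And>k. k \<in> S \<Longrightarrow> sixth_moment (X k) \<le> W"
    and V0: "0 \<le> V"
    and V: "\<And>i j. i \<in> S \<Longrightarrow> j \<in> S \<Longrightarrow> i \<noteq> j \<Longrightarrow> mixed_moment (X i) (X j) * W ^ 3 \<le> V ^ 4 \<or> mixed_moment (X j) (X i) * W ^ 3 \<le> V ^ 4"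
  shows "sixth_moment (\<Union>k\<in>S. X k) \<le> real (card S) * W + real (card S) ^ 6 * V"
proof -
  let ?L = "{js. set js \<subseteq> S \<and> length js = 6}"
  let ?C = "(\<lambda>j. replicate 6 j) ` S"
  let ?n = "\<lambda>k. neg (X k)"
  let ?fs = "[X, X, X, ?n, ?n, ?n]"
  have len: "length ?fs = 6" by simp
  let ?t = "\<lambda>js. reps (map2 (\<lambda>f j. f j) ?fs js @ []) 0"
  have finL: "finite ?L" using finite_lists_length_eq[OF S, of 6] by simp
  have CL: "?C \<subseteq> ?L" by auto
  have "sixth_moment (\<Union>k\<in>S. X k) = reps (map (\<lambda>f. \<Union>j\<in>S. f j) ?fs @ []) 0"
    unfolding sixth_moment_def by (rule reps_perm) (simp add: image_UN)
  also have "\<dots> = (\<Sum>js | set js \<subseteq> S \<and> length js = length ?fs. ?t js)"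
    using S fin dis by (intro reps_expand) (auto, (metis disjoint_iff)+)
  also have "\<dots> = (\<Sum>js\<in>?L. ?t js)" unfolding len ..
  also have "\<dots> = (\<Sum>js\<in>?C. ?t js) + (\<Sum>js\<in>?L - ?C. ?t js)"
    using sum.subset_diff[OF CL finL, of ?t] by (simp only: add.commute)
  also have "(\<Sum>js\<in>?C. ?t js) \<le> real (card S) * W"
  proof -
    have "inj_on (\<lambda>j. replicate 6 j) S" by (auto simp: inj_on_def)
    then have "(\<Sum>js\<in>?C. ?t js) = (\<Sum>j\<in>S. ?t (replicate 6 j))"
      by (simp only: sum.reindex o_def)
    also have "\<dots> \<le> (\<Sum>j\<in>S. W)"
    proof (rule sum_mono)
      fix j assume "j \<in> S"
      have "?t (replicate 6 j) = sixth_moment (X j)"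
        unfolding sixth_moment_def by (rule reps_perm) (simp add: numeral_eq_Suc)
      then show "?t (replicate 6 j) \<le> W" using W[OF \<open>j \<in> S\<close>] by simp
    qed
    finally show ?thesis by simp
  qed
  also have "(\<Sum>js\<in>?L - ?C. ?t js) \<le> (\<Sum>js\<in>?L - ?C. V)"
  proof (rule sum_mono)
    fix js assume js: "js \<in> ?L - ?C"
    have lenjs: "length js = 6" and sub: "set js \<subseteq> S" using js by auto
    define Ys where "Ys = map2 (\<lambda>f j. f j) ?fs js"
    have "\<exists>i < 6. js ! i \<noteq> js ! 0"
    proof (rule ccontr)
      assume const: "\<not> ?thesis"
      have "js = replicate 6 (js ! 0)"
      proof (rule nth_equalityI)
        fix k assume "k < length js"
        then have k: "k < 6" using lenjs by simp
        then have "js ! k = js ! 0" using const by blast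
        then show "js ! k = replicate 6 (js ! 0) ! k" using k by (simp only: nth_replicate)
      qed (simp only: lenjs length_replicate)
      moreover have "js ! 0 \<in> S" using lenjs sub by (metis nth_mem subsetD zero_less_numeral)
      ultimately have "js \<in> ?C" by (rule image_eqI)
      then show False by (rule DiffD2[OF js])
    qed
    then obtain i where i: "i < 6" "js ! i \<noteq> js ! 0" by blast
    then have i0: "i \<noteq> 0" "0 \<noteq> i" by metis+
    have nth: "Ys ! k = X (js ! k) \<or> Ys ! k = neg (X (js ! k))" if "k < 6" for k
    proof -
      obtain a b c d e f where "js = [a, b, c, d, e, f]"
        using lenjs by (auto simp: numeral_eq_Suc length_Suc_conv)
      moreover have "k = 0 \<or> k = 1 \<or> k = 2 \<or> k = 3 \<or> k = 4 \<or> k = 5" using that by linarith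
      ultimately show ?thesis unfolding Ys_def by (elim disjE) simp_all
    qed
    have lenY: "length Ys = 6" using lenjs by (simp add: Ys_def)
    have inS: "js ! k \<in> S" if "k < 6" for k using that lenjs sub by (metis nth_mem subsetD)
    have mem: "\<exists>k\<in>S. Y = X k \<or> Y = neg (X k)" if Y: "Y \<in> set Ys" for Y
    proof -
      obtain k where k: "k < 6" "Y = Ys ! k" using Y lenY by (metis in_set_conv_nth)
      then show ?thesis using nth[OF k(1)] inS[OF k(1)] by (intro bexI[of _ "js ! k"]) simp_all
    qed
    have QY: "mixed_moment (Ys ! p) (Ys ! r) = mixed_moment (X (js ! p)) (X (js ! r))" if "p < 6" "r < 6" for p r
      using nth[OF that(1)] nth[OF that(2)] by (elim disjE) simp_all
    have b: "(reps Ys 0) ^ 4 \<le> mixed_moment (X (js ! p)) (X (js ! r)) * W ^ 3" if pr: "p < 6" "r < 6" "p \<noteq> r" for p r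
      unfolding QY[OF pr(1,2), symmetric]
    proof (rule reps_mixed_le[OF lenY pr])
      fix Y assume "Y \<in> set Ys"
      then obtain k where "k \<in> S" "Y = X k \<or> Y = neg (X k)" using mem by blast
      then show "finite Y" "sixth_moment Y \<le> W" using fin W by auto
    qed
    have "mixed_moment (X (js ! 0)) (X (js ! i)) * W ^ 3 \<le> V ^ 4 \<or> mixed_moment (X (js ! i)) (X (js ! 0)) * W ^ 3 \<le> V ^ 4"
      using V[OF inS inS, of 0 i] i by fastforce
    then have "(reps Ys 0) ^ 4 \<le> V ^ 4"
    proof
      assume "mixed_moment (X (js ! 0)) (X (js ! i)) * W ^ 3 \<le> V ^ 4"
      with b[OF _ i(1) i0(2)] show ?thesis by simp
    next
      assume "mixed_moment (X (js ! i)) (X (js ! 0)) * W ^ 3 \<le> V ^ 4"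
      with b[OF i(1) _ i0(1)] show ?thesis by simp
    qed
    then have "reps Ys 0 \<le> V"
      using V0 by (metis power_mono_iff reps_nonneg zero_less_numeral)
    then show "?t js \<le> V" by (simp only: append_Nil2 Ys_def)
  qed
  also have "\<dots> \<le> real (card ?L) * V"
    using V0 finL by (simp add: mult_right_mono card_mono)
  also have "real (card ?L) = real (card S) ^ 6" using card_lists_length_eq[OF S, of 6] by simp
  finally show ?thesis by simp
qed

lemma energy_le:
  assumes "finite Y"
  shows "(reps [Y, Y, neg Y, neg Y] 0)\<^sup>2 \<le> real (card Y) * sixth_moment Y"
proof -
  have "(reps ([Y] @ [Y, neg Y, neg Y]) 0)\<^sup>2 \<le> reps ([Y] @ map neg [Y]) 0 *
      reps ([Y, neg Y, neg Y] @ map neg [Y, neg Y, neg Y]) 0"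
    using assms by (intro reps_Cauchy_Schwarz) auto
  also have "reps ([Y] @ map neg [Y]) 0 = (\<Sum>y\<in>Y. \<Sum>x\<in>Y. if x = y then 1 else 0)"
    by (simp add: sum.reindex, intro sum.cong) (auto simp: eq_commute neg_eq_iff_add_eq_0 add_eq_0_iff2)
  also have "\<dots> = real (card Y)" using assms by simp
  also have "reps ([Y, neg Y, neg Y] @ map neg [Y, neg Y, neg Y]) 0 = sixth_moment Y"
    unfolding sixth_moment_def by (rule reps_perm) (simp add: image_image)
  finally show ?thesis by simp
qed

lemma reps_le_card:
  assumes "\<And>X. X \<in> set Xs \<Longrightarrow> real (card X) \<le> n" "0 \<le> n"
  shows "reps Xs z \<le> n ^ length Xs"
  using assms(1)
proof (induction Xs arbitrary: z)
  case (Cons X Xs)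
  have "(\<Sum>x\<in>X. reps Xs (z - x)) \<le> real (card X) * n ^ length Xs"
    using Cons by (intro sum_bounded_above) auto
  also have "\<dots> \<le> n * n ^ length Xs" using Cons.prems assms(2) by (intro mult_right_mono) auto
  finally show ?case by simp
qed simp

section \<open>Children with controlled slopes\<close>

text \<open>
  Repeatedly pick a vertex of least weight and discard its neighbours; when a vertex is picked, at most
  \<open>D\<close> of them are left.
\<close>

lemma independent_set_degenerate:
  fixes w :: "'i \<Rightarrow> real"
  assumes "finite V" and sym: "\<And>i j. E i j \<Longrightarrow> E j i"
    and deg: "\<And>k U. U \<subseteq> V \<Longrightarrow> k \<in> U \<Longrightarrow> (\<And>j. j \<in> U \<Longrightarrow> w k \<le> w j) \<Longrightarrow> card {j \<in> U - {k}. E k j} \<le> D"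
  shows "\<exists>S \<subseteq> V. (\<forall>i\<in>S. \<forall>j\<in>S. i \<noteq> j \<longrightarrow> \<not> E i j) \<and> card V \<le> card S * (D + 1)"
  using assms(1) deg
proof (induction "card V" arbitrary: V rule: less_induct)
  case less
  show ?case
  proof (cases "V = {}")
    case False
    define k where "k = arg_min_on w V"
    have k: "k \<in> V" "\<And>j. j \<in> V \<Longrightarrow> w k \<le> w j"
      unfolding k_def using arg_min_if_finite(1)[OF less.prems(1) False] arg_min_least[OF less.prems(1) False]
      by blast+
    define N where "N = insert k {j \<in> V - {k}. E k j}"
    have N: "card N \<le> D + 1" "finite N" "N \<subseteq> V"
    proof -
      have "card {j \<in> V - {k}. E k j} \<le> D" using k by (intro less.prems(2)) auto
      then show "card N \<le> D + 1" "finite N" "N \<subseteq> V"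
        using k(1) less.prems(1) unfolding N_def by (auto simp: card_insert_if)
    qed
    have smaller: "card (V - N) < card V"
      using k less.prems(1) by (intro psubset_card_mono) (auto simp: N_def)
    have "\<exists>S \<subseteq> V - N. (\<forall>i\<in>S. \<forall>j\<in>S. i \<noteq> j \<longrightarrow> \<not> E i j) \<and> card (V - N) \<le> card S * (D + 1)"
    proof (rule less.hyps[OF smaller])
      show "finite (V - N)" using less.prems(1) by simp
      show "card {j \<in> U - {k}. E k j} \<le> D"
        if "U \<subseteq> V - N" "k \<in> U" "\<And>j. j \<in> U \<Longrightarrow> w k \<le> w j" for k U
        using that by (intro less.prems(2)) auto
    qed
    then obtain S where S: "S \<subseteq> V - N" "\<forall>i\<in>S. \<forall>j\<in>S. i \<noteq> j \<longrightarrow> \<not> E i j"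
        "card (V - N) \<le> card S * (D + 1)" by blast
    have "finite S" "k \<notin> S" using S less.prems(1) by (auto simp: N_def intro: finite_subset)
    then have "card V \<le> card (insert k S) * (D + 1)"
      using S(3) N less.prems(1) card_Diff_subset[OF N(2,3)] by (simp add: card_insert_if)
    moreover have "\<forall>i\<in>insert k S. \<forall>j\<in>insert k S. i \<noteq> j \<longrightarrow> \<not> E i j"
      using S(1,2) sym unfolding N_def by blast
    ultimately show ?thesis using S(1) k(1) by (intro exI[of _ "insert k S"]) auto
  qed auto
qed

lemma card_growing_le:
  fixes w :: "nat \<Rightarrow> real" and R m :: real
  assumes fin: "finite U" and R: "R > 1" and m: "m > 0"
    and low: "\<And>j. j \<in> U \<Longrightarrow> m \<le> w j"
    and grow: "\<And>i j. i \<in> U \<Longrightarrow> j \<in> U \<Longrightarrow> i < j \<Longrightarrow> R * w i \<le> w j"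
    and up: "\<And>i j. i \<in> U \<Longrightarrow> j \<in> U \<Longrightarrow> i < j \<Longrightarrow> w i < R ^ q * m"
  shows "card U \<le> q + 1"
proof -
  have key: "R ^ (card V - 1) * m \<le> w (Max V)" if "V \<subseteq> U" "V \<noteq> {}" "finite V" for V
    using that(3,1,2)
  proof (induction V rule: finite_linorder_max_induct)
    case (insert b A)
    show ?case
    proof (cases "A = {}")
      case False
      have "Max (insert b A) = b" using insert False by (intro Max_eqI) (auto intro: less_imp_le)
      moreover have "Max A \<in> A" using insert False by simp
      moreover from this have "R * w (Max A) \<le> w b" using insert by (intro grow) auto
      moreover have "R * (R ^ (card A - 1) * m) \<le> R * w (Max A)"
        using insert False R by (intro mult_left_mono) auto
      moreover have "card (insert b A) - 1 = Suc (card A - 1)"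
        using insert False by (simp add: card_insert_if card_gt_0_iff) (metis less_irrefl)
      ultimately show ?thesis by (simp add: mult.assoc)
    qed (use insert low in auto)
  qed auto
  show ?thesis
  proof (rule ccontr)
    assume "\<not> ?thesis"
    then have c: "card U \<ge> q + 2" by simp
    then have ne: "U \<noteq> {}" by auto
    define V where "V = U - {Max U}"
    have V: "V \<subseteq> U" "card V = card U - 1" using fin ne by (auto simp: V_def)
    then have "V \<noteq> {}" "finite V" using c fin by (auto intro: finite_subset)
    then have "Max V \<in> V" by simp
    then have "w (Max V) < R ^ q * m"
      using fin V Max_ge[OF fin, of "Max V"] by (intro up[of _ "Max U"]) (auto simp: V_def ne order.not_eq_order_implies_strict)
    moreover have "R ^ q * m \<le> R ^ (card V - 1) * m"
      using R m c V by (intro mult_right_mono power_increasing) auto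
    ultimately show False using key[OF V(1) \<open>V \<noteq> {}\<close> \<open>finite V\<close>] by linarith
  qed
qed

text \<open>
  Here \<open>x\<close> and \<open>y\<close> stand for the slope increases of a curve on two intervals and \<open>g\<close> for the slope gap
  between the intervals. The last two alternatives will be used with \<open>q\<close> so large that the flatter interval
  looks straight from the other one.
\<close>

definition tame :: "nat \<Rightarrow> nat \<Rightarrow> real \<Rightarrow> real \<Rightarrow> real \<Rightarrow> bool" where
  "tame K q x y g \<longleftrightarrow> (x \<le> real K * g \<and> y \<le> real K * g) \<or> real K ^ q * x \<le> g \<or> real K ^ q * y \<le> g"

text \<open>
  Let \<open>k\<close> have the least increment \<open>w k\<close> among the remaining indices, and let \<open>j\<^sub>1 < j\<^sub>2 < \<dots>\<close> to its right fail to be tame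
  with \<open>k\<close>. The gap between \<open>k\<close> and \<open>j\<^sub>2\<close> contains the increment at \<open>j\<^sub>1\<close>. Hence failure of the first alternative makes
  the increments grow by factors \<open>K\<close>, while failure of the others keeps all but the last below \<open>K ^ q * w k\<close>. So there
  are at most \<open>q + 1\<close> such indices on each side, and the graph of pairs that are not tame is degenerate.
\<close>

lemma tame_subset_exists:
  fixes t :: "nat \<Rightarrow> real"
  assumes K: "K \<ge> 2" and mono: "strict_mono t" and V: "V \<subseteq> {..<K}"
  shows "\<exists>S \<subseteq> V. card V \<le> card S * (2 * q + 3) \<and>
    (\<forall>j\<in>S. \<forall>k\<in>S. j < k \<longrightarrow> tame K q (t (Suc j) - t j) (t (Suc k) - t k) (t k - t (Suc j)))"
proof -
  let ?w = "\<lambda>j. t (Suc j) - t j"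
  let ?T = "\<lambda>j k. tame K q (?w j) (?w k) (t k - t (Suc j))"
  define E where "E = (\<lambda>j k. (j < k \<and> \<not> ?T j k) \<or> (k < j \<and> \<not> ?T k j))"
  have finV: "finite V" using V finite_subset by blast
  have le: "t i \<le> t j" if "i \<le> j" for i j using that mono by (simp add: strict_mono_less_eq)
  have pos: "?w j > 0" for j using mono by (simp add: strict_mono_def)
  have deg: "card {j \<in> U - {k}. E k j} \<le> 2 * q + 2"
    if U: "U \<subseteq> V" "k \<in> U" "\<And>j. j \<in> U \<Longrightarrow> ?w k \<le> ?w j" for k U
  proof -
    let ?R = "{j \<in> U. k < j \<and> \<not> ?T k j}" and ?L = "{j \<in> U. j < k \<and> \<not> ?T j k}"
    have finU: "finite U" using U finV finite_subset by blast
    have "card ?R \<le> q + 1"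
    proof (rule card_growing_le[of _ "real K" "?w k" ?w])
      fix i j assume ij: "i \<in> ?R" "j \<in> ?R" "i < j"
      then have g: "?w i \<le> t j - t (Suc k)" using le[of "Suc k" i] le[of "Suc i" j] by simp
      have j: "\<not> ?T k j" "?w k \<le> ?w j" using ij U by auto
      have "\<not> ?w j \<le> K * (t j - t (Suc k))" using j unfolding tame_def by (meson order_trans)
      moreover have "real K * ?w i \<le> K * (t j - t (Suc k))" using g by (intro mult_left_mono) auto
      ultimately show "real K * ?w i \<le> ?w j" by linarith
      show "?w i < real K ^ q * ?w k" using j g unfolding tame_def by auto
    qed (use K U finU pos in auto)
    moreover have "card ?L \<le> q + 1"
    proof -
      have inj: "inj_on (\<lambda>j. K - j) ?L" using V U(1) by (auto simp: inj_on_def)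
      have "card ((\<lambda>j. K - j) ` ?L) \<le> q + 1"
      proof (rule card_growing_le[of _ "real K" "?w k" "\<lambda>i. ?w (K - i)"])
        fix a b assume ab: "a \<in> (\<lambda>j. K - j) ` ?L" "b \<in> (\<lambda>j. K - j) ` ?L" "a < b"
        define i j where "i = K - a" and "j = K - b"
        have ij: "i \<in> ?L" "j \<in> ?L" "j < i" using ab V U(1) unfolding i_def j_def by fastforce+
        then have g: "?w i \<le> t k - t (Suc j)" using le[of "Suc j" i] le[of "Suc i" k] by simp
        have j: "\<not> ?T j k" "?w k \<le> ?w j" using ij U by auto
        have "\<not> ?w j \<le> K * (t k - t (Suc j))" using j unfolding tame_def by (meson order_trans)
        moreover have "real K * ?w i \<le> K * (t k - t (Suc j))" using g by (intro mult_left_mono) auto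
        ultimately show "real K * ?w (K - a) \<le> ?w (K - b)" unfolding i_def j_def by linarith
        show "?w (K - a) < real K ^ q * ?w k" using j g unfolding tame_def i_def j_def by auto
      next
        fix a assume "a \<in> (\<lambda>j. K - j) ` ?L"
        then show "?w k \<le> ?w (K - a)" using U V by fastforce
      qed (use K U finU pos in auto)
      then show ?thesis using card_image[OF inj] by simp
    qed
    moreover have "{j \<in> U - {k}. E k j} = ?R \<union> ?L" by (auto simp: E_def)
    ultimately show ?thesis using card_Un_le[of ?R ?L] by simp
  qed
  have "\<exists>S \<subseteq> V. (\<forall>i\<in>S. \<forall>j\<in>S. i \<noteq> j \<longrightarrow> \<not> E i j) \<and> card V \<le> card S * ((2 * q + 2) + 1)"
    by (rule independent_set_degenerate[where w = ?w, OF finV _ deg]) (auto simp: E_def)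
  then obtain S where "S \<subseteq> V" "card V \<le> card S * (2 * q + 3)" "\<forall>i\<in>S. \<forall>j\<in>S. i \<noteq> j \<longrightarrow> \<not> E i j"
    by (auto simp: numeral_eq_Suc)
  then show ?thesis by (intro exI[of _ S]) (auto simp: E_def)
qed

section \<open>Trees of indices on a convex sequence\<close>

locale convex_sequence =
  fixes a :: "nat \<Rightarrow> real"
  assumes mono: "strict_mono a" and convex: "strict_mono (\<lambda>i. a (Suc i) - a i)"
begin

abbreviation slope :: "nat \<Rightarrow> real" where
  "slope i \<equiv> a (Suc i) - a i"

definition point :: "nat \<Rightarrow> real \<times> real" where
  "point i = (real i, a i)"

text \<open>
  \<open>branch K M q h l X\<close>: the set \<open>X\<close> of indices in \<open>{l..<l + K ^ h}\<close> consists of the leaves of a tree of height \<open>h\<close> in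
  which every node has \<open>M\<close> children, chosen among the \<open>K\<close> subintervals of equal length. Children
  turn by at most twice the average amount, and any two of them are tame.
\<close>

primrec branch :: "nat \<Rightarrow> nat \<Rightarrow> nat \<Rightarrow> nat \<Rightarrow> nat \<Rightarrow> nat set \<Rightarrow> bool" where
  "branch K M q 0 l X \<longleftrightarrow> X = {l}"
| "branch K M q (Suc h) l X \<longleftrightarrow> (\<exists>S Y. S \<subseteq> {..<K} \<and> card S = M \<and> X = (\<Union>j\<in>S. Y j) \<and>
     (\<forall>j\<in>S. branch K M q h (l + j * K ^ h) (Y j) \<and>
        real K * (slope (l + Suc j * K ^ h) - slope (l + j * K ^ h)) \<le> 2 * (slope (l + K ^ Suc h) - slope l)) \<and>
     (\<forall>j\<in>S. \<forall>k\<in>S. j < k \<longrightarrow> tame K q (slope (l + Suc j * K ^ h) - slope (l + j * K ^ h))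
        (slope (l + Suc k * K ^ h) - slope (l + k * K ^ h)) (slope (l + k * K ^ h) - slope (l + Suc j * K ^ h))))"

lemma slope_le: "i \<le> j \<Longrightarrow> slope i \<le> slope j"
  using strict_mono_less_eq[OF convex, of i j] by simp

lemma slope_less: "i < j \<Longrightarrow> slope i < slope j"
  using strict_mono_less[OF convex, of i j] by simp

text \<open>
  At each node at least half of the subintervals turn by at most twice the average, and tame
  children are selected among these.
\<close>

lemma branch_exists:
  assumes K: "K \<ge> 2" and M: "M * (4 * q + 6) \<le> K"
  shows "\<exists>X. branch K M q h l X"
proof (induction h arbitrary: l)
  case (Suc h)
  define t where "t = (\<lambda>j. slope (l + j * K ^ h))"
  have tm: "strict_mono t" unfolding t_def using K by (intro strict_monoI slope_less) auto
  let ?w = "\<lambda>j. t (Suc j) - t j"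
  define V where "V = {j. j < K \<and> real K * ?w j \<le> 2 * (t K - t 0)}"
  define V' where "V' = {j. j < K \<and> \<not> real K * ?w j \<le> 2 * (t K - t 0)}"
  have fin: "finite V" "finite V'" "{..<K} = V \<union> V'" "V \<inter> V' = {}" unfolding V_def V'_def by auto
  have tot: "(\<Sum>j<K. ?w j) = t K - t 0" by (rule sum_lessThan_telescope)
  have tpos: "t K - t 0 > 0" using tm K by (simp add: strict_mono_def)
  have "real (card V') * (2 * (t K - t 0)) \<le> (\<Sum>j\<in>V'. real K * ?w j)"
    by (rule sum_bounded_below) (auto simp: V'_def)
  also have "\<dots> \<le> (\<Sum>j<K. real K * ?w j)"
    using tm by (intro sum_mono2) (auto simp: V'_def strict_mono_less_eq)
  also have "\<dots> = real K * (t K - t 0)" using tot by (simp add: sum_distrib_left[symmetric])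
  finally have "(2 * real (card V')) * (t K - t 0) \<le> real K * (t K - t 0)" by (simp only: mult_ac)
  then have "2 * real (card V') \<le> real K" using tpos by (simp only: mult_le_cancel_right_pos)
  moreover have "card V + card V' = K" using fin by (metis card_Un_disjoint card_lessThan)
  ultimately have cV: "K \<le> 2 * card V" by linarith
  obtain S0 where S0: "S0 \<subseteq> V" "card V \<le> card S0 * (2 * q + 3)"
    "\<forall>j\<in>S0. \<forall>k\<in>S0. j < k \<longrightarrow> tame K q (?w j) (?w k) (t k - t (Suc j))"
    using tame_subset_exists[OF K tm, of V q] fin by auto
  have "M * (4 * q + 6) \<le> card S0 * (4 * q + 6)" using M cV S0(2) by (simp add: algebra_simps)
  then have "M \<le> card S0" by simp
  then obtain S where S: "S \<subseteq> S0" "card S = M" by (meson obtain_subset_with_card_n)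
  have "\<forall>j. \<exists>Z. branch K M q h (l + j * K ^ h) Z" using Suc by blast
  then obtain Y where Y: "\<And>j. branch K M q h (l + j * K ^ h) (Y j)" by metis
  have "branch K M q (Suc h) l (\<Union>j\<in>S. Y j)"
    unfolding branch.simps
  proof (intro exI[of _ S] exI[of _ Y] conjI ballI impI refl)
    show "S \<subseteq> {..<K}" using S S0 fin by auto
    show "card S = M" by (rule S)
    show "branch K M q h (l + j * K ^ h) (Y j)" for j by (rule Y)
    show "real K * (slope (l + Suc j * K ^ h) - slope (l + j * K ^ h)) \<le> 2 * (slope (l + K ^ Suc h) - slope l)"
      if "j \<in> S" for j
      using that S S0 unfolding V_def t_def by auto
    show "tame K q (slope (l + Suc j * K ^ h) - slope (l + j * K ^ h))
        (slope (l + Suc k * K ^ h) - slope (l + k * K ^ h)) (slope (l + k * K ^ h) - slope (l + Suc j * K ^ h))"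
      if "j \<in> S" "k \<in> S" "j < k" for j k
      using that S S0(3) unfolding t_def by blast
  qed
  then show ?case by blast
next
  case 0
  show ?case by (intro exI[of _ "{l}"]) simp
qed

lemma branch_range: "branch K M q h l X \<Longrightarrow> X \<subseteq> {l..<l + K ^ h}"
proof (induction h arbitrary: l X)
  case (Suc h)
  then obtain S Y where S: "S \<subseteq> {..<K}" "X = (\<Union>j\<in>S. Y j)" "\<And>j. j \<in> S \<Longrightarrow> branch K M q h (l + j * K ^ h) (Y j)"
    by auto
  show ?case
  proof
    fix x assume "x \<in> X"
    then obtain j where j: "j \<in> S" "x \<in> Y j" using S by blast
    then have "x \<in> {l + j * K ^ h..<l + j * K ^ h + K ^ h}" using Suc.IH S(3) by blast
    moreover have "Suc j * K ^ h \<le> K * K ^ h" using j S by (intro mult_right_mono) auto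
    ultimately show "x \<in> {l..<l + K ^ Suc h}" by auto
  qed
qed auto

lemma branch_finite: "branch K M q h l X \<Longrightarrow> finite X"
  by (drule branch_range) (simp add: finite_subset)

lemma blocks_disjoint:
  assumes "X \<subseteq> {l + i * L..<l + i * L + L}" "Y \<subseteq> {l + j * L..<l + j * L + L}" "i \<noteq> (j::nat)"
  shows "X \<inter> Y = {}"
proof -
  have "Suc i * L \<le> j * L \<or> Suc j * L \<le> i * L" using assms(3) by (metis linorder_neqE_nat Suc_leI mult_right_mono le0)
  then show ?thesis using assms(1,2) by fastforce
qed

text \<open>
  The nodes at depth \<open>u\<close>, numbered by the position of their interval. The turning bound multiplies along the
  path, which is why only a factor \<open>2 ^ u\<close> is lost compared with a curve of constant curvature.
\<close>

lemma branch_descend: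
  assumes "branch K M q h l X" "u \<le> h"
  shows "\<exists>I Z. finite I \<and> card I = M ^ u \<and> X = (\<Union>i\<in>I. Z i) \<and>
    (\<forall>i\<in>I. branch K M q (h - u) (l + i * K ^ (h - u)) (Z i) \<and> Suc i * K ^ (h - u) \<le> K ^ h \<and>
      real K ^ u * (slope (l + Suc i * K ^ (h - u)) - slope (l + i * K ^ (h - u))) \<le>
        2 ^ u * (slope (l + K ^ h) - slope l))"
  using assms
proof (induction u arbitrary: h l X)
  case 0
  then show ?case by (intro exI[of _ "{0}"] exI[of _ "\<lambda>_. X"]) auto
next
  case (Suc u)
  then obtain h' where h: "h = Suc h'" "u \<le> h'" by (cases h) auto
  obtain S Y where S: "S \<subseteq> {..<K}" "card S = M" "X = (\<Union>j\<in>S. Y j)"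
      "\<And>j. j \<in> S \<Longrightarrow> branch K M q h' (l + j * K ^ h') (Y j)"
      "\<And>j. j \<in> S \<Longrightarrow> real K * (slope (l + Suc j * K ^ h') - slope (l + j * K ^ h')) \<le> 2 * (slope (l + K ^ h) - slope l)"
    using Suc.prems(1) unfolding h branch.simps by blast
  let ?L = "K ^ (h' - u)"
  have "\<forall>j\<in>S. \<exists>I Z. finite I \<and> card I = M ^ u \<and> Y j = (\<Union>i\<in>I. Z i) \<and>
    (\<forall>i\<in>I. branch K M q (h' - u) (l + j * K ^ h' + i * ?L) (Z i) \<and> Suc i * ?L \<le> K ^ h' \<and>
      real K ^ u * (slope (l + j * K ^ h' + Suc i * ?L) - slope (l + j * K ^ h' + i * ?L)) \<le>
        2 ^ u * (slope (l + j * K ^ h' + K ^ h') - slope (l + j * K ^ h')))"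
    using Suc.IH[OF S(4) h(2)] by blast
  then obtain I Z where IZ: "\<And>j. j \<in> S \<Longrightarrow> finite (I j) \<and> card (I j) = M ^ u \<and> Y j = (\<Union>i\<in>I j. Z j i)"
    and D: "\<And>j i. j \<in> S \<Longrightarrow> i \<in> I j \<Longrightarrow> branch K M q (h' - u) (l + j * K ^ h' + i * ?L) (Z j i) \<and>
      Suc i * ?L \<le> K ^ h' \<and>
      real K ^ u * (slope (l + j * K ^ h' + Suc i * ?L) - slope (l + j * K ^ h' + i * ?L)) \<le>
        2 ^ u * (slope (l + j * K ^ h' + K ^ h') - slope (l + j * K ^ h'))"
    by metis
  have Kh: "K ^ h' = K ^ u * ?L" using h(2) by (simp add: power_add[symmetric])
  let ?P = "Sigma S I"
  let ?f = "\<lambda>(j, i). j * K ^ u + i"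
  have finS: "finite S" using S(1) finite_subset by blast
  have iK: "i < K ^ u \<and> ?L > 0" if "j \<in> S" "i \<in> I j" for j i
  proof -
    have "Suc i * ?L \<le> K ^ u * ?L" using D[OF that] Kh by auto
    moreover have "K > 0" using that S(1) by auto
    then have L: "?L > 0" by simp
    ultimately have "Suc i \<le> K ^ u" by (simp only: mult_le_cancel2)
    then show ?thesis using L by simp
  qed
  have inj: "inj_on ?f ?P"
  proof (rule inj_onI, clarify)
    fix j i j' i' assume A: "j \<in> S" "i \<in> I j" "j' \<in> S" "i' \<in> I j'" and e: "j * K ^ u + i = j' * K ^ u + i'"
    have quot: "(c * n + r) div n = c" if "r < n" for c n r :: nat using that by simp
    have "(j * K ^ u + i) div K ^ u = j" "(j' * K ^ u + i') div K ^ u = j'"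
      using iK[OF A(1,2)] iK[OF A(3,4)] by (intro quot, blast)+
    then show "j = j' \<and> i = i'" using e by auto
  qed
  define G where "G = inv_into ?P ?f"
  have G: "G (?f p) = p" if "p \<in> ?P" for p unfolding G_def using inv_into_f_f[OF inj that] .
  define W where "W = (\<lambda>n. Z (fst (G n)) (snd (G n)))"
  show ?case
  proof (intro exI[of _ "?f ` ?P"] exI[of _ W] conjI ballI)
    show "finite (?f ` ?P)" using finS IZ by auto
    show "card (?f ` ?P) = M ^ Suc u"
      using card_image[OF inj] finS IZ S(2) by (simp add: card_SigmaI)
    have "(\<Union>n\<in>?f ` ?P. W n) = (\<Union>p\<in>?P. Z (fst p) (snd p))"
      unfolding W_def using G by (simp add: image_image)
    also have "\<dots> = X" unfolding S(3) using IZ by fastforce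
    finally show "X = (\<Union>n\<in>?f ` ?P. W n)" ..
  next
    fix n assume "n \<in> ?f ` ?P"
    then obtain j i where ji: "j \<in> S" "i \<in> I j" "n = j * K ^ u + i" by auto
    have Wn: "W n = Z j i" unfolding W_def using G[of "(j, i)"] ji by simp
    have n: "l + n * ?L = l + j * K ^ h' + i * ?L" "l + Suc n * ?L = l + j * K ^ h' + Suc i * ?L"
      unfolding ji(3) Kh by (simp_all add: algebra_simps)
    have hu: "h - Suc u = h' - u" using h by simp
    show "branch K M q (h - Suc u) (l + n * K ^ (h - Suc u)) (W n)"
      unfolding hu n Wn using D[OF ji(1,2)] by blast
    have "Suc j * K ^ h' \<le> K * K ^ h'" using ji(1) S(1) by (intro mult_right_mono) auto
    then have "j * K ^ h' + Suc i * ?L \<le> K ^ h" using D[OF ji(1,2)] h by simp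
    then show "Suc n * K ^ (h - Suc u) \<le> K ^ h" using n(2) hu by simp
    have "real K ^ Suc u * (slope (l + j * K ^ h' + Suc i * ?L) - slope (l + j * K ^ h' + i * ?L)) \<le>
        real K * (2 ^ u * (slope (l + j * K ^ h' + K ^ h') - slope (l + j * K ^ h')))"
      using D[OF ji(1,2)] by (simp only: power_Suc mult.assoc) (intro mult_left_mono, auto)
    also have "\<dots> = 2 ^ u * (real K * (slope (l + Suc j * K ^ h') - slope (l + j * K ^ h')))"
      by (simp add: algebra_simps)
    also have "\<dots> \<le> 2 ^ u * (2 * (slope (l + K ^ h) - slope l))"
      using S(5)[OF ji(1)] by (intro mult_left_mono) auto
    finally show "real K ^ Suc u * (slope (l + Suc n * K ^ (h - Suc u)) - slope (l + n * K ^ (h - Suc u)))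
        \<le> 2 ^ Suc u * (slope (l + K ^ h) - slope l)"
      unfolding hu n by (simp only: power_Suc mult_ac)
  qed
qed

end

section \<open>Bilinear refinement\<close>

context convex_sequence
begin

lemma inj_point: "inj point"
  by (auto simp: inj_def point_def)

abbreviation sixth :: "nat set \<Rightarrow> real" where "sixth X \<equiv> sixth_moment (point ` X)"
abbreviation mixed :: "nat set \<Rightarrow> nat set \<Rightarrow> real" where "mixed X Y \<equiv> mixed_moment (point ` X) (point ` Y)"

lemma chord:
  assumes "i \<le> j"
  shows "slope i * (real j - real i) \<le> a j - a i" "a j - a i \<le> slope j * (real j - real i)"
proof -
  have "slope i * (real j - real i) \<le> a j - a i \<and> a j - a i \<le> slope j * (real j - real i)"
    using assms
  proof (induction j rule: dec_induct)
    case (step n)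
    have "slope i \<le> slope n" "slope n \<le> slope (Suc n)" using slope_le[of i n] slope_le[of n "Suc n"] step by simp_all
    moreover from this have "slope n * (real (Suc n) - real i) \<le> slope (Suc n) * (real (Suc n) - real i)"
      using step by (intro mult_right_mono) auto
    moreover have "slope n * (real (Suc n) - real i) = slope n * (real n - real i) + slope n"
      "slope i * (real (Suc n) - real i) = slope i * (real n - real i) + slope i"
      by (simp_all add: algebra_simps)
    ultimately show ?case using step.IH by linarith
  qed auto
  then show "slope i * (real j - real i) \<le> a j - a i" "a j - a i \<le> slope j * (real j - real i)"
    by auto
qed

definition apart :: "real \<Rightarrow> nat \<Rightarrow> nat \<Rightarrow> nat \<Rightarrow> nat \<Rightarrow> bool" where
  "apart g zl zu yl yu \<longleftrightarrow> (yu \<le> zl \<and> g \<le> slope zl - slope yu) \<or> (zu \<le> yl \<and> g \<le> slope yl - slope zu)"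

lemma apart_commute: "apart g zl zu yl yu = apart g yl yu zl zu"
  by (auto simp: apart_def)

lemma apart_sub: "apart g zl zu yl yu \<Longrightarrow> zl \<le> zl' \<Longrightarrow> zu' \<le> zu \<Longrightarrow> apart g zl' zu' yl yu"
  unfolding apart_def using slope_le[of zl zl'] slope_le[of zu' zu] by linarith

text \<open>
  Subtract from \<open>a\<close> the linear function with the slope of the curve at the end of the \<open>Y\<close>-interval that
  faces away from the other interval. On the \<open>Y\<close>-interval the result varies by at most \<open>L\<close> times the turning, whereas
  between \<open>x'\<close> and \<open>x\<close> it changes with slope at least \<open>g\<close>. The relation says that the second change is
  a signed sum of four values of the first kind.
\<close>

lemma relation_shift_le:
  assumes rel: "point x + point y1 + point y2 = point x' + point y3 + point y4"
    and Y: "{y1, y2, y3, y4} \<subseteq> {yl..<yl + L}" and Z: "{x, x'} \<subseteq> {zl..<zu}"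
    and sep: "apart g zl zu yl (yl + L)" and le: "x' \<le> x"
  shows "(real x - real x') * g \<le> 2 * real L * (slope (yl + L) - slope yl)"
proof -
  let ?T = "slope (yl + L) - slope yl"
  have e1: "real x - real x' = real y3 + real y4 - real y1 - real y2"
    and e2: "a x - a x' = a y3 + a y4 - a y1 - a y2"
    using rel by (simp_all add: point_def)
  from sep show ?thesis unfolding apart_def
  proof
    assume g: "yl + L \<le> zl \<and> g \<le> slope zl - slope (yl + L)"
    define G where "G = (\<lambda>i. a i - slope yl * real i)"
    have GY: "G yl \<le> G y \<and> G y \<le> G yl + real L * ?T" if "y \<in> {y1, y2, y3, y4}" for y
    proof -
      have y: "yl \<le> y" "y < yl + L" using that Y by auto
      have "a y - a yl - slope yl * (real y - real yl) \<le> (slope y - slope yl) * (real y - real yl)"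
        using chord(2)[OF y(1)] by (simp add: algebra_simps)
      also have "\<dots> \<le> ?T * real L"
        using y slope_le[of yl y] slope_le[of y "yl + L"] by (intro mult_mono) auto
      finally show ?thesis using chord(1)[OF y(1)] by (simp add: G_def algebra_simps)
    qed
    have "(real x - real x') * g \<le> (slope x' - slope yl) * (real x - real x')"
      using g le Z slope_le[of zl x'] slope_le[of yl "yl + L"] by (subst mult.commute, intro mult_right_mono) auto
    also have "\<dots> \<le> G x - G x'" using chord(1)[OF le] by (simp add: G_def algebra_simps)
    also have "\<dots> = G y3 + G y4 - G y1 - G y2"
    proof -
      have "slope yl * (real x - real x') = slope yl * (real y3 + real y4 - real y1 - real y2)" using e1 by simp
      then show ?thesis using e2 by (simp add: G_def algebra_simps)
    qed
    also have "\<dots> \<le> 2 * (real L * ?T)" using GY[of y1] GY[of y2] GY[of y3] GY[of y4] by auto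
    finally show ?thesis by (simp add: mult.assoc)
  next
    assume g: "zu \<le> yl \<and> g \<le> slope yl - slope zu"
    define G where "G = (\<lambda>i. slope (yl + L) * real i - a i)"
    have GY: "G y \<le> G (yl + L) \<and> G (yl + L) \<le> G y + real L * ?T" if "y \<in> {y1, y2, y3, y4}" for y
    proof -
      have y: "yl \<le> y" "y \<le> yl + L" using that Y by auto
      have "slope (yl + L) * (real (yl + L) - real y) - (a (yl + L) - a y) \<le>
          (slope (yl + L) - slope y) * (real (yl + L) - real y)"
        using chord(1)[OF y(2)] by (simp add: algebra_simps)
      also have "\<dots> \<le> ?T * real L"
        using y slope_le[of yl y] slope_le[of y "yl + L"] by (intro mult_mono) auto
      finally show ?thesis using chord(2)[OF y(2)] by (simp add: G_def algebra_simps)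
    qed
    have "(real x - real x') * g \<le> (slope (yl + L) - slope x) * (real x - real x')"
      using g le Z slope_le[of x zu] slope_le[of yl "yl + L"] by (subst mult.commute, intro mult_right_mono) auto
    also have "\<dots> \<le> G x - G x'" using chord(2)[OF le] by (simp add: G_def algebra_simps)
    also have "\<dots> = G y3 + G y4 - G y1 - G y2"
    proof -
      have "slope (yl + L) * (real x - real x') = slope (yl + L) * (real y3 + real y4 - real y1 - real y2)" using e1 by simp
      then show ?thesis using e2 by (simp add: G_def algebra_simps)
    qed
    also have "\<dots> \<le> 2 * (real L * ?T)" using GY[of y1] GY[of y2] GY[of y3] GY[of y4] by auto
    finally show ?thesis by (simp add: mult.assoc)
  qed
qed

lemma mixed_refine:
  assumes Y: "Y \<subseteq> {yl..<yl + L}" and I: "finite I"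
    and W: "\<And>i. i \<in> I \<Longrightarrow> W i \<subseteq> {zl + i * D..<zl + i * D + D}"
    and Z: "(\<Union>i\<in>I. W i) \<subseteq> {zl..<zu}"
    and sep: "apart g zl zu yl (yl + L)" and g: "g > 0"
    and fine: "2 * real L * (slope (yl + L) - slope yl) \<le> real D * g"
    and bound: "\<And>i. i \<in> I \<Longrightarrow> mixed (W i) Y \<le> w" and w: "0 \<le> w"
  shows "mixed (\<Union>i\<in>I. W i) Y \<le> 3 * real (card I) * w"
proof -
  have eq: "point ` (\<Union>i\<in>I. W i) = (\<Union>i\<in>I. point ` W i)" by blast
  have close: "real x - real x' \<le> real D"
    if rel: "point x + point y1 + point y2 = point x' + point y3 + point y4" and "x \<in> (\<Union>i\<in>I. W i)" "x' \<in> (\<Union>i\<in>I. W i)"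
      "{y1, y2, y3, y4} \<subseteq> Y" for x x' y1 y2 y3 y4
  proof (cases "x' \<le> x")
    case True
    have "{x, x'} \<subseteq> {zl..<zu}" "{y1, y2, y3, y4} \<subseteq> {yl..<yl + L}" using that Z Y by blast+
    from relation_shift_le[OF rel this(2,1) sep True] fine
    have "(real x - real x') * g \<le> real D * g" by linarith
    then show ?thesis using g by (simp only: mult_le_cancel_right_pos)
  qed auto
  have sep_index: "i \<le> j + 1" if "x \<in> W i" "x' \<in> W j" "i \<in> I" "j \<in> I" "real x - real x' \<le> real D" for i j x x'
  proof (rule ccontr)
    assume "\<not> i \<le> j + 1"
    then have "(j + 2) * D \<le> i * D" by (intro mult_right_mono) auto
    moreover have "zl + i * D \<le> x" "x' < zl + j * D + D" using W that by fastforce+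
    ultimately show False using that(5) by (simp add: algebra_simps)
  qed
  show ?thesis unfolding eq
  proof (rule mixed_moment_UN_left_le)
    show "finite (point ` Y)" using Y finite_subset by blast
    show "finite (point ` W k)" if "k \<in> I" for k using W[OF that] finite_subset by blast
    show "point ` W i \<inter> point ` W j = {}" if "i \<in> I" "j \<in> I" "i \<noteq> j" for i j
      using blocks_disjoint[OF W W, of i j] that inj_point by (simp add: image_Int[symmetric])
    show "i \<le> j + 1 \<and> j \<le> i + 1"
      if A: "i \<in> I" "j \<in> I" "x \<in> point ` W i" "x' \<in> point ` W j" "y1 \<in> point ` Y" "y2 \<in> point ` Y" "y3 \<in> point ` Y" "y4 \<in> point ` Y"
        and rel: "x + y1 + y2 = x' + y3 + y4" for i j x x' y1 y2 y3 y4
    proof -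
      obtain z z' v1 v2 v3 v4 where e: "x = point z" "x' = point z'" "y1 = point v1" "y2 = point v2" "y3 = point v3" "y4 = point v4"
        and m: "z \<in> W i" "z' \<in> W j" "v1 \<in> Y" "v2 \<in> Y" "v3 \<in> Y" "v4 \<in> Y" using A by blast
      have u: "z \<in> (\<Union>i\<in>I. W i)" "z' \<in> (\<Union>i\<in>I. W i)" using m A by blast+
      have "real z - real z' \<le> real D" using close[of z v1 v2 z' v3 v4] rel e m u by auto
      moreover have "real z' - real z \<le> real D" using close[of z' v3 v4 z v1 v2] rel e m u by auto
      ultimately show ?thesis using sep_index m A(1,2) by blast
    qed
  qed (use I bound w in auto)
qed

lemma branch_card: "branch K M q h l X \<Longrightarrow> card X = M ^ h"
proof (induction h arbitrary: l X)
  case (Suc h)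
  then obtain S Y where S: "S \<subseteq> {..<K}" "card S = M" "X = (\<Union>j\<in>S. Y j)" "\<And>j. j \<in> S \<Longrightarrow> branch K M q h (l + j * K ^ h) (Y j)"
    by auto
  have "card X = (\<Sum>j\<in>S. card (Y j))"
    unfolding S(3)
  proof (rule card_UN_disjoint)
    show "finite S" using S(1) finite_subset by blast
    show "\<forall>i\<in>S. finite (Y i)" using S(4) branch_finite by blast
    show "\<forall>i\<in>S. \<forall>j\<in>S. i \<noteq> j \<longrightarrow> Y i \<inter> Y j = {}"
      using blocks_disjoint[OF branch_range branch_range] S(4) by blast
  qed
  also have "\<dots> = (\<Sum>j\<in>S. M ^ h)" using Suc.IH S(4) by (intro sum.cong) auto
  finally show ?case using S(2) by simp
qed auto

text \<open>
  What a descendant at depth \<open>u\<close> inherits from a branch of height \<open>H\<close> that turns by at most \<open>K * g\<close> as a whole, where \<open>g\<close> is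
  the slope gap to a sibling.
\<close>

definition node :: "nat \<Rightarrow> nat \<Rightarrow> nat \<Rightarrow> nat \<Rightarrow> real \<Rightarrow> nat \<Rightarrow> nat \<Rightarrow> nat set \<Rightarrow> bool" where
  "node K M q H g u l Z \<longleftrightarrow> u \<le> H \<and> branch K M q (H - u) l Z \<and>
     real K ^ u * (slope (l + K ^ (H - u)) - slope l) \<le> 2 ^ u * (real K * g)"

lemma node_descend:
  assumes "node K M q H g u l X" "u \<le> v" "v \<le> H"
  shows "\<exists>I Z. finite I \<and> card I = M ^ (v - u) \<and> X = (\<Union>i\<in>I. Z i) \<and>
    (\<forall>i\<in>I. node K M q H g v (l + i * K ^ (H - v)) (Z i) \<and> Suc i * K ^ (H - v) \<le> K ^ (H - u))"
proof -
  have b: "branch K M q (H - u) l X" and th: "real K ^ u * (slope (l + K ^ (H - u)) - slope l) \<le> 2 ^ u * (real K * g)"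
    using assms by (auto simp: node_def)
  have e: "H - u - (v - u) = H - v" "v - u \<le> H - u" using assms by auto
  obtain I Z where I: "finite I" "card I = M ^ (v - u)" "X = (\<Union>i\<in>I. Z i)"
    and D: "\<And>i. i \<in> I \<Longrightarrow> branch K M q (H - v) (l + i * K ^ (H - v)) (Z i) \<and> Suc i * K ^ (H - v) \<le> K ^ (H - u) \<and>
      real K ^ (v - u) * (slope (l + Suc i * K ^ (H - v)) - slope (l + i * K ^ (H - v))) \<le>
        2 ^ (v - u) * (slope (l + K ^ (H - u)) - slope l)"
    using branch_descend[OF b e(2)] unfolding e(1) by blast
  have "node K M q H g v (l + i * K ^ (H - v)) (Z i)" if "i \<in> I" for i
    unfolding node_def
  proof (intro conjI)
    have p: "real K ^ v = real K ^ u * real K ^ (v - u)" "2 ^ v = 2 ^ (v - u) * (2 ^ u :: real)"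
      using assms(2) by (simp_all add: power_add[symmetric])
    have s: "l + i * K ^ (H - v) + K ^ (H - v) = l + Suc i * K ^ (H - v)" by simp
    have "real K ^ v * (slope (l + i * K ^ (H - v) + K ^ (H - v)) - slope (l + i * K ^ (H - v))) =
        real K ^ u * (real K ^ (v - u) * (slope (l + Suc i * K ^ (H - v)) - slope (l + i * K ^ (H - v))))"
      unfolding p s by (simp only: mult.assoc)
    also have "\<dots> \<le> real K ^ u * (2 ^ (v - u) * (slope (l + K ^ (H - u)) - slope l))"
      using D[OF that] by (intro mult_left_mono) auto
    also have "\<dots> = 2 ^ (v - u) * (real K ^ u * (slope (l + K ^ (H - u)) - slope l))" by (simp only: mult_ac)
    also have "\<dots> \<le> 2 ^ (v - u) * (2 ^ u * (real K * g))" using th by (intro mult_left_mono) auto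
    finally show "real K ^ v * (slope (l + i * K ^ (H - v) + K ^ (H - v)) - slope (l + i * K ^ (H - v))) \<le> 2 ^ v * (real K * g)"
      unfolding p(2) by (simp only: mult.assoc)
  qed (use D[OF that] assms in auto)
  then show ?thesis using I D by blast
qed

lemma node_range: "node K M q H g u l Z \<Longrightarrow> Z \<subseteq> {l..<l + K ^ (H - u)}"
  unfolding node_def using branch_range by blast

lemma node_finite: "node K M q H g u l Z \<Longrightarrow> finite Z"
  by (drule node_range) (simp add: finite_subset)

text \<open>
  One round refines \<open>Z\<close> to depth \<open>2 * t - 2\<close>: a block of depth \<open>t\<close> has relative length \<open>K powr -t\<close> and turns by at
  most \<open>2 ^ t * K powr -t * (K * g)\<close>, so orthogonality holds down to relative length \<open>2 ^ (t + 1) * K powr (1 - 2 * t)\<close>, and \<open>2 ^ (t + 1) \<le> K\<close>. Then the roles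
  are exchanged and the next round starts from depth \<open>2 * t - 2\<close>. Since \<open>t - 2\<close> doubles while
  Cauchy-Schwarz halves exponents, each of the \<open>m\<close> rounds saves the exponent \<open>\<eta> * (t - 2) / 2\<close>. The saving comes
  from the induction hypothesis \<open>J\<close> for the short block, which carries \<open>\<eta> * (H - t)\<close> instead of \<open>\<eta> * H\<close>.
\<close>

lemma bilinear_chain:
  fixes K M q H :: nat and \<eta> B g :: real
  assumes J: "\<And>h l X. h \<le> H \<Longrightarrow> branch K M q h l X \<Longrightarrow> sixth X \<le> real M powr ((3 + \<eta>) * real h + B)"
    and M: "M \<ge> 1" and K: "2 ^ (H + 1) \<le> K" and g: "g > 0" and \<eta>: "0 < \<eta>"
  shows "3 \<le> t \<Longrightarrow> 2 ^ m * t \<le> H \<Longrightarrow> u \<le> 2 * t - 2 \<Longrightarrow> node K M q H g u zl Z \<Longrightarrow> node K M q H g t yl Y \<Longrightarrow>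
    apart g zl (zl + K ^ (H - u)) yl (yl + K ^ (H - t)) \<Longrightarrow>
    mixed Z Y \<le> 9 * real M powr ((real H - real u) + 2 * (real H - real t) + \<eta> * real H + B - \<eta> * real m * (real t - 2) / 2)"
proof (induction m arbitrary: t u zl Z yl Y)
  case 0
  let ?E = "(real H - real u) + 2 * (real H - real t) + \<eta> * real H + B"
  have uH: "u \<le> H" "t \<le> H" using 0 by (auto simp: node_def)
  have bZ: "sixth Z \<le> real M powr ((3 + \<eta>) * real (H - u) + B)" and bY: "sixth Y \<le> real M powr ((3 + \<eta>) * real (H - t) + B)"
    using 0 by (intro J; force simp: node_def)+
  have fin: "finite (point ` Z)" "finite (point ` Y)" using node_finite[OF 0(4)] node_finite[OF 0(5)] by simp_all
  have "mixed Z Y ^ 3 \<le> sixth Z * (sixth Y)\<^sup>2" by (rule mixed_moment_Hoelder[OF fin])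
  also have "\<dots> \<le> real M powr ((3 + \<eta>) * real (H - u) + B) * (real M powr ((3 + \<eta>) * real (H - t) + B))\<^sup>2"
    using bZ bY by (intro mult_mono power_mono) auto
  also have "\<dots> = real M powr (((3 + \<eta>) * real (H - u) + B) + (((3 + \<eta>) * real (H - t) + B) + ((3 + \<eta>) * real (H - t) + B)))"
    by (simp only: power2_eq_square powr_add)
  also have "\<dots> \<le> real M powr (3 * ?E)"
  proof (rule powr_mono)
    have "\<eta> * (real H - real u) \<le> \<eta> * real H" "\<eta> * (real H - real t) \<le> \<eta> * real H" using \<eta> by auto
    then show "((3 + \<eta>) * real (H - u) + B) + (((3 + \<eta>) * real (H - t) + B) + ((3 + \<eta>) * real (H - t) + B)) \<le> 3 * ?E"
      using uH by (simp add: of_nat_diff algebra_simps)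
  qed (use M in auto)
  also have "\<dots> = (real M powr ?E) ^ 3" using M by (simp add: powr_power mult_ac)
  finally have "mixed Z Y \<le> real M powr ?E" by (simp add: power_mono_iff)
  also have "real M powr ?E \<le> 9 * real M powr ?E" using powr_ge_zero[of "real M" ?E] by linarith
  finally show ?case by simp
next
  case (Suc m)
  define v where "v = 2 * t - 2"
  have t: "3 \<le> t" "2 * t \<le> H" "t \<le> v" "u \<le> v" "v \<le> H" "3 \<le> v"
    "2 ^ m * v \<le> H" "t \<le> 2 * v - 2"
  proof -
    have "(1::nat) \<le> 2 ^ m" by simp
    then have "1 * (2 * t) \<le> 2 ^ m * (2 * t)" by (rule mult_right_mono) simp
    moreover have e: "2 ^ m * (2 * t) = 2 ^ Suc m * t" by simp
    ultimately show *: "2 * t \<le> H" using Suc.prems(2) by linarith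
    then show "v \<le> H" unfolding v_def by simp
    have "2 ^ m * v \<le> 2 ^ m * (2 * t)" unfolding v_def by (intro mult_left_mono) auto
    then show "2 ^ m * v \<le> H" using Suc.prems(2) e by linarith
  qed (use Suc.prems v_def in auto)
  have bY: "sixth Y \<le> real M powr ((3 + \<eta>) * real (H - t) + B)"
    using Suc.prems by (intro J; force simp: node_def)
  let ?E1 = "(real H - real t) + 2 * (real H - real v) + \<eta> * real H + B - \<eta> * real m * (real v - 2) / 2"
  let ?E2 = "(3 + \<eta>) * real (H - t) + B"
  let ?w = "3 * real M powr ((?E1 + ?E2) / 2)"
  have sq: "9 * real M powr x * real M powr y = (3 * real M powr ((x + y) / 2))\<^sup>2" for x y
  proof -
    have "real M powr ((x + y) / 2) * real M powr ((x + y) / 2) = real M powr x * real M powr y"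
      by (simp only: powr_add[symmetric] field_sum_of_halves)
    then show ?thesis by (simp add: power2_eq_square)
  qed
  obtain I W where I: "finite I" "card I = M ^ (v - u)" "Z = (\<Union>i\<in>I. W i)"
    and D: "\<And>i. i \<in> I \<Longrightarrow> node K M q H g v (zl + i * K ^ (H - v)) (W i)"
      "\<And>i. i \<in> I \<Longrightarrow> Suc i * K ^ (H - v) \<le> K ^ (H - u)"
    using node_descend[OF Suc.prems(4) t(4,5)] by blast
  have fin: "finite (point ` Y)" "\<And>i. i \<in> I \<Longrightarrow> finite (point ` W i)"
    using node_finite[OF Suc.prems(5)] node_finite[OF D(1)] by simp_all
  have "mixed (\<Union>i\<in>I. W i) Y \<le> 3 * real (card I) * ?w"
  proof (rule mixed_refine)
    show "Y \<subseteq> {yl..<yl + K ^ (H - t)}" by (rule node_range[OF Suc.prems(5)])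
    show "W i \<subseteq> {zl + i * K ^ (H - v)..<zl + i * K ^ (H - v) + K ^ (H - v)}" if "i \<in> I" for i
      by (rule node_range[OF D(1)[OF that]])
    show "(\<Union>i\<in>I. W i) \<subseteq> {zl..<zl + K ^ (H - u)}" using node_range[OF Suc.prems(4)] I(3) by blast
    show "2 * real (K ^ (H - t)) * (slope (yl + K ^ (H - t)) - slope yl) \<le> real (K ^ (H - v)) * g"
    proof -
      let ?T = "slope (yl + K ^ (H - t)) - slope yl"
      have Kp: "real K > 0" using K by (cases K) auto
      have "real (2 ^ (t + 1)) \<le> real (2 ^ (H + 1))" using t by (intro of_nat_mono power_increasing) auto
      also have "\<dots> \<le> real K" using K by (intro of_nat_mono)
      finally have K2: "2 ^ (t + 1) \<le> real K" by simp
      have "real K ^ t * ?T \<le> 2 ^ t * (real K * g)" using Suc.prems(5) by (simp add: node_def)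
      moreover have "real K ^ t = real K ^ (t - 2) * real K * real K"
      proof -
        have "t = Suc (Suc (t - 2))" using t(1) by simp
        then have "real K ^ t = real K ^ Suc (Suc (t - 2))" by (rule arg_cong)
        also have "\<dots> = real K ^ (t - 2) * real K * real K" by (simp only: power_Suc mult_ac)
        finally show ?thesis .
      qed
      ultimately have "2 * (real K ^ (t - 2) * ?T) * real K \<le> 2 ^ (t + 1) * g"
        using Kp by (simp add: mult_ac)
      also have "\<dots> \<le> g * real K" using K2 g by (simp add: mult.commute)
      finally have *: "2 * (real K ^ (t - 2) * ?T) \<le> g" using Kp by (simp only: mult_le_cancel_right_pos)
      have "K ^ (H - t) = K ^ (H - v) * K ^ (t - 2)"
        using t unfolding v_def by (simp add: power_add[symmetric])
      then have "2 * real (K ^ (H - t)) * ?T = real (K ^ (H - v)) * (2 * (real K ^ (t - 2) * ?T))"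
        by (simp add: mult_ac)
      also have "\<dots> \<le> real (K ^ (H - v)) * g" using * by (intro mult_left_mono) auto
      finally show ?thesis .
    qed
    show "mixed (W i) Y \<le> ?w" if i: "i \<in> I" for i
    proof -
      have "apart g yl (yl + K ^ (H - t)) (zl + i * K ^ (H - v)) (zl + i * K ^ (H - v) + K ^ (H - v))"
        using Suc.prems(6) D(2)[OF i] by (subst apart_commute) (rule apart_sub, auto)
      then have IH: "mixed Y (W i) \<le> 9 * real M powr ?E1"
        by (intro Suc.IH[OF t(6,7,8) Suc.prems(5) D(1)[OF i]])
      have "(mixed (W i) Y)\<^sup>2 \<le> mixed Y (W i) * sixth Y" using fin i by (intro mixed_moment_Cauchy_Schwarz) auto
      also have "\<dots> \<le> (9 * real M powr ?E1) * real M powr ?E2" using IH bY by (intro mult_mono) auto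
      also have "\<dots> = ?w\<^sup>2" by (rule sq)
      finally show ?thesis by (rule power2_le_imp_le) simp
    qed
  qed (use I Suc.prems g in auto)
  also have "\<dots> = 9 * real M powr (real (v - u) + (?E1 + ?E2) / 2)"
    using I(2) M by (simp add: powr_add powr_realpow)
  also have "\<dots> \<le> 9 * real M powr ((real H - real u) + 2 * (real H - real t) + \<eta> * real H + B - \<eta> * real (Suc m) * (real t - 2) / 2)"
  proof -
    have v: "real v = 2 * real t - 2" using t unfolding v_def by (simp add: of_nat_diff)
    have "real (v - u) + (?E1 + ?E2) / 2 = (real H - real u) + 2 * (real H - real t) + \<eta> * real H + B - \<eta> * real (Suc m) * (real t - 2) / 2 - \<eta>"
    proof -
      have d: "real (v - u) = real v - real u" "real (H - t) = real H - real t" using t by auto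
      show ?thesis unfolding d v by (simp add: field_simps)
    qed
    then show ?thesis using \<eta> M by (intro mult_left_mono powr_mono) auto
  qed
  finally show ?case unfolding I(3) .
qed

end

section \<open>Sixth moment of a branch\<close>

context convex_sequence
begin

lemma tame_imp_gap_pos:
  assumes "tame K q x y g" "x > 0" "y > 0" "0 \<le> g" "K > 0"
  shows "g > 0"
proof (rule ccontr)
  assume "\<not> g > 0"
  then have "g = 0" using assms(4) by simp
  moreover have "0 < real K ^ q * x" "0 < real K ^ q * y" using assms by simp_all
  ultimately show False using assms(1-3) by (auto simp: tame_def)
qed

text \<open>
  If \<open>Y\<close> is so flat that the refinement reaches single points, only relations with \<open>x = x'\<close> and their
  neighbours remain. What is left is the fourth moment of \<open>Y\<close>; interpolating it between the second and the sixth moment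
  lets only the square root of \<open>W\<close> enter.
\<close>

lemma mixed_flat:
  assumes Z: "branch K M q' H zl Z" and Y: "branch K M q' H yl Y" and K: "K \<ge> 2" and q: "H < q"
    and sep: "apart g zl (zl + K ^ H) yl (yl + K ^ H)" and g: "g > 0"
    and flat: "real K ^ q * (slope (yl + K ^ H) - slope yl) \<le> g"
    and J: "sixth Y \<le> W" and W: "0 \<le> W"
  shows "mixed Z Y \<le> 3 * real M ^ H * sqrt (real M ^ H * W)"
proof -
  let ?T = "slope (yl + K ^ H) - slope yl"
  have T0: "0 \<le> ?T" using slope_le[of yl "yl + K ^ H"] by simp
  obtain I S where I: "finite I" "card I = M ^ H" "Z = (\<Union>i\<in>I. S i)"
    and D: "\<And>i. i \<in> I \<Longrightarrow> branch K M q' 0 (zl + i) (S i)"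
    using branch_descend[OF Z order.refl] by auto
  have S: "S i = {zl + i}" if "i \<in> I" for i using D[OF that] by simp
  have finY: "finite Y" using branch_finite[OF Y] .
  have "mixed (\<Union>i\<in>I. S i) Y \<le> 3 * real (card I) * sqrt (real M ^ H * W)"
  proof (rule mixed_refine[where D = 1])
    show "Y \<subseteq> {yl..<yl + K ^ H}" by (rule branch_range[OF Y])
    show "(\<Union>i\<in>I. S i) \<subseteq> {zl..<zl + K ^ H}" using branch_range[OF Z] I(3) by simp
    show "S i \<subseteq> {zl + i * 1..<zl + i * 1 + 1}" if "i \<in> I" for i using S[OF that] by auto
    have "2 * real (K ^ H) \<le> real K * real K ^ H" using K by (simp add: mult_right_mono)
    also have "\<dots> = real K ^ Suc H" by simp
    also have "\<dots> \<le> real K ^ q" using K q by (intro power_increasing) auto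
    finally have "2 * real (K ^ H) * ?T \<le> real K ^ q * ?T" using T0 by (rule mult_right_mono)
    then show "2 * real (K ^ H) * ?T \<le> real 1 * g" using flat by linarith
    show "mixed (S i) Y \<le> sqrt (real M ^ H * W)" if "i \<in> I" for i
    proof -
      let ?Y = "point ` Y"
      have "mixed (S i) Y = reps [?Y, ?Y, neg ?Y, neg ?Y] 0"
        unfolding mixed_moment_def S[OF that] by simp
      moreover have "(reps [?Y, ?Y, neg ?Y, neg ?Y] 0)\<^sup>2 \<le> real (card ?Y) * sixth Y"
        using finY by (intro energy_le) auto
      moreover have "real (card ?Y) * sixth Y \<le> real M ^ H * W"
        using branch_card[OF Y] J card_image[OF inj_on_subset[OF inj_point subset_UNIV, of Y]]
        by (simp add: mult_left_mono)
      ultimately show ?thesis by (intro real_le_rsqrt) simp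
    qed
  qed (use I sep g W in auto)
  then show ?thesis using I by simp
qed

text \<open>
  Small heights are covered by the trivial bound; this fixes \<open>B\<close>, since \<open>3 * 2 ^ m\<close> is the height needed to run \<open>m\<close> rounds from
  depth \<open>t = 3\<close>. For larger heights, one of the two mixed moments of tame siblings is, up to a constant, smaller by \<open>M powr -26\<close>
  than the bound for the sixth moment of one child. The fourth root in \<open>reps_mixed_le\<close> turns this into \<open>M powr (-13/2)\<close>, which beats the
  \<open>M ^ 6\<close> choices of children.
\<close>

theorem sixth_moment_branch:
  fixes K M q d m :: nat and \<eta> B :: real
  assumes \<eta>: "0 < \<eta>" and m: "64 \<le> \<eta> * real m" "3 \<le> m" and B: "B = 9 * 2 ^ m"
    and M: "M \<ge> 2" and K: "2 ^ (d + 1) \<le> K" and q: "d \<le> q"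
  shows "h \<le> d \<Longrightarrow> branch K M q h l X \<Longrightarrow> sixth X \<le> real M powr ((3 + \<eta>) * real h + B)"
proof (induction h arbitrary: l X rule: less_induct)
  case (less h)
  show ?case
  proof (cases "h \<le> 3 * 2 ^ m")
    case True
    let ?n = "real M ^ h"
    let ?Xs = "[point ` X, point ` X, point ` X, neg (point ` X), neg (point ` X), neg (point ` X)]"
    have len: "length ?Xs = 6" by simp
    have "sixth X \<le> ?n ^ length ?Xs"
      unfolding sixth_moment_def
    proof (rule reps_le_card)
      fix Y assume "Y \<in> set ?Xs"
      then have "Y = point ` X \<or> Y = neg (point ` X)" by auto
      moreover have "card (point ` X) \<le> card X" "card (neg (point ` X)) \<le> card (point ` X)"
        using branch_finite[OF less.prems(2)] by (simp_all add: card_image_le)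
      ultimately have "card Y \<le> card X" by auto
      then show "real (card Y) \<le> ?n" using branch_card[OF less.prems(2)] by (metis of_nat_le_iff of_nat_power)
    qed simp
    also have "\<dots> = real M powr (real (h * 6))"
      unfolding len using M by (subst powr_realpow) (simp, simp only: power_mult)
    also have "\<dots> = real M powr (6 * real h)" by (simp add: mult.commute)
    also have "\<dots> \<le> real M powr ((3 + \<eta>) * real h + B)"
    proof (rule powr_mono)
      have "real h \<le> real (3 * 2 ^ m)" using True by (simp only: of_nat_le_iff)
      then have "real h \<le> 3 * 2 ^ m" by simp
      then have "3 * real h \<le> B" using B by simp
      moreover have "0 \<le> \<eta> * real h" using \<eta> by simp
      ultimately show "6 * real h \<le> (3 + \<eta>) * real h + B" by (simp add: distrib_right)
    qed (use M in simp)
    finally show ?thesis .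
  next
    case False
    then obtain H where H: "h = Suc H" by (cases h) auto
    have mH: "2 ^ m * 3 \<le> H" "3 \<le> H"
    proof -
      show *: "2 ^ m * 3 \<le> H" using False H by simp
      have "(1::nat) \<le> 2 ^ m" by simp
      then show "3 \<le> H" using * by linarith
    qed
    define L where "L = K ^ H"
    have K2: "K \<ge> 2"
    proof -
      have "(2::nat) ^ 1 \<le> 2 ^ (d + 1)" by (intro power_increasing) auto
      then have "2 \<le> (2::nat) ^ (d + 1)" by (simp only: power_one_right)
      then show ?thesis using K by (rule order_trans)
    qed
    have Lpos: "L > 0" using K2 unfolding L_def by simp
    obtain S Y where S: "S \<subseteq> {..<K}" "card S = M" "X = (\<Union>j\<in>S. Y j)"
      and Y: "\<And>j. j \<in> S \<Longrightarrow> branch K M q H (l + j * L) (Y j)"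
      and tm: "\<And>j k. j \<in> S \<Longrightarrow> k \<in> S \<Longrightarrow> j < k \<Longrightarrow> tame K q (slope (l + Suc j * L) - slope (l + j * L))
        (slope (l + Suc k * L) - slope (l + k * L)) (slope (l + k * L) - slope (l + Suc j * L))"
    proof -
      from less.prems(2)[unfolded H branch.simps, folded L_def] obtain S Y
        where A: "S \<subseteq> {..<K}" "card S = M" "X = (\<Union>j\<in>S. Y j)"
          "\<forall>j\<in>S. branch K M q H (l + j * L) (Y j) \<and>
            real K * (slope (l + Suc j * L) - slope (l + j * L)) \<le> 2 * (slope (l + K ^ Suc H) - slope l)"
          "\<forall>j\<in>S. \<forall>k\<in>S. j < k \<longrightarrow> tame K q (slope (l + Suc j * L) - slope (l + j * L))
            (slope (l + Suc k * L) - slope (l + k * L)) (slope (l + k * L) - slope (l + Suc j * L))"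
        by (elim exE conjE)
      show thesis using A(4,5) by (intro that[OF A(1-3)]) simp_all
    qed
    have finS: "finite S" using S(1) finite_subset by blast
    define e where "e = (3 + \<eta>) * real H + B"
    let ?W = "real M powr e"
    let ?V = "2 * real M powr (e - 13 / 2)"
    have IH: "sixth Z \<le> real M powr ((3 + \<eta>) * real h' + B)" if "h' \<le> H" "branch K M q h' l' Z" for h' l' Z
      by (rule less.IH) (use less.prems(1) that H in auto)
    have IHW: "sixth Z \<le> ?W" if "branch K M q H l' Z" for l' Z
      unfolding e_def by (rule IH[OF order.refl that])
    have V4: "?V ^ 4 = 16 * real M powr (4 * e - 26)"
      using M by (simp add: power_mult_distrib powr_power algebra_simps)
    have W3: "?W ^ 3 = real M powr (3 * e)" using M by (simp add: powr_power mult.commute)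
    have small: "Q * ?W ^ 3 \<le> ?V ^ 4" if "Q \<le> 9 * real M powr (e - 26)" for Q
    proof -
      have "Q * ?W ^ 3 \<le> 9 * real M powr (e - 26) * ?W ^ 3" using that by (intro mult_right_mono) auto
      also have "\<dots> = 9 * real M powr (4 * e - 26)" unfolding W3 by (simp only: mult.assoc powr_add[symmetric]) (simp add: algebra_simps)
      also have "\<dots> \<le> ?V ^ 4" unfolding V4 by simp
      finally show ?thesis .
    qed
    have pair: "mixed (Y j) (Y k) \<le> 9 * real M powr (e - 26) \<or> mixed (Y k) (Y j) \<le> 9 * real M powr (e - 26)"
      if jk: "j \<in> S" "k \<in> S" "j < k" for j k
    proof -
      define g where "g = slope (l + k * L) - slope (l + Suc j * L)"
      have "Suc j * L \<le> k * L" using jk by (intro mult_right_mono) auto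
      then have g0: "0 \<le> g" unfolding g_def using slope_le[of "l + Suc j * L" "l + k * L"] by simp
      have g: "g > 0"
        using tame_imp_gap_pos[OF tm[OF jk]] g0 K2 Lpos slope_less[of "l + j * L" "l + Suc j * L"] slope_less[of "l + k * L" "l + Suc k * L"]
        unfolding g_def by simp
      have en: "l + i * L + K ^ H = l + Suc i * L" for i by (simp add: L_def)
      have ap: "apart g (l + j * L) (l + j * L + K ^ H) (l + k * L) (l + k * L + K ^ H)"
        using \<open>Suc j * L \<le> k * L\<close> unfolding apart_def en g_def by auto
      have flat: "3 * real M ^ H * sqrt (real M ^ H * ?W) \<le> 9 * real M powr (e - 26)"
      proof -
        have "real M ^ H = real M powr real H" using M by (simp add: powr_realpow)
        then have "3 * real M ^ H * sqrt (real M ^ H * ?W) = 3 * real M powr (real H + (real H + e) / 2)"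
          using M by (simp add: powr_add[symmetric] powr_half_sqrt[symmetric] powr_powr)
        also have "\<dots> \<le> 9 * real M powr (e - 26)"
        proof (intro mult_mono powr_mono)
          have "(2::real) ^ 3 \<le> 2 ^ m" using m by (intro power_increasing) auto
          then have "52 \<le> B" using B by simp
          moreover have "0 \<le> \<eta> * real H" using \<eta> by simp
          ultimately show "real H + (real H + e) / 2 \<le> e - 26" unfolding e_def by (simp add: field_simps)
        qed (use M in auto)
        finally show ?thesis .
      qed
      have Hq: "H < q" using q less.prems(1) H by simp
      from tm[OF jk, folded g_def] show ?thesis unfolding tame_def
      proof (elim disjE)
        assume A: "real K ^ q * (slope (l + Suc j * L) - slope (l + j * L)) \<le> g"
        have "mixed (Y k) (Y j) \<le> 3 * real M ^ H * sqrt (real M ^ H * ?W)"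
          using A by (intro mixed_flat[OF Y[OF jk(2)] Y[OF jk(1)] K2 Hq _ g _ IHW[OF Y[OF jk(1)]]]) (use ap in \<open>auto simp: en apart_commute\<close>)
        then show ?thesis using flat by linarith
      next
        assume A: "real K ^ q * (slope (l + Suc k * L) - slope (l + k * L)) \<le> g"
        have "mixed (Y j) (Y k) \<le> 3 * real M ^ H * sqrt (real M ^ H * ?W)"
          using A by (intro mixed_flat[OF Y[OF jk(1)] Y[OF jk(2)] K2 Hq _ g _ IHW[OF Y[OF jk(2)]]]) (use ap in \<open>auto simp: en\<close>)
        then show ?thesis using flat by linarith
      next
        assume A: "slope (l + Suc j * L) - slope (l + j * L) \<le> real K * g \<and> slope (l + Suc k * L) - slope (l + k * L) \<le> real K * g"
        have nj: "node K M q H g 0 (l + j * L) (Y j)" and nk: "node K M q H g 0 (l + k * L) (Y k)"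
          using Y jk A unfolding node_def by (simp_all add: en del: mult_Suc)
        obtain I Z where I: "finite I" "card I = M ^ 3" "Y k = (\<Union>i\<in>I. Z i)"
          and Z: "\<And>i. i \<in> I \<Longrightarrow> node K M q H g 3 (l + k * L + i * K ^ (H - 3)) (Z i) \<and> Suc i * K ^ (H - 3) \<le> K ^ H"
          using node_descend[OF nk, of 3] mH by auto
        let ?w = "9 * real M powr ((real H - real 0) + 2 * (real H - real 3) + \<eta> * real H + B - \<eta> * real m * (real 3 - 2) / 2)"
        have "2 ^ (H + 1) \<le> (2::nat) ^ (d + 1)" using less.prems(1) H by (intro power_increasing) auto
        then have KH: "2 ^ (H + 1) \<le> K" using K by linarith
        have b: "mixed (Y j) (Z i) \<le> ?w" if "i \<in> I" for i
        proof (rule bilinear_chain[where H = H and t = 3 and u = 0 and m = m and g = g])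
          show "sixth X' \<le> real M powr ((3 + \<eta>) * real h' + B)" if "h' \<le> H" "branch K M q h' l' X'" for h' l' X'
            by (rule IH[OF that])
          show "apart g (l + j * L) (l + j * L + K ^ (H - 0)) (l + k * L + i * K ^ (H - 3)) (l + k * L + i * K ^ (H - 3) + K ^ (H - 3))"
            using ap Z[OF that] apart_sub[of g "l + k * L" "l + k * L + K ^ H" "l + j * L" "l + j * L + K ^ H" "l + k * L + i * K ^ (H - 3)" "l + k * L + i * K ^ (H - 3) + K ^ (H - 3)"]
            by (simp add: apart_commute)
        qed (use M KH g \<eta> mH nj Z that in auto)
        have eq: "point ` Y k = (\<Union>i\<in>I. point ` Z i)" unfolding I(3) by blast
        have "mixed (Y j) (Y k) \<le> real (card I) ^ 4 * ?w"
          unfolding eq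
        proof (rule mixed_moment_UN_right_le)
          show "finite (point ` Y j)" using branch_finite[OF Y[OF jk(1)]] by simp
          show "finite (point ` Z i)" if "i \<in> I" for i using node_finite Z[OF that] by blast
          show "point ` Z i \<inter> point ` Z i' = {}" if "i \<in> I" "i' \<in> I" "i \<noteq> i'" for i i'
          proof -
            have "Z i \<inter> Z i' = {}"
              by (rule blocks_disjoint[OF node_range[of K M q H g 3] node_range[of K M q H g 3] that(3)]) (use Z that in blast)+
            then show ?thesis using inj_point by (simp add: image_Int[symmetric])
          qed
        qed (use I b in auto)
        also have "\<dots> = 9 * real M powr (12 + ((real H - real 0) + 2 * (real H - real 3) + \<eta> * real H + B - \<eta> * real m * (real 3 - 2) / 2))"
        proof -
          have "real (card I) ^ 4 = real M ^ (3 * 4)" by (simp only: I(2) of_nat_power power_mult)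
          also have "\<dots> = real M powr 12" using powr_realpow[of "real M" 12] M by simp
          finally show ?thesis by (simp only: powr_add mult_ac)
        qed
        \<comment> \<open>cutting \<open>Y k\<close> into \<open>M ^ 3\<close> pieces costs \<open>M ^ 12\<close>, of which \<open>M ^ 6\<close> is regained; the chain saves \<open>M ^ 32\<close>\<close>
        also have "\<dots> \<le> 9 * real M powr (e - 26)"
          using m(1) M by (intro mult_left_mono powr_mono) (auto simp: algebra_simps e_def)
        finally show ?thesis by blast
      qed
    qed
    have eqX: "point ` X = (\<Union>k\<in>S. point ` Y k)" unfolding S(3) by blast
    have "sixth X \<le> real (card S) * ?W + real (card S) ^ 6 * ?V"
      unfolding eqX
    proof (rule sixth_moment_UN_le[OF finS])
      show "finite (point ` Y k)" if "k \<in> S" for k using branch_finite[OF Y[OF that]] by simp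
      show "point ` Y i \<inter> point ` Y j = {}" if "i \<in> S" "j \<in> S" "i \<noteq> j" for i j
      proof -
        have "Y i \<inter> Y j = {}"
          by (rule blocks_disjoint[OF _ _ that(3)]) (use branch_range[OF Y] that in \<open>auto simp: L_def\<close>)
        then show ?thesis using inj_point by (simp add: image_Int[symmetric])
      qed
      show "sixth (Y k) \<le> ?W" if "k \<in> S" for k by (rule IHW[OF Y[OF that]])
      show "mixed (Y i) (Y j) * ?W ^ 3 \<le> ?V ^ 4 \<or> mixed (Y j) (Y i) * ?W ^ 3 \<le> ?V ^ 4"
        if "i \<in> S" "j \<in> S" "i \<noteq> j" for i j
      proof (cases "i < j")
        case True
        then show ?thesis using pair[OF that(1,2)] small by blast
      next
        case False
        then show ?thesis using pair[OF that(2,1)] small that(3) by fastforce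
      qed
    qed simp
    also have "\<dots> = real M powr (1 + e) + 2 * real M powr (e - 1 / 2)"
    proof -
      have "real M ^ 6 = real M powr 6" "real M = real M powr 1" using powr_realpow[of "real M" 6] M by simp_all
      then have "real M ^ 6 * real M powr (e - 13 / 2) = real M powr (6 + (e - 13 / 2))" "real M * ?W = real M powr (1 + e)"
        by (simp_all only: powr_add)
      then show ?thesis using S(2) by (simp add: algebra_simps)
    qed
    also have "\<dots> \<le> real M powr (1 + e) + 2 * real M powr (1 + e)"
      using M by (intro add_mono mult_left_mono powr_mono) auto
    also have "\<dots> = 3 * real M powr (1 + e)" by simp
    also have "\<dots> \<le> (real M * real M) * real M powr (1 + e)"
      using mult_mono[of 2 "real M" 2 "real M"] M by (intro mult_right_mono) auto
    also have "\<dots> = real M powr (3 + e)" 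
    proof -
      have "real M * real M = real M powr 2" using powr_realpow[of "real M" 2] M by (simp add: power2_eq_square)
      moreover have "real M powr (3 + e) = real M powr 2 * real M powr (1 + e)"
        by (simp only: powr_add[symmetric]) simp
      ultimately show ?thesis by (simp only:)
    qed
    also have "\<dots> \<le> real M powr ((3 + \<eta>) * real h + B)"
      using M \<eta> H by (intro powr_mono) (auto simp: algebra_simps e_def)
    finally show ?thesis .
  qed
qed

end

section \<open>Sums, differences and moments of a finite set\<close>

definition rdiff :: "real set \<Rightarrow> real \<Rightarrow> real" where
  "rdiff A d = real (card {p \<in> A \<times> A. fst p - snd p = d})"

definition rsum :: "real set \<Rightarrow> real \<Rightarrow> real" where
  "rsum A s = real (card {p \<in> A \<times> A. fst p + snd p = s})"

definition cubic_energy :: "real set \<Rightarrow> real" where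
  "cubic_energy A = (\<Sum>d\<in>(\<lambda>p. fst p - snd p) ` (A \<times> A). rdiff A d ^ 3)"

lemma card_eq_sum: "finite A \<Longrightarrow> finite B \<Longrightarrow>
  real (card {p \<in> A \<times> B. P (fst p) (snd p)}) = (\<Sum>x\<in>A. \<Sum>y\<in>B. if P x y then 1 else 0)"
proof -
  assume f: "finite A" "finite B"
  have "(\<Sum>x\<in>A. \<Sum>y\<in>B. if P x y then 1 else 0 :: real) = (\<Sum>p\<in>A \<times> B. if P (fst p) (snd p) then 1 else 0)"
    by (simp add: sum.cartesian_product case_prod_unfold)
  also have "\<dots> = (\<Sum>p\<in>{p \<in> A \<times> B. P (fst p) (snd p)}. 1)"
    using f by (intro sum.inter_filter[symmetric]) simp
  finally show ?thesis by simp
qed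

lemma rdiff_reps:
  assumes "finite A" shows "reps [A, neg A] d = rdiff A d"
proof -
  have "(\<Sum>y\<in>neg A. if d - x - y = 0 then 1 else 0 :: real) = (\<Sum>y\<in>A. if x - y = d then 1 else 0)" for x
    by (subst sum.reindex, simp, rule sum.cong[OF refl]) (auto simp: o_def)
  then show ?thesis unfolding rdiff_def using card_eq_sum[OF assms assms, of "\<lambda>x y. x - y = d"]
    by (simp only: reps.simps)
qed

lemma rsum_reps:
  assumes "finite A" shows "reps [A, A] s = rsum A s"
proof -
  have "(\<Sum>y\<in>A. if s - x - y = 0 then 1 else 0 :: real) = (\<Sum>y\<in>A. if x + y = s then 1 else 0)" for x
    by (rule sum.cong[OF refl]) auto
  then show ?thesis unfolding rsum_def using card_eq_sum[OF assms assms, of "\<lambda>x y. x + y = s"]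
    by (simp only: reps.simps)
qed

lemma rdiff_minus: "rdiff A (- d) = rdiff A d"
proof -
  have "bij_betw (\<lambda>(x, y). (y, x)) {p \<in> A \<times> A. fst p - snd p = - d} {p \<in> A \<times> A. fst p - snd p = d}"
    by (rule bij_betw_byWitness[where f' = "\<lambda>(x, y). (y, x)"]) auto
  then show ?thesis unfolding rdiff_def using bij_betw_same_card by fastforce
qed

lemma rdiff_nonneg [simp]: "0 \<le> rdiff A d" and rsum_nonneg [simp]: "0 \<le> rsum A s"
  by (simp_all add: rdiff_def rsum_def)

lemma rdiff_pos: "finite A \<Longrightarrow> x \<in> A \<Longrightarrow> y \<in> A \<Longrightarrow> 1 \<le> rdiff A (x - y)"
  unfolding rdiff_def by (auto simp: Suc_le_eq card_gt_0_iff)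

lemma rsum_pos: "finite A \<Longrightarrow> x \<in> A \<Longrightarrow> y \<in> A \<Longrightarrow> 1 \<le> rsum A (x + y)"
  unfolding rsum_def by (auto simp: Suc_le_eq card_gt_0_iff)

lemma rdiff_mono: "finite B \<Longrightarrow> A \<subseteq> B \<Longrightarrow> rdiff A d \<le> rdiff B d"
  unfolding rdiff_def by (auto intro!: card_mono)

lemma cubic_energy_mono:
  assumes "finite B" "A \<subseteq> B" shows "cubic_energy A \<le> cubic_energy B"
proof -
  have "cubic_energy A \<le> (\<Sum>d\<in>(\<lambda>p. fst p - snd p) ` (A \<times> A). rdiff B d ^ 3)"
    unfolding cubic_energy_def using rdiff_mono[OF assms] by (intro sum_mono power_mono) auto
  also have "\<dots> \<le> cubic_energy B"
    unfolding cubic_energy_def using assms by (intro sum_mono2) auto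
  finally show ?thesis .
qed

lemma sum_fibres:
  fixes h :: "'b \<Rightarrow> real"
  assumes "finite T"
  shows "(\<Sum>t\<in>T. h (g t)) = (\<Sum>z\<in>g ` T. real (card {t \<in> T. g t = z}) * h z)"
  using sum.image_gen[OF assms, of "\<lambda>t. h (g t)" g] by simp

lemma weighted_Cauchy_Schwarz:
  fixes w :: "'b \<Rightarrow> real"
  assumes T: "finite T"
  shows "(\<Sum>t\<in>T. w (g t))\<^sup>2 \<le> real (card {p \<in> T \<times> T. g (fst p) = g (snd p)}) * (\<Sum>z\<in>g ` T. (w z)\<^sup>2)"
proof -
  let ?c = "\<lambda>z. real (card {t \<in> T. g t = z})"
  have "(\<Sum>t\<in>T. w (g t))\<^sup>2 = (\<Sum>z\<in>g ` T. ?c z * w z)\<^sup>2"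
    by (subst sum_fibres[OF T]) simp
  also have "\<dots> \<le> (\<Sum>z\<in>g ` T. (?c z)\<^sup>2) * (\<Sum>z\<in>g ` T. (w z)\<^sup>2)"
    by (rule Cauchy_Schwarz_ineq_sum)
  also have "(\<Sum>z\<in>g ` T. (?c z)\<^sup>2) = (\<Sum>t\<in>T. ?c (g t))"
    by (subst sum_fibres[OF T]) (simp add: power2_eq_square)
  also have "\<dots> = (\<Sum>t\<in>T. \<Sum>t'\<in>T. if g t = g t' then 1 else 0)"
  proof (rule sum.cong[OF refl])
    fix t
    have "{t' \<in> T. g t' = g t} = {t' \<in> T. g t = g t'}" by auto
    then show "?c (g t) = (\<Sum>t'\<in>T. if g t = g t' then 1 else 0)"
      using T by (simp add: sum.inter_filter[symmetric])
  qed
  also have "\<dots> = real (card {p \<in> T \<times> T. g (fst p) = g (snd p)})"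
    using card_eq_sum[OF T T, of "\<lambda>t t'. g t = g t'"] by simp
  finally show ?thesis .
qed

text \<open>
  Two triples that differ by one common translation are the same as three representations of a
  single difference.
\<close>

lemma card_shift_pairs_le_cubic_energy:
  fixes P :: "((real \<times> real \<times> real) \<times> (real \<times> real \<times> real)) set"
  assumes A: "finite A"
    and P: "\<And>a b c a' b' c'. ((a, b, c), (a', b', c')) \<in> P \<Longrightarrow> {a, b, c, a', b', c'} \<subseteq> A \<and> a - a' = b - b' \<and> a - a' = c - c'"
  shows "real (card P) \<le> cubic_energy A"
proof -
  let ?D = "(\<lambda>p. fst p - snd p) ` (A \<times> A)"
  let ?R = "\<lambda>d. {p \<in> A \<times> A. fst p - snd p = d}"
  let ?f = "\<lambda>((a, b, c), (a', b', c')). (a - a', (a, a'), (b, b'), (c, c'))"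
  have fin: "finite ?D" "finite (?R d)" for d using A by auto
  have "card P \<le> card (SIGMA d:?D. ?R d \<times> ?R d \<times> ?R d)"
  proof (rule card_inj_on_le)
    show "inj_on ?f P" by (auto simp: inj_on_def)
    show "?f ` P \<subseteq> (SIGMA d:?D. ?R d \<times> ?R d \<times> ?R d)"
    proof clarify
      fix a b c a' b' c' assume "((a, b, c), (a', b', c')) \<in> P"
      from P[OF this] show "a - a' \<in> ?D \<and> ((a, a'), (b, b'), (c, c')) \<in> ?R (a - a') \<times> ?R (a - a') \<times> ?R (a - a')"
        by force
    qed
    show "finite (SIGMA d:?D. ?R d \<times> ?R d \<times> ?R d)" using fin by auto
  qed
  also have "\<dots> = (\<Sum>d\<in>?D. card (?R d) ^ 3)"
    using fin by (simp add: card_SigmaI card_cartesian_product power3_eq_cube mult.assoc)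
  finally have "real (card P) \<le> real (\<Sum>d\<in>?D. card (?R d) ^ 3)" by (rule of_nat_mono)
  then show ?thesis by (simp add: cubic_energy_def rdiff_def)
qed

lemma sixth_moment_eq_diff:
  assumes A: "finite A"
  defines "D \<equiv> (\<lambda>p. fst p - snd p) ` (A \<times> A)"
  shows "sixth_moment A = (\<Sum>(x, y)\<in>D \<times> D. rdiff A x * rdiff A y * rdiff A (x + y))"
proof -
  have D: "finite D" "sums_of [A, neg A] \<subseteq> D" using A by (force simp: D_def)+
  have "sixth_moment A = reps ([A, neg A] @ [A, neg A] @ [A, neg A]) 0"
    unfolding sixth_moment_def by (rule reps_perm) simp
  also have "\<dots> = (\<Sum>x\<in>D. reps [A, neg A] x * (\<Sum>y\<in>D. reps [A, neg A] y * reps [A, neg A] (0 - x - y)))"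
    by (simp only: reps_append[OF D])
  also have "\<dots> = (\<Sum>x\<in>D. rdiff A x * (\<Sum>y\<in>D. rdiff A y * rdiff A (- (x + y))))"
    by (simp only: rdiff_reps[OF A]) (simp add: algebra_simps)
  also have "\<dots> = (\<Sum>x\<in>D. \<Sum>y\<in>D. rdiff A x * rdiff A y * rdiff A (x + y))"
    unfolding rdiff_minus by (simp add: sum_distrib_left mult.assoc)
  finally show ?thesis by (simp add: sum.cartesian_product)
qed

lemma sixth_moment_eq_sum:
  assumes A: "finite A"
  defines "S \<equiv> (\<lambda>p. fst p + snd p) ` (A \<times> A)"
  shows "sixth_moment A = (\<Sum>(s, t)\<in>S \<times> S. rsum A s * rsum A t * rdiff A (s - t))"
proof -
  have S: "finite S" "sums_of [A, A] \<subseteq> S" using A by (force simp: S_def)+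
  have S': "finite (neg S)" "sums_of [neg A, neg A] \<subseteq> neg S" using A by (force simp: S_def image_iff)+
  have nn: "reps [neg A, neg A] (- t) = rsum A t" for t
    using reps_neg[of "[A, A]" "- t"] rsum_reps[OF A, of t] by simp
  have "sixth_moment A = reps ([A, A] @ [neg A, neg A] @ [A, neg A]) 0"
    unfolding sixth_moment_def by (rule reps_perm) simp
  also have "\<dots> = (\<Sum>s\<in>S. reps [A, A] s * (\<Sum>t\<in>neg S. reps [neg A, neg A] t * reps [A, neg A] (0 - s - t)))"
    by (simp only: reps_append[OF S] reps_append[OF S'])
  also have "\<dots> = (\<Sum>s\<in>S. reps [A, A] s * (\<Sum>t\<in>S. reps [neg A, neg A] (- t) * reps [A, neg A] (- (s - t))))"
    by (simp add: sum.reindex algebra_simps del: reps.simps)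
  also have "\<dots> = (\<Sum>s\<in>S. rsum A s * (\<Sum>t\<in>S. rsum A t * rdiff A (s - t)))"
    by (simp only: rdiff_reps[OF A] rsum_reps[OF A] nn rdiff_minus)
  also have "\<dots> = (\<Sum>s\<in>S. \<Sum>t\<in>S. rsum A s * rsum A t * rdiff A (s - t))"
    by (simp add: sum_distrib_left mult.assoc)
  finally show ?thesis by (simp add: sum.cartesian_product)
qed

lemma ln_ge_one_minus_inverse: "0 < (x::real) \<Longrightarrow> 1 - 1 / x \<le> ln x"
  using ln_le_minus_one[of "1 / x"] by (simp add: ln_div)

text \<open>
  A tangent inequality, with equality at \<open>x = y = z = T\<close>. It bounds sums of square roots from below by sums of reciprocals,
  which are exactly computable for representation counts; it takes the place of a selection of popular
  differences.
\<close>

lemma sqrt_prod3_ge: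
  fixes x y z T :: real
  assumes "0 < x" "0 < y" "0 < z" "0 < T"
  shows "sqrt (T ^ 3) * (5 / 2 - T / 2 * (1 / x + 1 / y + 1 / z)) \<le> sqrt (x * y * z)"
proof -
  define Q where "Q = (x / T) * (y / T) * (z / T)"
  have Q: "Q > 0" using assms by (simp add: Q_def)
  have "sqrt Q \<ge> 1 + ln (sqrt Q)" using ln_le_minus_one[of "sqrt Q"] Q by simp
  also have "ln (sqrt Q) = (ln (x / T) + ln (y / T) + ln (z / T)) / 2"
  proof -
    have ln3: "ln (u * v * w) = ln u + ln v + ln w" if "0 < u" "0 < v" "0 < w" for u v w :: real
      using that by (simp add: ln_mult)
    have "ln Q = ln (x / T) + ln (y / T) + ln (z / T)" unfolding Q_def using assms by (intro ln3) auto
    then show ?thesis using Q by (simp add: ln_sqrt)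
  qed
  finally have "sqrt Q \<ge> 1 + (ln (x / T) + ln (y / T) + ln (z / T)) / 2" .
  moreover have "1 - T / x \<le> ln (x / T)" "1 - T / y \<le> ln (y / T)" "1 - T / z \<le> ln (z / T)"
    using ln_ge_one_minus_inverse[of "x / T"] ln_ge_one_minus_inverse[of "y / T"] ln_ge_one_minus_inverse[of "z / T"] assms by auto
  moreover have "T / 2 * (1 / x + 1 / y + 1 / z) = (T / x + T / y + T / z) / 2" by (simp add: distrib_left add_divide_distrib)
  ultimately have "5 / 2 - T / 2 * (1 / x + 1 / y + 1 / z) \<le> sqrt Q" by argo
  then have "sqrt (T ^ 3) * (5 / 2 - T / 2 * (1 / x + 1 / y + 1 / z)) \<le> sqrt (T ^ 3) * sqrt Q"
    using assms by (intro mult_left_mono) auto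
  also have "\<dots> = sqrt (T ^ 3 * Q)" by (simp add: real_sqrt_mult)
  also have "T ^ 3 * Q = x * y * z" using assms by (simp add: Q_def power3_eq_cube)
  finally show ?thesis .
qed

lemma sqrt_prod2_ge:
  fixes x y T :: real
  assumes "0 < x" "0 < y" "0 < T"
  shows "T * (2 - T / 2 * (1 / x + 1 / y)) \<le> sqrt (x * y)"
proof -
  define Q where "Q = (x / T) * (y / T)"
  have Q: "Q > 0" using assms by (simp add: Q_def)
  have "sqrt Q \<ge> 1 + ln (sqrt Q)" using ln_le_minus_one[of "sqrt Q"] Q by simp
  also have "ln (sqrt Q) = (ln (x / T) + ln (y / T)) / 2"
  proof -
    have ln2: "ln (u * v) = ln u + ln v" if "0 < u" "0 < v" for u v :: real
      using that by (simp add: ln_mult)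
    have "ln Q = ln (x / T) + ln (y / T)" unfolding Q_def using assms by (intro ln2) auto
    then show ?thesis using Q by (simp add: ln_sqrt)
  qed
  finally have "sqrt Q \<ge> 1 + (ln (x / T) + ln (y / T)) / 2" .
  moreover have "1 - T / x \<le> ln (x / T)" "1 - T / y \<le> ln (y / T)"
    using ln_ge_one_minus_inverse[of "x / T"] ln_ge_one_minus_inverse[of "y / T"] assms by auto
  moreover have "T / 2 * (1 / x + 1 / y) = (T / x + T / y) / 2" by (simp add: distrib_left add_divide_distrib)
  ultimately have "2 - T / 2 * (1 / x + 1 / y) \<le> sqrt Q" by argo
  then have "T * (2 - T / 2 * (1 / x + 1 / y)) \<le> T * sqrt Q"
    using assms by (intro mult_left_mono) auto
  also have "\<dots> = sqrt (T\<^sup>2 * Q)" using assms by (simp add: real_sqrt_mult)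
  also have "T\<^sup>2 * Q = x * y" using assms by (simp add: Q_def power2_eq_square)
  finally show ?thesis .
qed

lemma sum_inverse_rdiff:
  assumes A: "finite A"
  shows "(\<Sum>x\<in>A. \<Sum>y\<in>A. 1 / rdiff A (x - y)) = real (card ((\<lambda>p. fst p - snd p) ` (A \<times> A)))"
proof -
  have "(\<Sum>x\<in>A. \<Sum>y\<in>A. 1 / rdiff A (x - y)) = (\<Sum>p\<in>A \<times> A. 1 / rdiff A (fst p - snd p))"
    by (simp add: sum.cartesian_product case_prod_unfold)
  also have "\<dots> = (\<Sum>d\<in>(\<lambda>p. fst p - snd p) ` (A \<times> A). rdiff A d * (1 / rdiff A d))"
    unfolding rdiff_def by (rule sum_fibres) (use A in simp)
  also have "\<dots> = (\<Sum>d\<in>(\<lambda>p. fst p - snd p) ` (A \<times> A). 1)"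
    using rdiff_pos[OF A] by (intro sum.cong) force+
  finally show ?thesis by simp
qed

lemma sum_inverse_rsum:
  assumes A: "finite A"
  shows "(\<Sum>x\<in>A. \<Sum>y\<in>A. 1 / rsum A (x + y)) = real (card ((\<lambda>p. fst p + snd p) ` (A \<times> A)))"
proof -
  have "(\<Sum>x\<in>A. \<Sum>y\<in>A. 1 / rsum A (x + y)) = (\<Sum>p\<in>A \<times> A. 1 / rsum A (fst p + snd p))"
    by (simp add: sum.cartesian_product case_prod_unfold)
  also have "\<dots> = (\<Sum>d\<in>(\<lambda>p. fst p + snd p) ` (A \<times> A). rsum A d * (1 / rsum A d))"
    unfolding rsum_def by (rule sum_fibres) (use A in simp)
  also have "\<dots> = (\<Sum>d\<in>(\<lambda>p. fst p + snd p) ` (A \<times> A). 1)"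
    using rsum_pos[OF A] by (intro sum.cong) force+
  finally show ?thesis by simp
qed

text \<open>
  Sum the weight \<open>sqrt (r (a - b) * r (b - c) * r (a - c))\<close> over all triples. By the tangent inequality with \<open>T = n\<^sup>2 / card D\<close> this
  is at least \<open>n ^ 3 * sqrt (T ^ 3)\<close>. By Cauchy-Schwarz over the fibres of \<open>(a, b, c) \<mapsto> (a - b, b - c)\<close> its square is at most
  the number of pairs of triples in a common fibre, which \<open>cubic_energy\<close> bounds, times the sum of the squared weights, which \<open>sixth_moment\<close> bounds.
\<close>

theorem difference_set_bound:
  assumes A: "finite A"
  shows "real (card A) ^ 12 \<le> real (card ((\<lambda>p. fst p - snd p) ` (A \<times> A))) ^ 3 * cubic_energy A * sixth_moment A"
proof (cases "A = {}")
  case False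
  define D where "D = (\<lambda>p. fst p - snd p) ` (A \<times> A)"
  define n where "n = real (card A)"
  have n: "n > 0" using A False by (simp add: n_def card_gt_0_iff)
  have D: "finite D" "real (card D) > 0" using A False by (auto simp: D_def card_gt_0_iff)
  define T where "T = n\<^sup>2 / real (card D)"
  have T: "T > 0" using n D by (simp add: T_def)
  let ?r = "rdiff A"
  let ?g = "\<lambda>(a, b, c). (a - b, b - c)"
  let ?w = "\<lambda>(x, y). sqrt (?r x * ?r y * ?r (x + y))"
  let ?T = "A \<times> A \<times> A"
  have pos: "?r (x - y) > 0" if "x \<in> A" "y \<in> A" for x y using rdiff_pos[OF A that] by linarith
  have inv: "(\<Sum>x\<in>A. \<Sum>y\<in>A. 1 / ?r (x - y)) = real (card D)"
    unfolding D_def by (rule sum_inverse_rdiff[OF A])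
  have "n ^ 3 * sqrt (T ^ 3) = (\<Sum>a\<in>A. \<Sum>b\<in>A. \<Sum>c\<in>A. sqrt (T ^ 3) * (5 / 2 - T / 2 * (1 / ?r (a - b) + 1 / ?r (b - c) + 1 / ?r (a - c))))"
  proof -
    have lin: "(\<Sum>a\<in>A. \<Sum>b\<in>A. \<Sum>c\<in>A. s * (5 / 2 - t * (u a b c + v a b c + w a b c))) =
      s * (5 / 2 * n ^ 3 - t * ((\<Sum>a\<in>A. \<Sum>b\<in>A. \<Sum>c\<in>A. u a b c) + (\<Sum>a\<in>A. \<Sum>b\<in>A. \<Sum>c\<in>A. v a b c) +
        (\<Sum>a\<in>A. \<Sum>b\<in>A. \<Sum>c\<in>A. w a b c)))" for s t :: real and u v w
      by (simp only: sum_distrib_left[symmetric] sum_subtractf sum.distrib sum_constant)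
        (simp add: n_def power3_eq_cube)
    have 1: "(\<Sum>a\<in>A. \<Sum>b\<in>A. \<Sum>c\<in>A. 1 / ?r (a - b)) = n * card D"
      unfolding inv[symmetric] n_def by (simp only: sum_constant sum_distrib_left)
    have 2: "(\<Sum>a\<in>A. \<Sum>b\<in>A. \<Sum>c\<in>A. 1 / ?r (b - c)) = n * card D"
      unfolding inv[symmetric] n_def by (simp only: sum_constant)
    have 3: "(\<Sum>a\<in>A. \<Sum>b\<in>A. \<Sum>c\<in>A. 1 / ?r (a - c)) = n * card D"
      unfolding inv[symmetric] n_def by (simp only: sum_constant sum_distrib_left)
    have "(\<Sum>a\<in>A. \<Sum>b\<in>A. \<Sum>c\<in>A. sqrt (T ^ 3) * (5 / 2 - T / 2 * (1 / ?r (a - b) + 1 / ?r (b - c) + 1 / ?r (a - c)))) =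
      sqrt (T ^ 3) * (5 / 2 * n ^ 3 - T / 2 * (n * card D + n * card D + n * card D))"
      unfolding lin 1 2 3 ..
    also have "T / 2 * (n * card D + n * card D + n * card D) = 3 / 2 * n ^ 3"
      using D by (auto simp: T_def power2_eq_square power3_eq_cube card_gt_0_iff)
    finally show ?thesis by (simp add: mult.commute)
  qed
  also have "\<dots> \<le> (\<Sum>a\<in>A. \<Sum>b\<in>A. \<Sum>c\<in>A. sqrt (?r (a - b) * ?r (b - c) * ?r (a - c)))"
    using T by (intro sum_mono sqrt_prod3_ge pos)
  also have "\<dots> = (\<Sum>t\<in>?T. ?w (?g t))"
    by (simp add: sum.cartesian_product case_prod_unfold)
  finally have "(n ^ 3 * sqrt (T ^ 3))\<^sup>2 \<le> (\<Sum>t\<in>?T. ?w (?g t))\<^sup>2"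
    using n T by (intro power_mono) auto
  also have "\<dots> \<le> real (card {p \<in> ?T \<times> ?T. ?g (fst p) = ?g (snd p)}) * (\<Sum>z\<in>?g ` ?T. (?w z)\<^sup>2)"
    using A by (intro weighted_Cauchy_Schwarz) simp
  also have "\<dots> \<le> cubic_energy A * sixth_moment A"
  proof (rule mult_mono)
    show "real (card {p \<in> ?T \<times> ?T. ?g (fst p) = ?g (snd p)}) \<le> cubic_energy A"
      by (rule card_shift_pairs_le_cubic_energy[OF A]) auto
    have "(\<Sum>z\<in>?g ` ?T. (?w z)\<^sup>2) = (\<Sum>(x, y)\<in>?g ` ?T. ?r x * ?r y * ?r (x + y))"
      by (intro sum.cong) auto
    also have "\<dots> \<le> (\<Sum>(x, y)\<in>D \<times> D. ?r x * ?r y * ?r (x + y))"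
      using D by (intro sum_mono2) (force simp: D_def)+
    also have "\<dots> = sixth_moment A" unfolding D_def by (rule sixth_moment_eq_diff[OF A, symmetric])
    finally show "(\<Sum>z\<in>?g ` ?T. (?w z)\<^sup>2) \<le> sixth_moment A" .
    show "0 \<le> cubic_energy A" unfolding cubic_energy_def by (intro sum_nonneg) auto
  qed (auto intro!: sum_nonneg)
  finally have "(n ^ 3)\<^sup>2 * T ^ 3 \<le> cubic_energy A * sixth_moment A" using T by (simp add: power_mult_distrib)
  then have "(n ^ 3)\<^sup>2 * (n\<^sup>2) ^ 3 / real (card D) ^ 3 \<le> cubic_energy A * sixth_moment A" by (simp add: T_def power_divide)
  then have "(n ^ 3)\<^sup>2 * (n\<^sup>2) ^ 3 \<le> cubic_energy A * sixth_moment A * real (card D) ^ 3" using D by (simp add: pos_divide_le_eq)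
  then show ?thesis unfolding D_def[symmetric] n_def[symmetric] by (simp add: power_mult[symmetric] power_add[symmetric] mult_ac)
qed simp

lemma energy_lower_bound:
  assumes A: "finite A" and S: "finite S" "(\<lambda>p. fst p + snd p) ` (A \<times> A) \<subseteq> S"
  defines "D \<equiv> (\<lambda>p. fst p - snd p) ` (A \<times> A)"
  shows "real (card A) ^ 4 \<le> real (card S) * (\<Sum>d\<in>D. (rdiff A d)\<^sup>2)"
proof -
  have D: "finite D" "sums_of [A, neg A] \<subseteq> D" using A by (force simp: D_def)+
  have S': "sums_of [A, A] \<subseteq> S" using S(2) by force
  have "real (card A) ^ 2 = real (card (A \<times> A))" by (simp add: card_cartesian_product power2_eq_square)
  also have "\<dots> = (\<Sum>p\<in>A \<times> A. 1)" by simp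
  also have "\<dots> = (\<Sum>s\<in>(\<lambda>p. fst p + snd p) ` (A \<times> A). rsum A s * 1)"
    unfolding rsum_def by (rule sum_fibres) (use A in simp)
  also have "\<dots> \<le> (\<Sum>s\<in>S. rsum A s * 1)" using S by (intro sum_mono2) auto
  finally have "(real (card A) ^ 2)\<^sup>2 \<le> (\<Sum>s\<in>S. rsum A s * 1)\<^sup>2" by (intro power_mono) auto
  also have "\<dots> \<le> (\<Sum>s\<in>S. (rsum A s)\<^sup>2) * (\<Sum>s\<in>S. 1\<^sup>2)" by (rule Cauchy_Schwarz_ineq_sum)
  also have "(\<Sum>s\<in>S. (rsum A s)\<^sup>2) = reps ([A, A] @ map neg [A, A]) 0"
    unfolding rsum_reps[OF A, symmetric] by (rule reps_square[OF S(1) S'])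
  also have "\<dots> = reps ([A, neg A] @ map neg [A, neg A]) 0" by (rule reps_perm) (simp add: image_image)
  also have "\<dots> = (\<Sum>d\<in>D. (rdiff A d)\<^sup>2)"
    unfolding rdiff_reps[OF A, symmetric] by (rule reps_square[OF D, symmetric])
  finally show ?thesis by (simp add: power_mult[symmetric] mult.commute)
qed

text \<open>
  Hoelder's inequality for the exponents \<open>3/2\<close>, \<open>2\<close>, \<open>3\<close>, obtained from two Cauchy-Schwarz steps through the
  moment of order \<open>5/2\<close>.
\<close>

lemma moment_interpolation:
  fixes r :: "'a \<Rightarrow> real"
  assumes "finite D" "\<And>d. d \<in> D \<Longrightarrow> 0 \<le> r d"
  shows "(\<Sum>d\<in>D. (r d)\<^sup>2) ^ 3 \<le> (\<Sum>d\<in>D. r d * sqrt (r d))\<^sup>2 * (\<Sum>d\<in>D. r d ^ 3)"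
proof -
  define E where "E = (\<Sum>d\<in>D. (r d)\<^sup>2)"
  define F where "F = (\<Sum>d\<in>D. r d * sqrt (r d))"
  define G where "G = (\<Sum>d\<in>D. (r d)\<^sup>2 * sqrt (r d))"
  define H where "H = (\<Sum>d\<in>D. r d ^ 3)"
  have nonneg: "0 \<le> E" "0 \<le> F" "0 \<le> G" "0 \<le> H" using assms unfolding E_def F_def G_def H_def by (auto intro!: sum_nonneg)
  let ?q = "\<lambda>d. sqrt (sqrt (r d))"
  have q: "?q d * ?q d = sqrt (r d)" "sqrt (r d) * sqrt (r d) = r d" if "d \<in> D" for d using assms(2)[OF that] by simp_all
  have "E\<^sup>2 = (\<Sum>d\<in>D. (sqrt (r d) * ?q d) * (r d * ?q d))\<^sup>2"
  proof -
    have "(r d)\<^sup>2 = (sqrt (r d) * ?q d) * (r d * ?q d)" if "d \<in> D" for d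
    proof -
      have "(sqrt (r d) * ?q d) * (r d * ?q d) = r d * (sqrt (r d) * (?q d * ?q d))" by (simp only: mult_ac)
      then show ?thesis by (simp only: q[OF that] power2_eq_square)
    qed
    then show ?thesis unfolding E_def by (simp only: cong: sum.cong)
  qed
  also have "\<dots> \<le> (\<Sum>d\<in>D. (sqrt (r d) * ?q d)\<^sup>2) * (\<Sum>d\<in>D. (r d * ?q d)\<^sup>2)" by (rule Cauchy_Schwarz_ineq_sum)
  also have "\<dots> = F * G"
  proof -
    have "(sqrt (r d) * ?q d)\<^sup>2 = r d * sqrt (r d)" "(r d * ?q d)\<^sup>2 = (r d)\<^sup>2 * sqrt (r d)" if "d \<in> D" for d
    proof -
      have "(sqrt (r d) * ?q d)\<^sup>2 = (sqrt (r d) * sqrt (r d)) * (?q d * ?q d)"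
        "(r d * ?q d)\<^sup>2 = (r d)\<^sup>2 * (?q d * ?q d)" by (simp_all only: power2_eq_square mult_ac)
      then show "(sqrt (r d) * ?q d)\<^sup>2 = r d * sqrt (r d)" "(r d * ?q d)\<^sup>2 = (r d)\<^sup>2 * sqrt (r d)"
        by (simp_all only: q[OF that])
    qed
    then show ?thesis unfolding F_def G_def by (simp only: cong: sum.cong)
  qed
  finally have 1: "E\<^sup>2 \<le> F * G" .
  have "G\<^sup>2 = (\<Sum>d\<in>D. r d * (r d * sqrt (r d)))\<^sup>2" unfolding G_def by (simp add: power2_eq_square mult.assoc)
  also have "\<dots> \<le> (\<Sum>d\<in>D. (r d)\<^sup>2) * (\<Sum>d\<in>D. (r d * sqrt (r d))\<^sup>2)" by (rule Cauchy_Schwarz_ineq_sum)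
  also have "(\<Sum>d\<in>D. (r d * sqrt (r d))\<^sup>2) = H"
    unfolding H_def using assms by (intro sum.cong refl) (simp add: power_mult_distrib power2_eq_square power3_eq_cube)
  finally have 2: "G\<^sup>2 \<le> E * H" unfolding E_def .
  have "E * E ^ 3 = (E\<^sup>2)\<^sup>2" by (simp add: power_mult[symmetric] power_Suc[symmetric] del: power_Suc)
  also have "\<dots> \<le> (F * G)\<^sup>2" using 1 by (intro power_mono) auto
  also have "\<dots> = F\<^sup>2 * G\<^sup>2" by (simp add: power_mult_distrib)
  also have "\<dots> \<le> F\<^sup>2 * (E * H)" using 2 by (intro mult_left_mono) auto
  finally have *: "E * E ^ 3 \<le> E * (F\<^sup>2 * H)" by (simp add: mult_ac)
  have "E ^ 3 \<le> F\<^sup>2 * H"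
  proof (cases "E = 0")
    case False
    then have "0 < E" using nonneg by simp
    then show ?thesis using * by (simp only: mult_le_cancel_left_pos)
  qed (use nonneg in simp)
  then show ?thesis unfolding E_def F_def H_def .
qed

text \<open>
  As for differences, now with the fibres of \<open>(a, b, c) \<mapsto> (a + b, b + c)\<close>, where \<open>(a + b) - (b + c)\<close> is the difference \<open>a - c\<close>. The sum over
  \<open>b\<close> needs the tangent inequality for each pair \<open>(a, c)\<close> separately, so \<open>a\<close> and \<open>c\<close> are restricted to the set \<open>A'\<close> of
  elements for which the reciprocal sum \<open>f\<close> is at most twice its average. The remaining sum over \<open>(a, c)\<close> is the moment of order \<open>3/2\<close> of \<open>A'\<close>,
  bounded from below by interpolation between the energy of \<open>A'\<close>, which is large because \<open>S\<close> is small, and \<open>cubic_energy\<close>.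
\<close>

theorem sumset_bound:
  assumes A: "finite A"
  shows "real (card A) ^ 18 \<le> 2 ^ 14 * real (card ((\<lambda>p. fst p + snd p) ` (A \<times> A))) ^ 5 * (cubic_energy A)\<^sup>2 * sixth_moment A"
proof (cases "A = {}")
  case False
  define S where "S = (\<lambda>p. fst p + snd p) ` (A \<times> A)"
  define n where "n = real (card A)"
  define \<sigma> where "\<sigma> = real (card S)"
  have n: "n > 0" using A False by (simp add: n_def card_gt_0_iff)
  have S: "finite S" "\<sigma> > 0" using A False by (auto simp: S_def \<sigma>_def card_gt_0_iff)
  define T where "T = n\<^sup>2 / (2 * \<sigma>)"
  have T: "T > 0" using n S by (simp add: T_def)
  let ?p = "rsum A"
  define f where "f = (\<lambda>a. \<Sum>b\<in>A. 1 / ?p (a + b))"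
  have f0: "0 \<le> f a" for a unfolding f_def by (intro sum_nonneg) auto
  have totf: "(\<Sum>a\<in>A. f a) = \<sigma>" unfolding f_def \<sigma>_def S_def by (rule sum_inverse_rsum[OF A])
  define A' where "A' = {a \<in> A. f a \<le> 2 * \<sigma> / n}"
  have A': "finite A'" "A' \<subseteq> A" using A by (auto simp: A'_def)
  have big: "n / 2 \<le> real (card A')"
  proof -
    have "real (card (A - A')) * (2 * \<sigma> / n) \<le> (\<Sum>a\<in>A - A'. f a)"
      by (rule sum_bounded_below) (auto simp: A'_def)
    also have "\<dots> \<le> \<sigma>" unfolding totf[symmetric] using A f0 by (intro sum_mono2) auto
    finally have "real (card (A - A')) * 2 * \<sigma> \<le> n * \<sigma>" using n by (simp add: field_simps)
    then have "real (card (A - A')) * 2 \<le> n" using S by simp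
    moreover have "card (A - A') = card A - card A'" "card A' \<le> card A" using A A' by (simp_all add: card_Diff_subset card_mono)
    ultimately show ?thesis by (simp add: n_def of_nat_diff)
  qed
  let ?r = "rdiff A'"
  define D where "D = (\<lambda>p. fst p - snd p) ` (A' \<times> A')"
  define F where "F = (\<Sum>d\<in>D. ?r d * sqrt (?r d))"
  have F0: "0 \<le> F" unfolding F_def by (intro sum_nonneg) auto
  let ?T = "A' \<times> A \<times> A'"
  let ?g = "\<lambda>(a, b, c). (a + b, b + c)"
  let ?w = "\<lambda>(x, y). sqrt (?p x * ?p y * ?r (x - y))"
  have pos: "?p (x + y) > 0" if "x \<in> A" "y \<in> A" for x y using rsum_pos[OF A that] by linarith
  have inner: "T * n \<le> (\<Sum>b\<in>A. sqrt (?p (a + b) * ?p (b + c)))" if "a \<in> A'" "c \<in> A'" for a c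
  proof -
    have "f a \<le> 2 * \<sigma> / n" "f c \<le> 2 * \<sigma> / n" using that by (auto simp: A'_def)
    then have "T / 2 * (f a + f c) \<le> T / 2 * (2 * (2 * \<sigma> / n))" using T by (intro mult_left_mono) auto
    also have "\<dots> = n" using n S by (simp add: T_def power2_eq_square)
    finally have "T * n \<le> T * (2 * n - T / 2 * (f a + f c))" using T by (intro mult_left_mono) auto
    also have "\<dots> = (\<Sum>b\<in>A. T * (2 - T / 2 * (1 / ?p (a + b) + 1 / ?p (b + c))))"
      by (simp only: sum_distrib_left[symmetric] sum_subtractf sum.distrib sum_constant)
        (simp add: n_def f_def add.commute)
    also have "\<dots> \<le> (\<Sum>b\<in>A. sqrt (?p (a + b) * ?p (b + c)))"
      using that A'(2) T by (intro sum_mono sqrt_prod2_ge pos) auto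
    finally show ?thesis .
  qed
  have "(T * n) * F = (\<Sum>a\<in>A'. \<Sum>c\<in>A'. (T * n) * sqrt (?r (a - c)))"
  proof -
    have "F = (\<Sum>p\<in>A' \<times> A'. sqrt (?r (fst p - snd p)))"
      unfolding F_def D_def rdiff_def by (rule sum_fibres[symmetric]) (use A' in simp)
    then show ?thesis by (simp add: sum_distrib_left sum.cartesian_product case_prod_unfold)
  qed
  also have "\<dots> \<le> (\<Sum>a\<in>A'. \<Sum>c\<in>A'. (\<Sum>b\<in>A. sqrt (?p (a + b) * ?p (b + c))) * sqrt (?r (a - c)))"
    using inner by (intro sum_mono mult_right_mono) auto
  also have "\<dots> = (\<Sum>a\<in>A'. \<Sum>c\<in>A'. \<Sum>b\<in>A. sqrt (?p (a + b) * ?p (b + c) * ?r (a - c)))"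
    by (simp add: sum_distrib_right real_sqrt_mult)
  also have "\<dots> = (\<Sum>a\<in>A'. \<Sum>b\<in>A. \<Sum>c\<in>A'. sqrt (?p (a + b) * ?p (b + c) * ?r (a - c)))"
    by (intro sum.cong refl sum.swap)
  also have "\<dots> = (\<Sum>t\<in>?T. ?w (?g t))"
    by (simp add: sum.cartesian_product case_prod_unfold)
  finally have "((T * n) * F)\<^sup>2 \<le> (\<Sum>t\<in>?T. ?w (?g t))\<^sup>2"
    using n T F0 by (intro power_mono) auto
  also have "\<dots> \<le> real (card {p \<in> ?T \<times> ?T. ?g (fst p) = ?g (snd p)}) * (\<Sum>z\<in>?g ` ?T. (?w z)\<^sup>2)"
    using A A' by (intro weighted_Cauchy_Schwarz) simp
  also have "\<dots> \<le> cubic_energy A * sixth_moment A"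
  proof (rule mult_mono)
    let ?P = "{p \<in> ?T \<times> ?T. ?g (fst p) = ?g (snd p)}"
    let ?h = "\<lambda>((a, b, c), (a', b', c')). ((a, b', c), (a', b, c'))"
    have "inj_on ?h ?P" by (auto simp: inj_on_def)
    then have "card ?P = card (?h ` ?P)" by (simp only: card_image)
    also have "real \<dots> \<le> cubic_energy A"
      by (rule card_shift_pairs_le_cubic_energy[OF A]) (use A'(2) in \<open>auto simp: algebra_simps\<close>)
    finally show "real (card ?P) \<le> cubic_energy A" .
    have "(\<Sum>z\<in>?g ` ?T. (?w z)\<^sup>2) = (\<Sum>(x, y)\<in>?g ` ?T. ?p x * ?p y * ?r (x - y))"
      by (intro sum.cong) auto
    also have "\<dots> \<le> (\<Sum>(x, y)\<in>S \<times> S. ?p x * ?p y * ?r (x - y))"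
      using S A'(2) by (intro sum_mono2) (force simp: S_def)+
    also have "\<dots> \<le> (\<Sum>(x, y)\<in>S \<times> S. ?p x * ?p y * rdiff A (x - y))"
      using rdiff_mono[OF A A'(2)] by (intro sum_mono) (auto intro!: mult_left_mono)
    also have "\<dots> = sixth_moment A" unfolding S_def by (rule sixth_moment_eq_sum[OF A, symmetric])
    finally show "(\<Sum>z\<in>?g ` ?T. (?w z)\<^sup>2) \<le> sixth_moment A" .
    show "0 \<le> cubic_energy A" unfolding cubic_energy_def by (intro sum_nonneg) auto
  qed (auto intro!: sum_nonneg)
  finally have main: "(T * n)\<^sup>2 * F\<^sup>2 \<le> cubic_energy A * sixth_moment A" by (simp only: power_mult_distrib)
  define E where "E = (\<Sum>d\<in>D. (?r d)\<^sup>2)"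
  have finD: "finite D" using A' by (simp add: D_def)
  have nonneg: "0 \<le> cubic_energy A" unfolding cubic_energy_def by (intro sum_nonneg) auto
  have "(n / 2) ^ 4 \<le> real (card A') ^ 4" using big n by (intro power_mono) auto
  also have "\<dots> \<le> \<sigma> * E" unfolding \<sigma>_def E_def D_def
    using A' S(1) by (intro energy_lower_bound) (force simp: S_def)+
  finally have E: "(n / 2) ^ 4 \<le> \<sigma> * E" .
  have "E ^ 3 \<le> F\<^sup>2 * (\<Sum>d\<in>D. ?r d ^ 3)"
    unfolding E_def F_def by (rule moment_interpolation[OF finD]) simp
  also have "\<dots> \<le> F\<^sup>2 * cubic_energy A"
    using cubic_energy_mono[OF A A'(2)] unfolding cubic_energy_def[of A'] D_def by (intro mult_left_mono) auto
  finally have EF: "E ^ 3 \<le> F\<^sup>2 * cubic_energy A" .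
  have "((n / 2) ^ 4) ^ 3 * (T * n)\<^sup>2 \<le> (\<sigma> * E) ^ 3 * (T * n)\<^sup>2"
    using E n by (intro mult_right_mono power_mono) auto
  also have "\<dots> = \<sigma> ^ 3 * (T * n)\<^sup>2 * E ^ 3" by (simp add: power_mult_distrib mult_ac)
  also have "\<dots> \<le> \<sigma> ^ 3 * (T * n)\<^sup>2 * (F\<^sup>2 * cubic_energy A)" using EF S by (intro mult_left_mono) auto
  also have "\<dots> = \<sigma> ^ 3 * cubic_energy A * ((T * n)\<^sup>2 * F\<^sup>2)" by (simp only: mult_ac)
  also have "\<dots> \<le> \<sigma> ^ 3 * cubic_energy A * (cubic_energy A * sixth_moment A)" using main S nonneg by (intro mult_left_mono) auto
  finally have fin: "((n / 2) ^ 4) ^ 3 * (T * n)\<^sup>2 \<le> \<sigma> ^ 3 * cubic_energy A * (cubic_energy A * sixth_moment A)" .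
  have "n ^ 18 = 2 ^ 14 * \<sigma>\<^sup>2 * (((n / 2) ^ 4) ^ 3 * (T * n)\<^sup>2)"
    using S(2) by (simp add: T_def power_divide power_mult_distrib power_mult[symmetric] field_simps power_add[symmetric])
  also have "\<dots> \<le> 2 ^ 14 * \<sigma>\<^sup>2 * (\<sigma> ^ 3 * cubic_energy A * (cubic_energy A * sixth_moment A))"
    using fin by (intro mult_left_mono) auto
  also have "\<dots> = 2 ^ 14 * \<sigma> ^ 5 * (cubic_energy A)\<^sup>2 * sixth_moment A"
    by (simp add: power2_eq_square eval_nat_numeral mult_ac)
  finally show ?thesis unfolding n_def \<sigma>_def S_def .
qed simp

section \<open>Convex sequences: cubic energy and passage to values\<close>

lemma three_term_AM_GM:
  fixes x y :: real
  assumes "0 < x" "0 < y"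
  shows "3 \<le> 1 / (x * y) + x + y"
proof -
  define s where "s = sqrt (x * y)"
  have s: "s > 0" "s\<^sup>2 = x * y" using assms by (auto simp: s_def)
  have "(2 * s)\<^sup>2 \<le> (x + y)\<^sup>2"
    using s(2) zero_le_power2[of "x - y"] by (simp add: power2_eq_square algebra_simps)
  then have xy: "2 * s \<le> x + y" by (rule power2_le_imp_le) (use assms in simp)
  have "0 \<le> (s - 1)\<^sup>2 * (2 * s + 1)" using s by (intro mult_nonneg_nonneg) auto
  also have "\<dots> = 1 + s\<^sup>2 * (2 * s) - 3 * s\<^sup>2" by (simp add: power2_eq_square algebra_simps)
  also have "\<dots> \<le> 1 + s\<^sup>2 * (x + y) - 3 * s\<^sup>2" using xy by (simp add: mult_left_mono)
  finally have "3 * (x * y) \<le> 1 + (x * y) * (x + y)" using s by simp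
  then show ?thesis using assms by (simp add: field_simps)
qed

text \<open>
  By Hoelder's inequality; here in the form of the tangent inequality at \<open>T = N / m\<close>, the largest possible
  average gap.
\<close>

lemma gap_product_sum:
  fixes x y :: "nat \<Rightarrow> nat"
  assumes x: "\<And>k. k < m \<Longrightarrow> x k < x (Suc k)" "x m < N" and y: "\<And>k. k < m \<Longrightarrow> y k < y (Suc k)" "y m < N"
  shows "real m ^ 3 \<le> (real N)\<^sup>2 * (\<Sum>k<m. 1 / (real (x (Suc k) - x k) * real (y (Suc k) - y k)))"
proof (cases "m = 0")
  case False
  define T where "T = real N / real m"
  have N: "real N > 0" using x(2) by simp
  have T: "T > 0" using False N by (simp add: T_def)
  let ?u = "\<lambda>k. real (x (Suc k)) - real (x k)"
  let ?v = "\<lambda>k. real (y (Suc k)) - real (y k)"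
  have U: "(\<Sum>k<m. ?u k) \<le> real N" "(\<Sum>k<m. ?v k) \<le> real N"
    using x(2) y(2) sum_lessThan_telescope[of "\<lambda>k. real (x k)" m] sum_lessThan_telescope[of "\<lambda>k. real (y k)" m] by auto
  have bound: "3 / T\<^sup>2 - (?u k + ?v k) / T ^ 3 \<le> 1 / (real (x (Suc k) - x k) * real (y (Suc k) - y k))" if "k < m" for k
  proof -
    have pos: "?u k > 0" "?v k > 0" and eq: "real (x (Suc k) - x k) = ?u k" "real (y (Suc k) - y k) = ?v k"
      using x(1)[OF that] y(1)[OF that] by auto
    have "3 \<le> 1 / (?u k / T * (?v k / T)) + ?u k / T + ?v k / T"
      using pos T by (intro three_term_AM_GM) auto
    then have "3 / T\<^sup>2 \<le> (1 / (?u k / T * (?v k / T)) + ?u k / T + ?v k / T) / T\<^sup>2"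
      by (intro divide_right_mono) auto
    also have "\<dots> = 1 / (?u k * ?v k) + (?u k + ?v k) / T ^ 3"
      using T by (simp add: add_divide_distrib power2_eq_square power3_eq_cube)
    finally show ?thesis unfolding eq by simp
  qed
  have "real m ^ 3 = (real N)\<^sup>2 * (real m * (3 / T\<^sup>2) - (real N + real N) / T ^ 3)"
    using False N by (simp add: T_def power2_eq_square power3_eq_cube field_simps)
  also have "\<dots> \<le> (real N)\<^sup>2 * (real m * (3 / T\<^sup>2) - ((\<Sum>k<m. ?u k) + (\<Sum>k<m. ?v k)) / T ^ 3)"
    using U T by (intro mult_left_mono diff_left_mono divide_right_mono add_mono) auto
  also have "real m * (3 / T\<^sup>2) - ((\<Sum>k<m. ?u k) + (\<Sum>k<m. ?v k)) / T ^ 3 = (\<Sum>k<m. 3 / T\<^sup>2 - (?u k + ?v k) / T ^ 3)"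
    by (simp only: sum_subtractf sum_constant card_lessThan sum_divide_distrib[symmetric] sum.distrib)
  also have "(real N)\<^sup>2 * \<dots> \<le> (real N)\<^sup>2 * (\<Sum>k<m. 1 / (real (x (Suc k) - x k) * real (y (Suc k) - y k)))"
    by (intro mult_left_mono sum_mono bound) auto
  finally show ?thesis .
qed simp

context convex_sequence
begin

lemma shift_less:
  assumes "j < j'" "0 < v"
  shows "a (j + v) - a j < a (j' + v) - a j'"
proof -
  have tel: "(\<Sum>k<v. slope (i + k)) = a (i + v) - a i" for i
    using sum_lessThan_telescope[of "\<lambda>k. a (i + k)" v] by simp
  have "(\<Sum>k<v. slope (j + k)) < (\<Sum>k<v. slope (j' + k))"
    using assms by (intro sum_strict_mono slope_less) auto
  then show ?thesis unfolding tel .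
qed

lemma shift_inj: "0 < v \<Longrightarrow> a (j + v) - a j = a (j' + v) - a j' \<Longrightarrow> j = j'"
  using shift_less[of j j' v] shift_less[of j' j v] by (metis less_irrefl linorder_neqE_nat)

lemma a_inj: "inj a"
  using mono by (rule strict_mono_imp_inj_on)

text \<open>
  Order the representations \<open>d = a i - a j\<close> of a difference. Two consecutive ones give
  \<open>a (i + u) - a i = a (j + v) - a j\<close>, and this equation determines \<open>j\<close> from \<open>(u, v, i)\<close>. So every triple \<open>(v, u, i)\<close> occurs for at
  most one \<open>d\<close>. Summing the weight \<open>1 / (u * v)\<close> over all triples gives \<open>N * (harm N)\<^sup>2\<close>, while a difference with \<open>m + 1\<close>
  representations contributes at least \<open>m ^ 3 / N\<^sup>2\<close>.
\<close>

lemma cubic_energy_le: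
  assumes N: "N > 0"
  shows "cubic_energy (a ` {..<N}) \<le> 9 * real N ^ 3 * (harm N)\<^sup>2"
proof -
  define A where "A = a ` {..<N}"
  define D where "D = (\<lambda>p. fst p - snd p) ` (A \<times> A)"
  have finA: "finite A" and finD: "finite D" by (auto simp: A_def D_def)
  define J where "J = (\<lambda>d. {j \<in> {..<N}. a j + d \<in> A})"
  define \<tau> where "\<tau> = (\<lambda>d j. inv a (a j + d))"
  have finJ: "finite (J d)" for d by (simp add: J_def)
  have \<tau>: "a (\<tau> d j) = a j + d" "\<tau> d j < N" if "j \<in> J d" for d j
  proof -
    from that have "a j + d \<in> a ` {..<N}" by (simp add: J_def A_def)
    then obtain i where i: "i < N" "a i = a j + d" by (elim imageE) auto
    then have "\<tau> d j = i" unfolding \<tau>_def by (metis a_inj inv_f_f)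
    then show "a (\<tau> d j) = a j + d" "\<tau> d j < N" using i by auto
  qed
  have \<tau>_mono: "\<tau> d j < \<tau> d j'" if "j \<in> J d" "j' \<in> J d" "j < j'" for d j j'
  proof -
    have "a (\<tau> d j) < a (\<tau> d j')" using \<tau>(1) that mono by (simp add: strict_mono_less)
    then show ?thesis using mono by (simp add: strict_mono_less)
  qed
  have card_J: "rdiff A d = real (card (J d))" for d
  proof -
    have "bij_betw (\<lambda>j. (a j + d, a j)) (J d) {p \<in> A \<times> A. fst p - snd p = d}"
      unfolding bij_betw_def
    proof
      show "inj_on (\<lambda>j. (a j + d, a j)) (J d)" using a_inj by (auto simp: inj_on_def)
      show "(\<lambda>j. (a j + d, a j)) ` J d = {p \<in> A \<times> A. fst p - snd p = d}"
        by (force simp: J_def A_def image_iff)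
    qed
    then show ?thesis unfolding rdiff_def using bij_betw_same_card by fastforce
  qed
  have J_pos: "card (J d) > 0" if "d \<in> D" for d
  proof -
    have "1 \<le> rdiff A d" using rdiff_pos[OF finA] that by (auto simp: D_def)
    then show ?thesis using card_J by simp
  qed
  define xs where "xs = (\<lambda>d. sorted_list_of_set (J d))"
  define x where "x = (\<lambda>d k. xs d ! k)"
  define y where "y = (\<lambda>d k. \<tau> d (x d k))"
  define m where "m = (\<lambda>d. card (J d) - 1)"
  have xJ: "x d k \<in> J d" if "k < card (J d)" for d k
  proof -
    have "x d k \<in> set (xs d)" using that by (simp add: x_def xs_def)
    then show ?thesis using finJ by (simp add: xs_def)
  qed
  have x_less: "x d k < x d k'" if "k < k'" "k' < card (J d)" for d k k'
    unfolding x_def xs_def using that strict_sorted_list_of_set[of "J d"]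
    by (simp add: sorted_wrt_iff_nth_less)
  have x_N: "x d k < N" if "k < card (J d)" for d k using xJ[OF that] by (simp add: J_def)
  have y_N: "y d k < N" if "k < card (J d)" for d k unfolding y_def by (rule \<tau>(2)[OF xJ[OF that]])
  have y_less: "y d k < y d k'" if "k < k'" "k' < card (J d)" for d k k'
    unfolding y_def using that by (intro \<tau>_mono xJ x_less) auto
  have ay: "a (y d k) = a (x d k) + d" if "k < card (J d)" for d k unfolding y_def by (rule \<tau>(1)[OF xJ[OF that]])
  let ?P = "SIGMA d:D. {..<m d}"
  let ?G = "\<lambda>(d, k). (x d (Suc k) - x d k, y d (Suc k) - y d k, y d k)"
  let ?B = "{1..N} \<times> {1..N} \<times> {..<N}"
  let ?f = "\<lambda>(u, v, i). 1 / (real u * real v)"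
  have Pk: "k < card (J d)" "Suc k < card (J d)" if "(d, k) \<in> ?P" for d k using that by (auto simp: m_def)
  have inj: "inj_on ?G ?P"
  proof (rule inj_onI)
    fix p p' assume p: "p \<in> ?P" "p' \<in> ?P" and eq: "?G p = ?G p'"
    obtain d k d' k' where dk: "p = (d, k)" "p' = (d', k')" by (metis surj_pair)
    define u v where "u = y d (Suc k) - y d k" and "v = x d (Suc k) - x d k"
    have k: "k < card (J d)" "Suc k < card (J d)" "k' < card (J d')" "Suc k' < card (J d')"
      using Pk p unfolding dk by blast+
    have e: "x d' (Suc k') - x d' k' = v" "y d' (Suc k') - y d' k' = u" "y d' k' = y d k"
      using eq unfolding dk u_def v_def by auto
    have s: "x d (Suc k) = x d k + v" "x d' (Suc k') = x d' k' + v" "y d (Suc k) = y d k + u" "y d' (Suc k') = y d k + u" "0 < v"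
      using x_less[of k "Suc k" d] x_less[of k' "Suc k'" d'] y_less[of k "Suc k" d] y_less[of k' "Suc k'" d'] k e
      unfolding u_def v_def by auto
    have "a (x d k + v) - a (x d k) = a (y d k + u) - a (y d k)"
      using ay[OF k(1)] ay[OF k(2)] s by simp
    moreover have "a (x d' k' + v) - a (x d' k') = a (y d k + u) - a (y d k)"
      using ay[OF k(3)] ay[OF k(4)] s e by simp
    ultimately have xx: "x d k = x d' k'" using shift_inj[OF s(5)] by metis
    then have d: "d = d'" using ay[OF k(1)] ay[OF k(3)] e(3) by simp
    moreover have "k = k'"
      using x_less[of k k' d] x_less[of k' k d] xx k d by (metis less_irrefl linorder_neqE_nat)
    ultimately show "p = p'" unfolding dk by simp
  qed
  have "(\<Sum>d\<in>D. real (m d) ^ 3) \<le> (\<Sum>d\<in>D. (real N)\<^sup>2 * (\<Sum>k<m d. ?f (?G (d, k))))"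
  proof (rule sum_mono)
    fix d assume "d \<in> D"
    then have "m d < card (J d)" using J_pos by (simp add: m_def)
    then have "real (m d) ^ 3 \<le> (real N)\<^sup>2 * (\<Sum>k<m d. 1 / (real (x d (Suc k) - x d k) * real (y d (Suc k) - y d k)))"
      by (intro gap_product_sum x_less y_less x_N y_N) auto
    then show "real (m d) ^ 3 \<le> (real N)\<^sup>2 * (\<Sum>k<m d. ?f (?G (d, k)))" by simp
  qed
  also have "\<dots> = (real N)\<^sup>2 * (\<Sum>p\<in>?P. ?f (?G p))"
    using finD by (simp add: sum_distrib_left[symmetric] sum.Sigma case_prod_unfold)
  also have "(\<Sum>p\<in>?P. ?f (?G p)) = (\<Sum>q\<in>?G ` ?P. ?f q)" by (simp add: sum.reindex[OF inj])
  also have "\<dots> \<le> (\<Sum>q\<in>?B. ?f q)"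
  proof (rule sum_mono2)
    show "?G ` ?P \<subseteq> ?B"
    proof
      fix q assume "q \<in> ?G ` ?P"
      then obtain d k where dk: "(d, k) \<in> ?P" "q = ?G (d, k)" by blast
      note k = Pk[OF dk(1)]
      show "q \<in> ?B" using x_less[of k "Suc k" d] y_less[of k "Suc k" d] x_N[OF k(2)] y_N[OF k(2)] y_N[OF k(1)] k dk(2)
        by auto
    qed
  qed auto
  also have "\<dots> = real N * (harm N)\<^sup>2"
  proof -
    have "(\<Sum>q\<in>?B. ?f q) = (\<Sum>u\<in>{1..N}. \<Sum>v\<in>{1..N}. \<Sum>i<N. 1 / (real u * real v))"
      by (simp only: sum.cartesian_product)
    also have "\<dots> = (\<Sum>u\<in>{1..N}. \<Sum>v\<in>{1..N}. real N * (inverse (real u) * inverse (real v)))"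
      by (simp add: inverse_eq_divide)
    also have "\<dots> = real N * ((\<Sum>u\<in>{1..N}. inverse (real u)) * (\<Sum>v\<in>{1..N}. inverse (real v)))"
      by (simp only: sum_product sum_distrib_left[symmetric])
    finally show ?thesis by (simp add: harm_def power2_eq_square)
  qed
  finally have main: "(\<Sum>d\<in>D. real (m d) ^ 3) \<le> real N ^ 3 * (harm N)\<^sup>2"
    by (simp add: mult_left_mono power2_eq_square power3_eq_cube mult.assoc)
  have "harm 1 \<le> (harm N :: real)" using N by (intro harm_mono) auto
  then have h1: "1 \<le> (harm N :: real)" by (simp add: harm_def)
  have "real (card D) \<le> real (card (A \<times> A))" unfolding D_def using finA by (intro of_nat_mono card_image_le) simp
  also have "\<dots> = real N ^ 2 * 1"
    using card_image[OF inj_on_subset[OF a_inj subset_UNIV, of "{..<N}"]]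
    by (simp add: A_def card_cartesian_product power2_eq_square)
  also have "\<dots> \<le> real N ^ 3 * (harm N)\<^sup>2"
    using N h1 by (intro mult_mono power_increasing one_le_power) auto
  finally have cD: "real (card D) \<le> real N ^ 3 * (harm N)\<^sup>2" .
  have "cubic_energy A = (\<Sum>d\<in>D. real (card (J d)) ^ 3)" unfolding cubic_energy_def D_def card_J ..
  also have "\<dots> \<le> (\<Sum>d\<in>D. 8 * real (m d) ^ 3 + 1)"
  proof (rule sum_mono)
    fix d assume "d \<in> D"
    then have c: "card (J d) = Suc (m d)" using J_pos[of d] by (simp add: m_def)
    show "real (card (J d)) ^ 3 \<le> 8 * real (m d) ^ 3 + 1"
    proof (cases "m d = 0")
      case False
      then have "real (card (J d)) ^ 3 \<le> (2 * real (m d)) ^ 3" unfolding c by (intro power_mono) auto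
      then show ?thesis by (simp add: power_mult_distrib)
    qed (simp add: c)
  qed
  also have "\<dots> = 8 * (\<Sum>d\<in>D. real (m d) ^ 3) + real (card D)" by (simp add: sum.distrib sum_distrib_left)
  also have "\<dots> \<le> 9 * real N ^ 3 * (harm N)\<^sup>2" using main cD by simp
  finally show ?thesis unfolding A_def .
qed

end

lemma reps_snd:
  assumes "\<And>X. X \<in> set Xs \<Longrightarrow> inj_on snd X \<and> finite X" "finite F" "\<And>n z. n \<notin> F \<Longrightarrow> reps Xs (n, z) = 0"
  shows "reps (map ((`) snd) Xs) z = (\<Sum>n\<in>F. reps Xs (n, z))"
  using assms
proof (induction Xs arbitrary: F z)
  case Nil
  have "(0::'a) \<in> F" using Nil(3)[of 0 0] by (auto simp: zero_prod_def split: if_splits)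
  then have "(\<Sum>n\<in>F. reps [] (n, z)) = (\<Sum>n\<in>{0::'a}. reps [] (n, z))"
    by (intro sum.mono_neutral_right) (use Nil(2) \<open>0 \<in> F\<close> in \<open>auto simp: zero_prod_def\<close>)
  then show ?case by (simp add: zero_prod_def)
next
  case (Cons X Xs)
  have X: "inj_on snd X" "finite X" using Cons.prems(1) by auto
  have "reps (map ((`) snd) (X # Xs)) z = (\<Sum>x\<in>X. reps (map ((`) snd) Xs) (z - snd x))"
    using X by (simp add: sum.reindex)
  also have "\<dots> = (\<Sum>x\<in>X. \<Sum>n\<in>F. reps Xs ((n, z) - x))"
  proof (rule sum.cong[OF refl])
    fix x assume x: "x \<in> X"
    have inj: "inj_on (\<lambda>n. n - fst x) F" by (simp add: inj_on_def)
    have "reps (map ((`) snd) Xs) (z - snd x) = (\<Sum>n\<in>(\<lambda>n. n - fst x) ` F. reps Xs (n, z - snd x))"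
    proof (rule Cons.IH)
      fix n w assume n: "n \<notin> (\<lambda>n. n - fst x) ` F"
      have "n + fst x \<notin> F"
      proof
        assume "n + fst x \<in> F"
        then have "(n + fst x) - fst x \<in> (\<lambda>n. n - fst x) ` F" by (rule imageI)
        then show False using n by simp
      qed
      then have "(\<Sum>x'\<in>X. reps Xs ((n + fst x, w + snd x) - x')) = 0"
        using Cons.prems(3)[of "n + fst x" "w + snd x"] by simp
      then have "reps Xs ((n + fst x, w + snd x) - x) = 0"
        using x X(2) by (subst (asm) sum_nonneg_eq_0_iff) auto
      then show "reps Xs (n, w) = 0" by (simp add: minus_prod_def)
    qed (use Cons.prems in auto)
    also have "\<dots> = (\<Sum>n\<in>F. reps Xs ((n, z) - x))"
      by (subst sum.reindex[OF inj]) (simp add: minus_prod_def)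
    finally show "reps (map ((`) snd) Xs) (z - snd x) = (\<Sum>n\<in>F. reps Xs ((n, z) - x))" .
  qed
  also have "\<dots> = (\<Sum>n\<in>F. \<Sum>x\<in>X. reps Xs ((n, z) - x))" by (rule sum.swap)
  finally show ?case by simp
qed

context convex_sequence
begin

text \<open>
  The difference of the two index sums takes at most \<open>6 * N + 1\<close> values, and by Cauchy-Schwarz no value is
  attained more often than \<open>0\<close>.
\<close>

lemma sixth_moment_values_le:
  assumes X: "X \<subseteq> {..<N}"
  shows "sixth_moment (a ` X) \<le> (6 * real N + 1) * sixth X"
proof -
  let ?P = "point ` X"
  let ?L = "[?P, ?P, ?P, neg ?P, neg ?P, neg ?P]"
  define F where "F = real_of_int ` {- (3 * int N)..3 * int N}"
  have finX: "finite X" using X finite_subset by blast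
  have sndP: "snd ` ?P = a ` X" by (force simp: point_def)
  have sndN: "snd ` neg ?P = neg (a ` X)" by (force simp: point_def)
  have inj: "inj_on snd ?P" using a_inj by (auto simp: inj_on_def point_def)
  have injN: "inj_on snd (neg ?P)" using a_inj by (auto simp: inj_on_def point_def)
  have support: "reps ?L (n, z) = 0" if "n \<notin> F" for n z
  proof (rule ccontr)
    assume "reps ?L (n, z) \<noteq> 0"
    then obtain xs where L: "list_all2 (\<in>) xs ?L" and e': "sum_list xs = (n, z)" using reps_witness by blast
    from L obtain p1 p2 p3 q1 q2 q3 where xs: "xs = [p1, p2, p3, q1, q2, q3]"
      and p: "p1 \<in> ?P" "p2 \<in> ?P" "p3 \<in> ?P" and q: "q1 \<in> neg ?P" "q2 \<in> neg ?P" "q3 \<in> neg ?P"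
      unfolding list_all2_Cons2 list_all2_Nil2 by (elim exE conjE) simp
    have e: "p1 + (p2 + (p3 + (q1 + (q2 + q3)))) = (n, z)" using e' unfolding xs by simp
    obtain i1 i2 i3 where i: "p1 = point i1" "p2 = point i2" "p3 = point i3" "{i1, i2, i3} \<subseteq> X" using p by auto
    obtain j1 j2 j3 where j: "q1 = - point j1" "q2 = - point j2" "q3 = - point j3" "{j1, j2, j3} \<subseteq> X"
      using q by auto
    have m: "{i1, i2, i3, j1, j2, j3} \<subseteq> X" using i j by simp
    have n: "n = real_of_int (int i1 + int i2 + int i3 - int j1 - int j2 - int j3)"
      using e unfolding i j by (simp add: point_def)
    have "i1 < N" "i2 < N" "i3 < N" "j1 < N" "j2 < N" "j3 < N" using m X by auto
    then have "n \<in> F" unfolding n F_def by (intro imageI) auto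
    then show False using that by simp
  qed
  have "sixth_moment (a ` X) = reps (map ((`) snd) ?L) 0" unfolding sixth_moment_def by (simp only: list.map sndP sndN)
  also have "\<dots> = (\<Sum>n\<in>F. reps ?L (n, 0))"
    using finX inj injN support by (intro reps_snd) (auto simp: F_def)
  also have "\<dots> \<le> (\<Sum>n\<in>F. sixth X)"
  proof (rule sum_mono)
    fix n
    have "(reps ([?P, ?P, ?P] @ [neg ?P, neg ?P, neg ?P]) (n, 0))\<^sup>2 \<le>
        reps ([?P, ?P, ?P] @ map neg [?P, ?P, ?P]) 0 * reps ([neg ?P, neg ?P, neg ?P] @ map neg [neg ?P, neg ?P, neg ?P]) 0"
      using finX by (intro reps_Cauchy_Schwarz) auto
    also have "reps ([?P, ?P, ?P] @ map neg [?P, ?P, ?P]) 0 = sixth X" by (simp add: sixth_moment_def del: reps.simps)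
    also have "reps ([neg ?P, neg ?P, neg ?P] @ map neg [neg ?P, neg ?P, neg ?P]) 0 = sixth X"
      unfolding sixth_moment_def by (rule reps_perm) (simp add: image_image)
    finally have "(reps ?L (n, 0))\<^sup>2 \<le> (sixth X)\<^sup>2" by (simp add: power2_eq_square del: reps.simps)
    then show "reps ?L (n, 0) \<le> sixth X" by (rule power2_le_imp_le) simp
  qed
  also have "\<dots> = real (card F) * sixth X" by simp
  also have "card F = card {- (3 * int N)..3 * int N}" unfolding F_def by (rule card_image) (simp add: inj_on_def)
  finally show ?thesis by simp
qed

end

section \<open>Lower bounds for sums and differences\<close>

lemma nat_root_exists:
  fixes d N :: nat
  assumes "d > 0"
  obtains K :: nat where "K ^ d \<le> N" "N < (K + 1) ^ d"
proof -
  define K where "K = (GREATEST k. k ^ d \<le> N)"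
  have bound: "k \<le> N" if k: "k ^ d \<le> N" for k :: nat
  proof -
    show "k \<le> N"
    proof (cases "k = 0")
      case False
      then have "k \<le> k ^ d" using assms by (intro self_le_power) auto
      then show ?thesis using k by linarith
    qed simp
  qed
  have "(0::nat) ^ d \<le> N" using assms by (simp add: zero_power)
  then have "K ^ d \<le> N" unfolding K_def by (rule GreatestI_nat[where P = "\<lambda>k. k ^ d \<le> N"]) (rule bound)
  moreover have "\<not> (K + 1) ^ d \<le> N"
  proof
    assume "(K + 1) ^ d \<le> N"
    then have "K + 1 \<le> K" unfolding K_def by (rule Greatest_le_nat[where P = "\<lambda>k. k ^ d \<le> N"]) (rule bound)
    then show False by simp
  qed
  ultimately show thesis using that by simp
qed

text \<open>
  The number \<open>m\<close> of rounds depends on \<open>\<delta>\<close> alone, then \<open>d\<close> is taken so large that \<open>M powr B\<close> is at most \<open>N powr (\<delta>/2)\<close>. The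
  density \<open>(4 * D) powr -d\<close> is the loss of a constant factor at each of the \<open>d\<close> levels, as \<open>K \<le> 4 * D * M\<close>.
\<close>

theorem subset_with_small_sixth_moment:
  fixes \<delta> :: real
  assumes \<delta>: "0 < \<delta>"
  shows "\<exists>c N0. 0 < c \<and> (\<forall>N\<ge>N0. \<forall>a. convex_sequence a \<longrightarrow>
    (\<exists>X\<subseteq>{..<N}. c * real N \<le> real (card X) \<and> sixth_moment (a ` X) \<le> 7 * real N powr (4 + \<delta>)))"
proof -
  define \<eta> where "\<eta> = \<delta> / 2"
  define m where "m = nat \<lceil>64 / \<eta>\<rceil> + 3"
  define B :: real where "B = 9 * 2 ^ m"
  define d where "d = nat \<lceil>B / \<eta>\<rceil> + 1"
  define D where "D = 4 * d + 6"
  define K0 where "K0 = max (2 ^ (d + 1)) (2 * D)"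
  have \<eta>: "0 < \<eta>" using \<delta> by (simp add: \<eta>_def)
  have m: "64 \<le> \<eta> * real m" "3 \<le> m"
  proof -
    have "64 / \<eta> \<le> real m" unfolding m_def by linarith
    then show "64 \<le> \<eta> * real m" using \<eta> by (simp add: pos_divide_le_eq mult.commute)
  qed (simp add: m_def)
  have d: "B / real d \<le> \<eta>" "d > 0"
  proof -
    have "B / \<eta> \<le> real d" unfolding d_def by linarith
    then show "B / real d \<le> \<eta>" using \<eta> by (simp add: d_def field_simps)
  qed (simp add: d_def)
  have D: "D > 0" by (simp add: D_def)
  have "\<exists>X\<subseteq>{..<N}. 1 / (4 * real D) ^ d * real N \<le> real (card X) \<and> sixth_moment (a ` X) \<le> 7 * real N powr (4 + \<delta>)"
    if N: "N \<ge> (K0 + 1) ^ d" and "convex_sequence a" for N a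
  proof -
    interpret convex_sequence a by fact
    obtain K where K: "K ^ d \<le> N" "N < (K + 1) ^ d" by (rule nat_root_exists[OF d(2)])
    have "(K0 + 1) ^ d < (K + 1) ^ d" using N K by linarith
    then have "K0 + 1 < K + 1" by (rule power_less_imp_less_base) simp
    then have K0: "2 ^ (d + 1) \<le> K" "2 * D \<le> K" by (auto simp: K0_def)
    define M where "M = K div D"
    have MD: "M * D \<le> K" unfolding M_def by simp
    have M2: "M \<ge> 2" unfolding M_def using K0(2) D by (metis div_le_mono nonzero_mult_div_cancel_right less_not_refl)
    have K2: "K \<ge> 2" using K0(2) D by linarith
    have "M * (4 * d + 6) \<le> K" using MD by (simp add: D_def)
    then obtain X where X: "branch K M d d 0 X" using branch_exists[OF K2, of M d d 0] by blast
    have sub: "X \<subseteq> {..<N}" using branch_range[OF X] K(1) by auto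
    have "1 / (4 * real D) ^ d * real N \<le> real (card X)"
    proof -
      have "K < (M + 1) * D" unfolding M_def using D by (simp add: dividend_less_div_times add.commute)
      then have "K + 1 \<le> (M + 1) * D" by simp
      also have "\<dots> \<le> (4 * M) * D" using M2 by (intro mult_right_mono) auto
      finally have "K + 1 \<le> M * (4 * D)" by simp
      then have "N \<le> (M * (4 * D)) ^ d" using K(2) by (meson le_trans less_imp_le power_mono zero_le)
      then have "real N \<le> real (M ^ d * (4 * D) ^ d)" by (simp only: power_mult_distrib of_nat_le_iff)
      then show ?thesis using D branch_card[OF X] by (simp add: pos_divide_le_eq)
    qed
    moreover have "sixth_moment (a ` X) \<le> 7 * real N powr (4 + \<delta>)"
    proof -
      have N1: "real N \<ge> 1" using N by (metis Suc_leI add_gr_0 less_le_trans of_nat_1 of_nat_le_iff One_nat_def zero_less_one zero_less_power)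
      have "sixth X \<le> real M powr ((3 + \<eta>) * real d + B)"
        using sixth_moment_branch[OF \<eta> m B_def M2 K0(1) order.refl order.refl X] .
      also have "\<dots> = (real M powr real d) powr (3 + \<eta> + B / real d)"
        using d(2) by (simp add: powr_powr algebra_simps)
      also have "\<dots> \<le> real N powr (3 + \<eta> + B / real d)"
      proof (rule powr_mono2)
        have "M ^ d \<le> K ^ d" using MD D by (intro power_mono) (auto intro: order_trans[OF _ MD])
        then have "real (M ^ d) \<le> real N" using K(1) by (simp only: of_nat_le_iff)
        then show "real M powr real d \<le> real N" using M2 by (simp add: powr_realpow)
        show "0 \<le> 3 + \<eta> + B / real d" using \<eta> by (simp add: B_def)
      qed simp
      also have "\<dots> \<le> real N powr (3 + \<delta>)"
      proof (rule powr_mono)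
        have "\<eta> + \<eta> = \<delta>" by (simp add: \<eta>_def)
        then show "3 + \<eta> + B / real d \<le> 3 + \<delta>" using d(1) by linarith
      qed (use N1 in simp)
      finally have "(6 * real N + 1) * sixth X \<le> (7 * real N) * real N powr (3 + \<delta>)"
        using N1 by (intro mult_mono) auto
      also have "\<dots> = 7 * real N powr (4 + \<delta>)" using N1 powr_add[of "real N" 1 "3 + \<delta>"] by simp
      finally show ?thesis using sixth_moment_values_le[OF sub] by linarith
    qed
    ultimately show ?thesis using sub by blast
  qed
  then show ?thesis using D
    by (intro exI[of _ "1 / (4 * real D) ^ d"] exI[of _ "(K0 + 1) ^ d"]) auto
qed

lemma harm_le_powr:
  assumes "N \<ge> 1" "0 < \<delta>"
  shows "harm N \<le> (1 + 1 / \<delta>) * real N powr \<delta>"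
proof -
  obtain k where k: "N = Suc k" using assms by (cases N) auto
  have "harm (Suc k) - ln (real (Suc k)) \<le> harm (Suc 0) - ln (real (Suc 0))"
    using decseqD[OF decseq_harm_diff_ln, of 0 k] by simp
  then have 1: "harm N \<le> 1 + ln (real N)" unfolding k by (simp add: harm_def)
  have "\<delta> * ln (real N) = ln (real N powr \<delta>)" using assms by (simp add: ln_powr)
  also have "\<dots> \<le> real N powr \<delta> - 1" using assms by (intro ln_le_minus_one) simp
  finally have "ln (real N) \<le> real N powr \<delta> / \<delta>" using assms by (simp add: pos_le_divide_eq mult.commute)
  moreover have "1 \<le> real N powr \<delta>" using assms by (simp add: ge_one_powr_ge_zero)
  ultimately show ?thesis using 1 by (simp add: distrib_right)
qed

text \<open>
  Beyond the given terms, each slope exceeds the previous one by one.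
\<close>

lemma convex_seq_extend:
  assumes "convex_seq N a"
  obtains b where "convex_sequence b" "b ` {..<N} = a ` {1..N}"
proof -
  have N: "N > 1" and inc: "strict_mono_on {1..N} a"
    and conv: "\<And>k. 2 \<le> k \<Longrightarrow> k \<le> N - 1 \<Longrightarrow> a k - a (k - 1) < a (k + 1) - a k"
    using assms by (auto simp: convex_seq_def)
  define s where "s = (\<lambda>j. if j < N - 1 then a (j + 2) - a (j + 1) else a N - a (N - 1) + real (j + 2 - N))"
  define b where "b = (\<lambda>i. a 1 + (\<Sum>j<i. s j))"
  have "s j < s (Suc j)" for j
  proof (cases "Suc j < N - 1")
    case True
    then show ?thesis using conv[of "j + 2"] by (simp add: s_def numeral_eq_Suc)
  next
    case False
    show ?thesis
    proof (cases "Suc j = N - 1")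
      case True
      then have "N = j + 2" using N by simp
      then show ?thesis by (simp add: s_def numeral_eq_Suc)
    next
      case False
      then have "N - 1 \<le> j" using \<open>\<not> Suc j < N - 1\<close> by simp
      then show ?thesis using N by (auto simp: s_def of_nat_diff)
    qed
  qed
  then have s: "strict_mono s" by (simp add: strict_mono_Suc_iff)
  have s0: "0 < s 0" using N inc by (auto simp: s_def strict_mono_on_def numeral_eq_Suc)
  have pos: "0 < s j" for j using s0 strict_mono_less_eq[OF s, of 0 j] by linarith
  have slope: "b (Suc i) - b i = s i" for i by (simp add: b_def)
  have "convex_sequence b"
  proof
    show "strict_mono b" using pos by (simp add: strict_mono_Suc_iff b_def)
    show "strict_mono (\<lambda>i. b (Suc i) - b i)" unfolding slope by (rule s)
  qed
  moreover have bi: "b i = a (Suc i)" if "i < N" for i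
    using that
  proof (induction i)
    case (Suc i)
    then have "i < N - 1" by simp
    then have "s i = a (i + 2) - a (i + 1)" by (simp add: s_def)
    then show ?case using Suc slope[of i] by simp
  qed (simp add: b_def)
  moreover have "b ` {..<N} = a ` {1..N}"
  proof -
    have "b ` {..<N} = (\<lambda>i. a (Suc i)) ` {..<N}" using bi by (intro image_cong) auto
    also have "\<dots> = a ` Suc ` {..<N}" by (simp add: image_image)
    also have "Suc ` {..<N} = {1..N}" using image_Suc_lessThan by auto
    finally show ?thesis .
  qed
  ultimately show thesis using that by blast
qed

lemma powr_le_of_power_le:
  fixes x C N p :: real and k :: nat
  assumes "0 < C" "0 < k" "0 \<le> x" "C * N powr (real k * p) \<le> x ^ k" "0 \<le> N"
  shows "root k C * N powr p \<le> x"
proof -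
  have "(root k C * N powr p) ^ k = C * N powr (real k * p)"
    using assms by (cases "N = 0") (simp_all add: power_mult_distrib powr_power mult.commute)
  also have "\<dots> \<le> x ^ k" by fact
  finally show ?thesis using assms by (simp add: power_mono_iff)
qed

lemma convex_values_lower_bounds:
  fixes \<epsilon> :: real
  assumes \<epsilon>: "0 < \<epsilon>"
  shows "\<exists>c N0. 0 < c \<and> (\<forall>N\<ge>N0. \<forall>b. convex_sequence b \<longrightarrow>
    c * real N powr (5 / 3 - \<epsilon>) \<le> real (card ((\<lambda>p. fst p - snd p) ` (b ` {..<N} \<times> b ` {..<N}))) \<and>
    c * real N powr (8 / 5 - \<epsilon>) \<le> real (card ((\<lambda>p. fst p + snd p) ` (b ` {..<N} \<times> b ` {..<N}))))"
proof -
  obtain c N0 where c: "0 < c" and rich: "\<And>N a. N \<ge> N0 \<Longrightarrow> convex_sequence a \<Longrightarrow>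
    \<exists>X\<subseteq>{..<N}. c * real N \<le> real (card X) \<and> sixth_moment (a ` X) \<le> 7 * real N powr (4 + \<epsilon>)"
    using subset_with_small_sixth_moment[OF \<epsilon>] by blast
  define \<kappa> where "\<kappa> = 9 * (1 + 1 / (\<epsilon> / 2))\<^sup>2"
  have \<kappa>: "\<kappa> > 0" using \<epsilon> unfolding \<kappa>_def by (intro mult_pos_pos zero_less_power add_pos_pos) auto
  define C1 where "C1 = c ^ 12 / (7 * \<kappa>)"
  define C2 where "C2 = c ^ 18 / (2 ^ 14 * 7 * \<kappa>\<^sup>2)"
  have C: "C1 > 0" "C2 > 0" using c \<kappa> by (auto simp: C1_def C2_def)
  have "root 3 C1 * real N powr (5 / 3 - \<epsilon>) \<le> real (card ((\<lambda>p. fst p - snd p) ` (b ` {..<N} \<times> b ` {..<N}))) \<and>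
    root 5 C2 * real N powr (8 / 5 - \<epsilon>) \<le> real (card ((\<lambda>p. fst p + snd p) ` (b ` {..<N} \<times> b ` {..<N})))"
    if N: "N \<ge> max N0 1" and "convex_sequence b" for N b
  proof -
    interpret convex_sequence b by fact
    have N1: "1 \<le> N" "1 \<le> real N" using N by auto
    obtain X where X: "X \<subseteq> {..<N}" "c * real N \<le> real (card X)" "sixth_moment (b ` X) \<le> 7 * real N powr (4 + \<epsilon>)"
      using rich[OF _ \<open>convex_sequence b\<close>, of N] N by auto
    let ?A = "b ` {..<N}" and ?A' = "b ` X"
    have fin: "finite ?A" "?A' \<subseteq> ?A" "finite ?A'" using X(1) finite_subset by blast+
    have AA: "?A' \<times> ?A' \<subseteq> ?A \<times> ?A" using fin(2) by (intro Sigma_mono)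
    have n: "c * real N \<le> real (card ?A')"
      using X(2) card_image[OF inj_on_subset[OF a_inj subset_UNIV, of X]] by simp
    have "cubic_energy ?A' \<le> cubic_energy ?A" by (rule cubic_energy_mono[OF fin(1,2)])
    also have "\<dots> \<le> 9 * real N ^ 3 * (harm N)\<^sup>2" using N1 by (intro cubic_energy_le) auto
    also have "\<dots> \<le> 9 * real N ^ 3 * ((1 + 1 / (\<epsilon> / 2)) * real N powr (\<epsilon> / 2))\<^sup>2"
      using harm_le_powr[OF N1(1), of "\<epsilon> / 2"] \<epsilon> by (intro mult_left_mono power_mono harm_nonneg) auto
    also have "\<dots> = \<kappa> * real N powr (3 + \<epsilon>)"
    proof -
      have "real N ^ 3 = real N powr 3" using powr_realpow[of "real N" 3] N1 by simp
      moreover have "(real N powr (\<epsilon> / 2))\<^sup>2 = real N powr \<epsilon>" by (simp add: power2_eq_square powr_add[symmetric])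
      ultimately show ?thesis by (simp add: \<kappa>_def power_mult_distrib powr_add)
    qed
    finally have E: "cubic_energy ?A' \<le> \<kappa> * real N powr (3 + \<epsilon>)" .
    have E0: "0 \<le> cubic_energy ?A'" unfolding cubic_energy_def by (intro sum_nonneg) auto
    define d where "d = real (card ((\<lambda>p. fst p - snd p) ` (?A \<times> ?A)))"
    define \<sigma> where "\<sigma> = real (card ((\<lambda>p. fst p + snd p) ` (?A \<times> ?A)))"
    have "real (card ((\<lambda>p. fst p - snd p) ` (?A' \<times> ?A'))) \<le> d"
      unfolding d_def using fin(1) by (intro of_nat_mono card_mono image_mono AA) simp
    then have "real (card ?A') ^ 12 \<le> d ^ 3 * (\<kappa> * real N powr (3 + \<epsilon>)) * (7 * real N powr (4 + \<epsilon>))"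
      using difference_set_bound[OF fin(3)] E X(3) E0 \<kappa>
      by (elim order_trans) (intro mult_mono power_mono; simp)
    moreover have "(c * real N) ^ 12 \<le> real (card ?A') ^ 12" using n c by (intro power_mono) auto
    ultimately have *: "(c * real N) ^ 12 \<le> d ^ 3 * (\<kappa> * real N powr (3 + \<epsilon>)) * (7 * real N powr (4 + \<epsilon>))" by linarith
    have "c ^ 12 * real N powr 12 \<le> d ^ 3 * (7 * \<kappa>) * real N powr (7 + 2 * \<epsilon>)"
    proof -
      have "real N powr 12 = real N ^ 12" using powr_realpow[of "real N" 12] N1 by simp
      moreover have "real N powr (7 + 2 * \<epsilon>) = real N powr (3 + \<epsilon>) * real N powr (4 + \<epsilon>)" by (simp add: powr_add[symmetric])
      ultimately show ?thesis using * by (simp add: power_mult_distrib mult_ac)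
    qed
    then have "c ^ 12 * real N powr 12 / real N powr (7 + 2 * \<epsilon>) \<le> d ^ 3 * (7 * \<kappa>)"
      using N1 by (simp add: pos_divide_le_eq)
    then have "c ^ 12 * real N powr (5 - 2 * \<epsilon>) \<le> d ^ 3 * (7 * \<kappa>)"
      using powr_diff[of "real N" 12 "7 + 2 * \<epsilon>"] by simp
    then have "C1 * real N powr (5 - 2 * \<epsilon>) \<le> d ^ 3" using \<kappa> by (simp add: C1_def pos_divide_le_eq)
    moreover have "C1 * real N powr (real 3 * (5 / 3 - \<epsilon>)) \<le> C1 * real N powr (5 - 2 * \<epsilon>)"
      using N1 C \<epsilon> by (intro mult_left_mono powr_mono) auto
    ultimately have "C1 * real N powr (real 3 * (5 / 3 - \<epsilon>)) \<le> d ^ 3" by linarith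
    then have 1: "root 3 C1 * real N powr (5 / 3 - \<epsilon>) \<le> d"
      by (rule powr_le_of_power_le[rotated 3]) (use C in \<open>simp_all add: d_def\<close>)
    have "real (card ((\<lambda>p. fst p + snd p) ` (?A' \<times> ?A'))) \<le> \<sigma>"
      unfolding \<sigma>_def using fin(1) by (intro of_nat_mono card_mono image_mono AA) simp
    then have "real (card ?A') ^ 18 \<le> 2 ^ 14 * \<sigma> ^ 5 * (\<kappa> * real N powr (3 + \<epsilon>))\<^sup>2 * (7 * real N powr (4 + \<epsilon>))"
      using sumset_bound[OF fin(3)] E X(3) E0 \<kappa>
      by (elim order_trans) (intro mult_mono power_mono; simp)
    moreover have "(c * real N) ^ 18 \<le> real (card ?A') ^ 18" using n c by (intro power_mono) auto
    ultimately have **: "(c * real N) ^ 18 \<le> 2 ^ 14 * \<sigma> ^ 5 * (\<kappa> * real N powr (3 + \<epsilon>))\<^sup>2 * (7 * real N powr (4 + \<epsilon>))" by linarith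
    have "c ^ 18 * real N powr 18 \<le> \<sigma> ^ 5 * (2 ^ 14 * 7 * \<kappa>\<^sup>2) * real N powr (10 + 3 * \<epsilon>)"
    proof -
      have "real N powr 18 = real N ^ 18" using powr_realpow[of "real N" 18] N1 by simp
      moreover have "real N powr (10 + 3 * \<epsilon>) = (real N powr (3 + \<epsilon>))\<^sup>2 * real N powr (4 + \<epsilon>)"
        by (simp add: power2_eq_square powr_add[symmetric])
      ultimately show ?thesis using ** by (simp add: power_mult_distrib mult_ac)
    qed
    then have "c ^ 18 * real N powr 18 / real N powr (10 + 3 * \<epsilon>) \<le> \<sigma> ^ 5 * (2 ^ 14 * 7 * \<kappa>\<^sup>2)"
      using N1 by (simp add: pos_divide_le_eq)
    then have "c ^ 18 * real N powr (8 - 3 * \<epsilon>) \<le> \<sigma> ^ 5 * (2 ^ 14 * 7 * \<kappa>\<^sup>2)"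
      using powr_diff[of "real N" 18 "10 + 3 * \<epsilon>"] by simp
    then have "C2 * real N powr (8 - 3 * \<epsilon>) \<le> \<sigma> ^ 5" using \<kappa> by (simp add: C2_def pos_divide_le_eq)
    moreover have "C2 * real N powr (real 5 * (8 / 5 - \<epsilon>)) \<le> C2 * real N powr (8 - 3 * \<epsilon>)"
      using N1 C \<epsilon> by (intro mult_left_mono powr_mono) auto
    ultimately have "C2 * real N powr (real 5 * (8 / 5 - \<epsilon>)) \<le> \<sigma> ^ 5" by linarith
    then have "root 5 C2 * real N powr (8 / 5 - \<epsilon>) \<le> \<sigma>"
      by (rule powr_le_of_power_le[rotated 3]) (use C in \<open>simp_all add: \<sigma>_def\<close>)
    with 1 show ?thesis unfolding d_def \<sigma>_def by blast
  qed
  note both = this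
  define e where "e = min (root 3 C1) (root 5 C2)"
  have e: "0 < e" "e \<le> root 3 C1" "e \<le> root 5 C2" using C by (auto simp: e_def)
  show ?thesis
  proof (intro exI[of _ e] exI[of _ "max N0 1"] conjI allI impI e(1))
    fix N b assume N: "max N0 1 \<le> N" "convex_sequence b"
    show "e * real N powr (5 / 3 - \<epsilon>) \<le> real (card ((\<lambda>p. fst p - snd p) ` (b ` {..<N} \<times> b ` {..<N})))"
      using both[OF N] mult_right_mono[OF e(2), of "real N powr (5 / 3 - \<epsilon>)"] by auto
    show "e * real N powr (8 / 5 - \<epsilon>) \<le> real (card ((\<lambda>p. fst p + snd p) ` (b ` {..<N} \<times> b ` {..<N})))"
      using both[OF N] mult_right_mono[OF e(3), of "real N powr (8 / 5 - \<epsilon>)"] by auto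
  qed
qed

lemma diffset_eq: "diffset A B = (\<lambda>p. fst p - snd p) ` (A \<times> B)"
  unfolding diffset_def by force

lemma sumset_eq: "sumset A B = (\<lambda>p. fst p + snd p) ` (A \<times> B)"
  unfolding sumset_def by force

theorem theorem1p6:
  shows "\<forall>\<epsilon>::real. \<epsilon> > 0 \<longrightarrow> (\<exists>c::real. c > 0 \<and>
    (\<forall>N::nat. N \<ge> 2 \<longrightarrow> (\<forall>(a :: nat \<Rightarrow> real) (A :: real set).
      convex_seq N a \<and> A = a ` {1..N} \<longrightarrow>
        real (card (diffset A A)) \<ge> c * real (card A) powr (5/3 - \<epsilon>) \<and>
        real (card (sumset A A)) \<ge> c * real (card A) powr (8/5 - \<epsilon>))))"
proof (intro allI impI)
  fix \<epsilon> :: real assume \<epsilon>: "\<epsilon> > 0"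
  obtain c N0 where c: "0 < c" and big: "\<And>N b. N \<ge> N0 \<Longrightarrow> convex_sequence b \<Longrightarrow>
    c * real N powr (5 / 3 - \<epsilon>) \<le> real (card ((\<lambda>p. fst p - snd p) ` (b ` {..<N} \<times> b ` {..<N}))) \<and>
    c * real N powr (8 / 5 - \<epsilon>) \<le> real (card ((\<lambda>p. fst p + snd p) ` (b ` {..<N} \<times> b ` {..<N})))"
    using convex_values_lower_bounds[OF \<epsilon>] by blast
  define c' where "c' = min c (1 / (real N0 + 1)\<^sup>2)"
  have c': "0 < c'" "c' \<le> c" "c' \<le> 1 / (real N0 + 1)\<^sup>2" using c by (auto simp: c'_def)
  show "\<exists>c>0. \<forall>N::nat. N \<ge> 2 \<longrightarrow> (\<forall>(a :: nat \<Rightarrow> real) (A :: real set).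
      convex_seq N a \<and> A = a ` {1..N} \<longrightarrow>
        real (card (diffset A A)) \<ge> c * real (card A) powr (5/3 - \<epsilon>) \<and>
        real (card (sumset A A)) \<ge> c * real (card A) powr (8/5 - \<epsilon>))"
  proof (intro exI[of _ c'] conjI allI impI c'(1))
    fix N :: nat and a :: "nat \<Rightarrow> real" and A :: "real set"
    assume N: "N \<ge> 2" and aA: "convex_seq N a \<and> A = a ` {1..N}"
    obtain b where b: "convex_sequence b" "b ` {..<N} = A" using convex_seq_extend aA by metis
    have finA: "finite A" and neA: "A \<noteq> {}" using aA N by auto
    have "inj_on a {1..N}" using aA strict_mono_on_imp_inj_on unfolding convex_seq_def by blast
    then have cardA: "card A = N" using aA card_image by fastforce
    have small: "c' * real N powr p \<le> real (card T)"
      if "N < N0" "p \<le> 2" "finite T" "T \<noteq> {}" for p and T :: "real set"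
    proof -
      have "real N powr p \<le> real N powr 2" using N that by (intro powr_mono) auto
      also have "\<dots> = (real N)\<^sup>2" using N powr_realpow[of "real N" 2] by simp
      also have "\<dots> \<le> (real N0 + 1)\<^sup>2" using that by (intro power_mono) auto
      finally have "c' * real N powr p \<le> 1 / (real N0 + 1)\<^sup>2 * (real N0 + 1)\<^sup>2"
        using c' by (intro mult_mono) auto
      also have "\<dots> \<le> 1" by simp
      also have "1 \<le> real (card T)" using that by (simp add: Suc_le_eq card_gt_0_iff)
      finally show ?thesis .
    qed
    have ne: "finite (diffset A A)" "diffset A A \<noteq> {}" "finite (sumset A A)" "sumset A A \<noteq> {}"
      using finA neA by (auto simp: diffset_eq sumset_eq)
    have large: "c' * real N powr (5 / 3 - \<epsilon>) \<le> real (card (diffset A A)) \<and>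
        c' * real N powr (8 / 5 - \<epsilon>) \<le> real (card (sumset A A))" if "N0 \<le> N"
      using big[OF that b(1)] mult_right_mono[OF c'(2), of "real N powr (5 / 3 - \<epsilon>)"]
        mult_right_mono[OF c'(2), of "real N powr (8 / 5 - \<epsilon>)"]
      unfolding b(2) diffset_eq sumset_eq by auto
    show "real (card (diffset A A)) \<ge> c' * real (card A) powr (5/3 - \<epsilon>)"
      unfolding cardA using large small[OF _ _ ne(1,2), of "5 / 3 - \<epsilon>"] \<epsilon> by (cases "N0 \<le> N") auto
    show "real (card (sumset A A)) \<ge> c' * real (card A) powr (8/5 - \<epsilon>)"
      unfolding cardA using large small[OF _ _ ne(3,4), of "8 / 5 - \<epsilon>"] \<epsilon> by (cases "N0 \<le> N") auto
  qed
qed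

end
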